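(* Let $k,n$ be positive integers. There is an isomorphism of $\mathrm{U}_q(\mathfrak{q}_n)$-supermodule superalgebras $$\tau:\mathsf{A}_{k,n}^{\Pi}\rightarrow\mathsf{A}_{k,n}$$ such that $$\tau\bigl(\check{T}_+\bigr)=T_+(J\otimes1),$$ where $\check T_+=\sum_{i=1}^k\sum_{a\in I_{n|n}}E_{ia}\otimes t_{ia}^{\pi}$ and $T_+=\sum_{i=1}^k\sum_{a\in I_{n|n}}E_{ia}\otimes t_{ia}$ are the generator matrices, $J=\sum_{a\in I_{n|n}}(-1)^{|a|}E_{-a,a}$, and $\tau$ is applied to the second tensor factor.
   Context: **Conventions.** The base field is $\mathbb{C}(q)$. Tensor products of superalgebras use the Koszul sign rule $(x\otimes y)(x'\otimes y')=(-1)^{|y||x'|}xx'\otimes yy'$. For $N\ge1$, $I_{N|N}=\{-N,\dots,-1,1,\dots,N\}$, with $|i|=\bar0$ if $i>0$ and $|i|=\bar1$ if $i<0$. Matrix units $E_{ij}$ (possibly rectangular) have parity $|i|+|j|$. $\delta_{a<b}$ is $1$ if $a<b$ and $0$ otherwise; $\xi=q-q^{-1}$; $\varphi(i,j)=(-1)^{|j|}(\delta_{ij}+\delta_{i,-j})$. $V_q$ is the superspace with basis $v_i$, $i\in I_{n|n}$, $|v_i|=|i|$, and $$S=\sum_{i,j\in I_{n|n}}q^{\varphi(i,j)}E_{ii}\otimes E_{jj}+\xi\sum_{i<j}(-1)^{|i|}(E_{ji}+E_{-j,-i})\otimes E_{ij}=\sum_{i,j}S_{ij}\otimes E_{ij}\in\mathrm{End}(V_q)^{\otimes2}.$$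 Superscripts indicate tensor positions, and a bracketed position is the one occupied by entries in a superalgebra other than a matrix superalgebra, e.g. $T^{1[3]}=\sum E_{ia}\otimes1\otimes t_{ia}$. **$\mathrm{U}_q(\mathfrak{q}_n)$** is the unital associative superalgebra generated by $L_{ij}$ of parity $|i|+|j|$, $i,j\in I_{n|n}$, $i\le j$, with relations $L_{ii}L_{-i,-i}=1=L_{-i,-i}L_{ii}$ and $L^{[1]2}L^{[1]3}S^{23}=S^{23}L^{[1]3}L^{[1]2}$, where $L=\sum_{i\le j}L_{ij}\otimes E_{ij}$ (put $L_{ij}=0$ for $i>j$). It is a Hopf superalgebra with $\Delta(L)=L\otimes L$, i.e. $\Delta(L_{ij})=\sum_k(-1)^{(|i|+|k|)(|k|+|j|)}L_{ik}\otimes L_{kj}$, $\varepsilon(L)=1$, antipode $L\mapsto L^{-1}$. A $\mathrm{U}_q(\mathfrak{q}_n)$-supermodule superalgebra is a unital associative superalgebra $B$ that is a $\mathrm{U}_q(\mathfrak{q}_n)$-supermodule with $u.(ab)=\sum_{(u)}(-1)^{|u_{(2)}||a|}(u_{(1)}.a)(u_{(2)}.b)$ and $u.1=\varepsilon(u)1$. **Matrices.** $R_+=\sum_{i,j=1}^kq^{\delta_{ij}}E_{ii}\otimes E_{jj}+\xi\sum_{1\le i<j\le k}E_{ji}\otimes E_{ij}$, and $$S_J=(1\otimes J)S(1\otimes J)=-\sum_{a,b\in I_{n|n}}q^{-\varphi(a,b)}E_{aa}\otimes E_{bb}+\xi\sum_{b<a}(-1)^{|a|}(E_{ba}+E_{-b,-a})\otimes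 E_{ab}.$$ **$\mathsf{A}_{k,n}$** (quantum coordinate superalgebra): unital associative superalgebra generated by $t_{ia}$ of parity $|i|+|a|$, $i\in I_{k|k}$, $a\in I_{n|n}$, with relations $t_{ia}=t_{-i,-a}$ and $S^{12}T^{1[3]}T^{2[3]}=T^{2[3]}T^{1[3]}S^{12}$, $T=\sum E_{ia}\otimes t_{ia}$ (the left $S$ is the matrix of the same form with indices in $I_{k|k}$). It is equivalently presented by generators $t_{ia}$, $1\le i\le k$, $a\in I_{n|n}$, with the relation $R_+^{12}T_+^{1[3]}T_+^{2[3]}=T_+^{2[3]}T_+^{1[3]}S^{12}$. It is a $\mathrm{U}_q(\mathfrak{q}_n)$-supermodule superalgebra with action $\Phi$ determined by $L^{[2]3}\cdot_\Phi T^{1[2]}=T^{1[2]}S^{13}$. **$\mathsf{A}_{k,n}^{\Pi}$**: unital associative superalgebra with generators $t_{ia}^{\pi}$ of parity $|a|+\bar1$, $1\le i\le k$, $a\in I_{n|n}$, and defining relation $R_+^{12}\check T_+^{1[3]}\check T_+^{2[3]}=\check T_+^{2[3]}\check T_+^{1[3]}S_J^{12}$. It is a $\mathrm{U}_q(\mathfrak{q}_n)$-supermodule superalgebra with action $\Phi^\pi$ determined by $L^{[2]3}\cdot_{\Phi^\pi}\check T_+^{1[2]}=\check T_+^{1[2]}S^{13}$. In both cases, for a matrix $M=\sum E_{ic}\otimes m_{ic}$ of generators, $L^{[2]3}\cdot M^{1[2]}$ denotes $\sum(-1)^{(|a|+|b|)|m_{ic}|}E_{ic}\otimes (L_{ab}.m_{ic})\otimes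 E_{ab}$. *)

theory Defs
  imports
    "HOL-Algebra.QuotRing"
    "HOL-Algebra.Module"
    "HOL-Algebra.Algebraic_Closure_Type"
    "HOL-Library.Poly_Mapping"
    "HOL-Library.Z2"
begin

section \<open>The base field and signs\<close>

type_synonym Cq = "complex poly fract"

definition qvar :: Cq where
  "qvar = Fract [:0, 1:] 1"

definition xi :: Cq where
  "xi = qvar - inverse qvar"

abbreviation Cq_ring :: "Cq ring" where
  "Cq_ring \<equiv> ring_of_type_algebra"

text \<open>Parities are elements of the two-element field \<^typ>\<open>bit\<close>; \<open>ksign p\<close> is $(-1)^p$.\<close>

definition ksign :: "bit \<Rightarrow> Cq" where
  "ksign p = (if p = 0 then 1 else -1)"


section \<open>Superalgebras and supermodules\<close>

record 'a superalg = "(Cq, 'a) module" +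
  hpart :: "bit \<Rightarrow> 'a set"

text \<open>A superspace only uses the additive, scalar and grading fields of the record.\<close>

locale superspace = module "Cq_ring" M for M :: "'a superalg" (structure) +
  assumes hpart_submodule: "submodule (hpart M p) Cq_ring M"
    and hpart_direct_sum:
      "x \<in> carrier M \<Longrightarrow> \<exists>!y. y \<in> hpart M 0 \<times> hpart M 1 \<and> x = fst y \<oplus> snd y"

locale superalgebra = superspace A + ring A for A :: "'a superalg" (structure) +
  assumes smult_mult_left:
      "\<lbrakk>x \<in> carrier A; y \<in> carrier A\<rbrakk> \<Longrightarrow> (c \<odot> x) \<otimes> y = c \<odot> (x \<otimes> y)"
    and smult_mult_right:
      "\<lbrakk>x \<in> carrier A; y \<in> carrier A\<rbrakk> \<Longrightarrow> x \<otimes> (c \<odot> y) = c \<odot> (x \<otimes> y)"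
    and one_even: "\<one> \<in> hpart A 0"
    and mult_hpart: "\<lbrakk>x \<in> hpart A p; y \<in> hpart A r\<rbrakk> \<Longrightarrow> x \<otimes> y \<in> hpart A (p + r)"

definition superalgebra_iso :: "'a superalg \<Rightarrow> 'b superalg \<Rightarrow> ('a \<Rightarrow> 'b) \<Rightarrow> bool" where
  "superalgebra_iso A B f \<longleftrightarrow>
     superalgebra A \<and> superalgebra B \<and> f \<in> ring_iso A B \<and>
     (\<forall>c. \<forall>x\<in>carrier A. f (c \<odot>\<^bsub>A\<^esub> x) = c \<odot>\<^bsub>B\<^esub> f x) \<and>
     (\<forall>p. f ` hpart A p \<subseteq> hpart B p)"

locale supermodule = U: superalgebra U + M: superspace M
  for U :: "'u superalg" and M :: "'a superalg" +
  fixes act :: "'u \<Rightarrow> 'a \<Rightarrow> 'a"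
  assumes act_closed: "\<lbrakk>u \<in> carrier U; x \<in> carrier M\<rbrakk> \<Longrightarrow> act u x \<in> carrier M"
    and act_add_left: "\<lbrakk>u \<in> carrier U; v \<in> carrier U; x \<in> carrier M\<rbrakk>
      \<Longrightarrow> act (u \<oplus>\<^bsub>U\<^esub> v) x = act u x \<oplus>\<^bsub>M\<^esub> act v x"
    and act_add_right: "\<lbrakk>u \<in> carrier U; x \<in> carrier M; y \<in> carrier M\<rbrakk>
      \<Longrightarrow> act u (x \<oplus>\<^bsub>M\<^esub> y) = act u x \<oplus>\<^bsub>M\<^esub> act u y"
    and act_smult_left: "\<lbrakk>u \<in> carrier U; x \<in> carrier M\<rbrakk>
      \<Longrightarrow> act (c \<odot>\<^bsub>U\<^esub> u) x = c \<odot>\<^bsub>M\<^esub> act u x"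
    and act_smult_right: "\<lbrakk>u \<in> carrier U; x \<in> carrier M\<rbrakk>
      \<Longrightarrow> act u (c \<odot>\<^bsub>M\<^esub> x) = c \<odot>\<^bsub>M\<^esub> act u x"
    and act_one: "x \<in> carrier M \<Longrightarrow> act \<one>\<^bsub>U\<^esub> x = x"
    and act_mult: "\<lbrakk>u \<in> carrier U; v \<in> carrier U; x \<in> carrier M\<rbrakk>
      \<Longrightarrow> act (u \<otimes>\<^bsub>U\<^esub> v) x = act u (act v x)"
    and act_hpart: "\<lbrakk>u \<in> hpart U p; x \<in> hpart M r\<rbrakk> \<Longrightarrow> act u x \<in> hpart M (p + r)"


section \<open>Superalgebras with a basis and their Koszul tensor products\<close>

text \<open>
  A superalgebra with a homogeneous basis indexed by \<open>'b\<close> is given by the parity of each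
  basis vector and the product of each pair of basis vectors. Its elements are the finitely
  supported functions \<open>'b \<Rightarrow>\<^sub>0 Cq\<close>. The constructions \<open>mat_sa\<close> and \<open>free_sa\<close>
  and iterated tensor products of them provide the spaces in which the matrix relations live.
\<close>

record 'b based_sa =
  bpar :: "'b \<Rightarrow> bit"
  bmul :: "'b \<Rightarrow> 'b \<Rightarrow> ('b \<Rightarrow>\<^sub>0 Cq)"

definition scale :: "Cq \<Rightarrow> ('b \<Rightarrow>\<^sub>0 Cq) \<Rightarrow> ('b \<Rightarrow>\<^sub>0 Cq)" where
  "scale c x = Poly_Mapping.map ((*) c) x"

definition sprod :: "'b based_sa \<Rightarrow> ('b \<Rightarrow>\<^sub>0 Cq) \<Rightarrow> ('b \<Rightarrow>\<^sub>0 Cq) \<Rightarrow> ('b \<Rightarrow>\<^sub>0 Cq)" where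
  "sprod A x y = (\<Sum>b\<in>Poly_Mapping.keys x. \<Sum>c\<in>Poly_Mapping.keys y.
     scale (Poly_Mapping.lookup x b * Poly_Mapping.lookup y c) (bmul A b c))"

abbreviation sprod_infix ("(_ \<star>\<^bsub>_\<^esub> _)" [70, 0, 71] 70) where
  "x \<star>\<^bsub>A\<^esub> y \<equiv> sprod A x y"

definition tens :: "('b \<Rightarrow>\<^sub>0 Cq) \<Rightarrow> ('c \<Rightarrow>\<^sub>0 Cq) \<Rightarrow> ('b \<times> 'c \<Rightarrow>\<^sub>0 Cq)" (infixr "\<otimes>\<^sub>t" 75) where
  "x \<otimes>\<^sub>t y = (\<Sum>b\<in>Poly_Mapping.keys x. \<Sum>c\<in>Poly_Mapping.keys y.
     Poly_Mapping.single (b, c) (Poly_Mapping.lookup x b * Poly_Mapping.lookup y c))"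

definition tens_sa :: "'b based_sa \<Rightarrow> 'c based_sa \<Rightarrow> ('b \<times> 'c) based_sa" (infixr "\<otimes>\<^sub>s" 75) where
  "A \<otimes>\<^sub>s B = \<lparr>
     bpar = (\<lambda>(b, c). bpar A b + bpar B c),
     bmul = (\<lambda>(b, c) (b', c').
       scale (ksign (bpar B c * bpar A b')) (bmul A b b' \<otimes>\<^sub>t bmul B c c'))\<rparr>"

definition word_par :: "('g \<Rightarrow> bit) \<Rightarrow> 'g list \<Rightarrow> bit" where
  "word_par par w = sum_list (map par w)"

definition free_sa :: "('g \<Rightarrow> bit) \<Rightarrow> 'g list based_sa" where
  "free_sa par = \<lparr>bpar = word_par par, bmul = (\<lambda>v w. Poly_Mapping.single (v @ w) 1)\<rparr>"

definition free_one :: "'g list \<Rightarrow>\<^sub>0 Cq" where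
  "free_one = Poly_Mapping.single [] 1"

definition gen :: "'g \<Rightarrow> ('g list \<Rightarrow>\<^sub>0 Cq)" where
  "gen g = Poly_Mapping.single [g] 1"


section \<open>Superalgebras by generators and relations\<close>

definition free_ring :: "('g \<Rightarrow> bit) \<Rightarrow> 'g set \<Rightarrow> ('g list \<Rightarrow>\<^sub>0 Cq) ring" where
  "free_ring par G = \<lparr>
     carrier = {x. Poly_Mapping.keys x \<subseteq> lists G},
     monoid.mult = sprod (free_sa par),
     one = free_one,
     ring.zero = 0,
     add = (+)\<rparr>"

definition rel_ideal :: "('g \<Rightarrow> bit) \<Rightarrow> 'g set \<Rightarrow> ('g list \<Rightarrow>\<^sub>0 Cq) set \<Rightarrow> ('g list \<Rightarrow>\<^sub>0 Cq) set" where
  "rel_ideal par G R = genideal (free_ring par G) R"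

definition pres_class ::
  "('g \<Rightarrow> bit) \<Rightarrow> 'g set \<Rightarrow> ('g list \<Rightarrow>\<^sub>0 Cq) set \<Rightarrow> ('g list \<Rightarrow>\<^sub>0 Cq) \<Rightarrow> ('g list \<Rightarrow>\<^sub>0 Cq) set" where
  "pres_class par G R x = rel_ideal par G R +>\<^bsub>free_ring par G\<^esub> x"

definition presented ::
  "('g \<Rightarrow> bit) \<Rightarrow> 'g set \<Rightarrow> ('g list \<Rightarrow>\<^sub>0 Cq) set \<Rightarrow> ('g list \<Rightarrow>\<^sub>0 Cq) set superalg" where
  "presented par G R = (let Q = free_ring par G Quot rel_ideal par G R in \<lparr>
     carrier = carrier Q,
     monoid.mult = monoid.mult Q,
     one = one Q,
     ring.zero = ring.zero Q,
     add = add Q,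
     module.smult = (\<lambda>c y. pres_class par G R (Poly_Mapping.single [] c) \<otimes>\<^bsub>Q\<^esub> y),
     hpart = (\<lambda>p. {pres_class par G R x | x.
       Poly_Mapping.keys x \<subseteq> lists G \<and> (\<forall>w\<in>Poly_Mapping.keys x. word_par par w = p)})\<rparr>)"


section \<open>Index sets, matrix units and the matrices $S$, $R_+$, $J$, $S_J$\<close>

definition idx :: "nat \<Rightarrow> int set" where
  "idx N = {- int N..int N} - {0}"

definition ipar :: "int \<Rightarrow> bit" where
  "ipar i = (if i > 0 then 0 else 1)"

definition pair_par :: "int \<times> int \<Rightarrow> bit" where
  "pair_par = (\<lambda>(i, j). ipar i + ipar j)"

text \<open>
  All matrix units, square or rectangular, are taken in one algebra of finite matrices with
  rows and columns indexed by \<^typ>\<open>int\<close>. That algebra has no unit, so identity matrices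
  \<open>idm Z\<close> carry their index set.
\<close>

definition mat_sa :: "(int \<times> int) based_sa" where
  "mat_sa = \<lparr>bpar = pair_par,
     bmul = (\<lambda>(i, j) (k, l). if j = k then Poly_Mapping.single (i, l) 1 else 0)\<rparr>"

definition E :: "int \<Rightarrow> int \<Rightarrow> (int \<times> int \<Rightarrow>\<^sub>0 Cq)" where
  "E i j = Poly_Mapping.single (i, j) 1"

definition idm :: "int set \<Rightarrow> (int \<times> int \<Rightarrow>\<^sub>0 Cq)" where
  "idm Z = (\<Sum>i\<in>Z. E i i)"

definition phi :: "int \<Rightarrow> int \<Rightarrow> int" where
  "phi i j = (if ipar j = 0 then 1 else -1) * (of_bool (i = j) + of_bool (i = - j))"

definition Smat :: "nat \<Rightarrow> ((int \<times> int) \<times> (int \<times> int) \<Rightarrow>\<^sub>0 Cq)" where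
  "Smat N =
     (\<Sum>i\<in>idx N. \<Sum>j\<in>idx N. scale (qvar powi phi i j) (E i i \<otimes>\<^sub>t E j j)) +
     scale xi (\<Sum>i\<in>idx N. \<Sum>j\<in>{j\<in>idx N. i < j}.
       scale (ksign (ipar i)) ((E j i + E (- j) (- i)) \<otimes>\<^sub>t E i j))"

definition Rplus :: "nat \<Rightarrow> ((int \<times> int) \<times> (int \<times> int) \<Rightarrow>\<^sub>0 Cq)" where
  "Rplus k =
     (\<Sum>i\<in>{1..int k}. \<Sum>j\<in>{1..int k}.
       scale (if i = j then qvar else 1) (E i i \<otimes>\<^sub>t E j j)) +
     scale xi (\<Sum>i\<in>{1..int k}. \<Sum>j\<in>{i<..int k}. E j i \<otimes>\<^sub>t E i j)"

definition Jmat :: "nat \<Rightarrow> (int \<times> int \<Rightarrow>\<^sub>0 Cq)" where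
  "Jmat n = (\<Sum>a\<in>idx n. scale (ksign (ipar a)) (E (- a) a))"

definition SJ :: "nat \<Rightarrow> ((int \<times> int) \<times> (int \<times> int) \<Rightarrow>\<^sub>0 Cq)" where
  "SJ n = ((idm (idx n) \<otimes>\<^sub>t Jmat n) \<star>\<^bsub>mat_sa \<otimes>\<^sub>s mat_sa\<^esub> Smat n)
            \<star>\<^bsub>mat_sa \<otimes>\<^sub>s mat_sa\<^esub> (idm (idx n) \<otimes>\<^sub>t Jmat n)"

text \<open>
  Placing an element of $\mathrm{End}\otimes\mathrm{End}$ in two of three tensor positions, with
  the unit (the empty word) of a free superalgebra in the remaining one.
\<close>

definition put12 :: "('b \<times> 'c \<Rightarrow>\<^sub>0 Cq) \<Rightarrow> ('b \<times> 'c \<times> 'g list \<Rightarrow>\<^sub>0 Cq)" where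
  "put12 x = (\<Sum>z\<in>Poly_Mapping.keys x.
     Poly_Mapping.single (fst z, snd z, []) (Poly_Mapping.lookup x z))"

definition put13 :: "('b \<times> 'c \<Rightarrow>\<^sub>0 Cq) \<Rightarrow> ('b \<times> 'g list \<times> 'c \<Rightarrow>\<^sub>0 Cq)" where
  "put13 x = (\<Sum>z\<in>Poly_Mapping.keys x.
     Poly_Mapping.single (fst z, [], snd z) (Poly_Mapping.lookup x z))"

definition put23 :: "('b \<times> 'c \<Rightarrow>\<^sub>0 Cq) \<Rightarrow> ('g list \<times> 'b \<times> 'c \<Rightarrow>\<^sub>0 Cq)" where
  "put23 x = (\<Sum>z\<in>Poly_Mapping.keys x.
     Poly_Mapping.single ([], fst z, snd z) (Poly_Mapping.lookup x z))"

text \<open>Coefficients of matrix units, as elements of the free superalgebra in position 1, 2 or 3.\<close>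

definition coeff1 :: "'b \<Rightarrow> 'c \<Rightarrow> ('g list \<times> 'b \<times> 'c \<Rightarrow>\<^sub>0 Cq) \<Rightarrow> ('g list \<Rightarrow>\<^sub>0 Cq)" where
  "coeff1 b c x = Poly_Mapping.map_key (\<lambda>w. (w, b, c)) x"

definition coeff2 :: "'b \<Rightarrow> 'c \<Rightarrow> ('b \<times> 'g list \<times> 'c \<Rightarrow>\<^sub>0 Cq) \<Rightarrow> ('g list \<Rightarrow>\<^sub>0 Cq)" where
  "coeff2 b c x = Poly_Mapping.map_key (\<lambda>w. (b, w, c)) x"

definition coeff3 :: "'b \<Rightarrow> 'c \<Rightarrow> ('b \<times> 'c \<times> 'g list \<Rightarrow>\<^sub>0 Cq) \<Rightarrow> ('g list \<Rightarrow>\<^sub>0 Cq)" where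
  "coeff3 b c x = Poly_Mapping.map_key (\<lambda>w. (b, c, w)) x"

definition entry :: "'b \<Rightarrow> ('b \<times> 'g list \<Rightarrow>\<^sub>0 Cq) \<Rightarrow> ('g list \<Rightarrow>\<^sub>0 Cq)" where
  "entry b x = Poly_Mapping.map_key (\<lambda>w. (b, w)) x"


section \<open>$\mathrm{U}_q(\mathfrak{q}_n)$\<close>

definition Uq_gens :: "nat \<Rightarrow> (int \<times> int) set" where
  "Uq_gens n = {(i, j). i \<in> idx n \<and> j \<in> idx n \<and> i \<le> j}"

definition Lgen :: "int \<Rightarrow> int \<Rightarrow> ((int \<times> int) list \<Rightarrow>\<^sub>0 Cq)" where
  "Lgen i j = (if i \<le> j then gen (i, j) else 0)"

definition L12 :: "nat \<Rightarrow> ((int \<times> int) list \<times> (int \<times> int) \<times> (int \<times> int) \<Rightarrow>\<^sub>0 Cq)" where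
  "L12 n = (\<Sum>i\<in>idx n. \<Sum>j\<in>idx n. Lgen i j \<otimes>\<^sub>t E i j \<otimes>\<^sub>t idm (idx n))"

definition L13 :: "nat \<Rightarrow> ((int \<times> int) list \<times> (int \<times> int) \<times> (int \<times> int) \<Rightarrow>\<^sub>0 Cq)" where
  "L13 n = (\<Sum>i\<in>idx n. \<Sum>j\<in>idx n. Lgen i j \<otimes>\<^sub>t idm (idx n) \<otimes>\<^sub>t E i j)"

abbreviation (input) Uq_free :: "(int \<times> int) list based_sa" where
  "Uq_free \<equiv> free_sa pair_par"

definition Uq_rels :: "nat \<Rightarrow> ((int \<times> int) list \<Rightarrow>\<^sub>0 Cq) set" where
  "Uq_rels n =
     {Lgen i i \<star>\<^bsub>Uq_free\<^esub> Lgen (- i) (- i) - free_one | i. i \<in> idx n} \<union>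
     (let W = Uq_free \<otimes>\<^sub>s mat_sa \<otimes>\<^sub>s mat_sa in
      {coeff1 p r (L12 n \<star>\<^bsub>W\<^esub> L13 n \<star>\<^bsub>W\<^esub> put23 (Smat n))
         - coeff1 p r (put23 (Smat n) \<star>\<^bsub>W\<^esub> L13 n \<star>\<^bsub>W\<^esub> L12 n) | p r. True})"

definition Uq :: "nat \<Rightarrow> ((int \<times> int) list \<Rightarrow>\<^sub>0 Cq) set superalg" where
  "Uq n = presented pair_par (Uq_gens n) (Uq_rels n)"

definition Uq_class :: "nat \<Rightarrow> ((int \<times> int) list \<Rightarrow>\<^sub>0 Cq) \<Rightarrow> ((int \<times> int) list \<Rightarrow>\<^sub>0 Cq) set" where
  "Uq_class n = pres_class pair_par (Uq_gens n) (Uq_rels n)"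

text \<open>
  The coproduct and counit of $\mathrm{U}_q(\mathfrak{q}_n)$ are the ones induced by the following
  superalgebra homomorphisms on the free superalgebra: $\Delta$ of the class of \<open>v\<close> is the class
  of \<open>comul n v\<close> in the Koszul tensor square.
\<close>

definition comul_gen :: "nat \<Rightarrow> int \<times> int \<Rightarrow> ((int \<times> int) list \<times> (int \<times> int) list \<Rightarrow>\<^sub>0 Cq)" where
  "comul_gen n = (\<lambda>(i, j). \<Sum>k\<in>idx n.
     scale (ksign ((ipar i + ipar k) * (ipar k + ipar j))) (Lgen i k \<otimes>\<^sub>t Lgen k j))"

primrec comul_word ::
  "nat \<Rightarrow> (int \<times> int) list \<Rightarrow> ((int \<times> int) list \<times> (int \<times> int) list \<Rightarrow>\<^sub>0 Cq)" where
  "comul_word n [] = free_one \<otimes>\<^sub>t free_one"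
| "comul_word n (g # w) = comul_gen n g \<star>\<^bsub>Uq_free \<otimes>\<^sub>s Uq_free\<^esub> comul_word n w"

definition comul ::
  "nat \<Rightarrow> ((int \<times> int) list \<Rightarrow>\<^sub>0 Cq) \<Rightarrow> ((int \<times> int) list \<times> (int \<times> int) list \<Rightarrow>\<^sub>0 Cq)" where
  "comul n v = (\<Sum>w\<in>Poly_Mapping.keys v. scale (Poly_Mapping.lookup v w) (comul_word n w))"

definition counit :: "((int \<times> int) list \<Rightarrow>\<^sub>0 Cq) \<Rightarrow> Cq" where
  "counit v = (\<Sum>w\<in>Poly_Mapping.keys v.
     Poly_Mapping.lookup v w * prod_list (map (\<lambda>(i, j). of_bool (i = j)) w))"

text \<open>
  In \<open>act_prod\<close> the pairs \<open>z\<close> of words in the support of \<open>comul n v\<close> give the Sweedler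
  components $u_{(1)}$, $u_{(2)}$ of the class \<open>u\<close> of \<open>v\<close>.
\<close>

locale Uq_supermodule_superalgebra = supermodule "Uq n" B act + superalgebra B
  for n :: nat and B :: "'a superalg"
    and act :: "((int \<times> int) list \<Rightarrow>\<^sub>0 Cq) set \<Rightarrow> 'a \<Rightarrow> 'a" +
  assumes act_prod:
    "\<lbrakk>Poly_Mapping.keys v \<subseteq> lists (Uq_gens n); a \<in> hpart B p; b \<in> carrier B\<rbrakk> \<Longrightarrow>
     act (Uq_class n v) (a \<otimes>\<^bsub>B\<^esub> b) =
       (\<Oplus>\<^bsub>B\<^esub>z\<in>Poly_Mapping.keys (comul n v).
          (Poly_Mapping.lookup (comul n v) z * ksign (word_par pair_par (snd z) * p)) \<odot>\<^bsub>B\<^esub>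
          (act (Uq_class n (Poly_Mapping.single (fst z) 1)) a
             \<otimes>\<^bsub>B\<^esub> act (Uq_class n (Poly_Mapping.single (snd z) 1)) b))"
    and act_unit:
    "Poly_Mapping.keys v \<subseteq> lists (Uq_gens n) \<Longrightarrow>
     act (Uq_class n v) \<one>\<^bsub>B\<^esub> = counit v \<odot>\<^bsub>B\<^esub> \<one>\<^bsub>B\<^esub>"

definition Uq_supermodule_superalgebra_iso ::
  "nat \<Rightarrow> 'a superalg \<Rightarrow> (((int \<times> int) list \<Rightarrow>\<^sub>0 Cq) set \<Rightarrow> 'a \<Rightarrow> 'a) \<Rightarrow>
   'b superalg \<Rightarrow> (((int \<times> int) list \<Rightarrow>\<^sub>0 Cq) set \<Rightarrow> 'b \<Rightarrow> 'b) \<Rightarrow> ('a \<Rightarrow> 'b) \<Rightarrow> bool" where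
  "Uq_supermodule_superalgebra_iso n A actA B actB f \<longleftrightarrow>
     Uq_supermodule_superalgebra n A actA \<and> Uq_supermodule_superalgebra n B actB \<and>
     superalgebra_iso A B f \<and>
     (\<forall>u\<in>carrier (Uq n). \<forall>x\<in>carrier A. f (actA u x) = actB u (f x))"


section \<open>$\mathsf{A}_{k,n}$ and $\mathsf{A}_{k,n}^{\Pi}$\<close>

text \<open>
  The generator with index pair \<open>(i, a)\<close> is $t_{ia}$ in the free superalgebra of
  $\mathsf{A}_{k,n}$ and $t_{ia}^{\pi}$ in that of $\mathsf{A}_{k,n}^{\Pi}$; the two differ in the
  parities of the generators. In \<open>gmat1\<close> and \<open>gmat2\<close> (that is, $T^{1[3]}$ and $T^{2[3]}$)
  the set \<open>Z\<close> indexes the identity matrix: the rows for the left factor and the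
  columns for the right factor of a product such as $T^{1[3]}T^{2[3]}$.
\<close>

definition gmat :: "int set \<Rightarrow> nat \<Rightarrow> ((int \<times> int) \<times> (int \<times> int) list \<Rightarrow>\<^sub>0 Cq)" where
  "gmat rows n = (\<Sum>i\<in>rows. \<Sum>a\<in>idx n. E i a \<otimes>\<^sub>t gen (i, a))"

definition gmat1 ::
  "int set \<Rightarrow> nat \<Rightarrow> int set \<Rightarrow> ((int \<times> int) \<times> (int \<times> int) \<times> (int \<times> int) list \<Rightarrow>\<^sub>0 Cq)" where
  "gmat1 rows n Z = (\<Sum>i\<in>rows. \<Sum>a\<in>idx n. E i a \<otimes>\<^sub>t idm Z \<otimes>\<^sub>t gen (i, a))"

definition gmat2 ::
  "int set \<Rightarrow> nat \<Rightarrow> int set \<Rightarrow> ((int \<times> int) \<times> (int \<times> int) \<times> (int \<times> int) list \<Rightarrow>\<^sub>0 Cq)" where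
  "gmat2 rows n Z = (\<Sum>i\<in>rows. \<Sum>a\<in>idx n. idm Z \<otimes>\<^sub>t E i a \<otimes>\<^sub>t gen (i, a))"

definition gmat12 ::
  "int set \<Rightarrow> nat \<Rightarrow> ((int \<times> int) \<times> (int \<times> int) list \<times> (int \<times> int) \<Rightarrow>\<^sub>0 Cq)" where
  "gmat12 rows n = (\<Sum>i\<in>rows. \<Sum>a\<in>idx n. E i a \<otimes>\<^sub>t gen (i, a) \<otimes>\<^sub>t idm (idx n))"

text \<open>The entries of $A^{12}T^{1[3]}T^{2[3]} - T^{2[3]}T^{1[3]}B^{12}$.\<close>

definition matrix_rels ::
  "(int \<times> int \<Rightarrow> bit) \<Rightarrow> int set \<Rightarrow> nat \<Rightarrow> ((int \<times> int) \<times> (int \<times> int) \<Rightarrow>\<^sub>0 Cq) \<Rightarrow>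
   ((int \<times> int) \<times> (int \<times> int) \<Rightarrow>\<^sub>0 Cq) \<Rightarrow> ((int \<times> int) list \<Rightarrow>\<^sub>0 Cq) set" where
  "matrix_rels par rows n A B = (let W = mat_sa \<otimes>\<^sub>s mat_sa \<otimes>\<^sub>s free_sa par in
     {coeff3 p r (put12 A \<star>\<^bsub>W\<^esub> gmat1 rows n rows \<star>\<^bsub>W\<^esub> gmat2 rows n (idx n))
        - coeff3 p r (gmat2 rows n rows \<star>\<^bsub>W\<^esub> gmat1 rows n (idx n) \<star>\<^bsub>W\<^esub> put12 B) | p r. True})"

definition A_gens :: "nat \<Rightarrow> nat \<Rightarrow> (int \<times> int) set" where
  "A_gens k n = idx k \<times> idx n"

definition A_rels :: "nat \<Rightarrow> nat \<Rightarrow> ((int \<times> int) list \<Rightarrow>\<^sub>0 Cq) set" where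
  "A_rels k n = {gen (i, a) - gen (- i, - a) | i a. i \<in> idx k \<and> a \<in> idx n} \<union>
     matrix_rels pair_par (idx k) n (Smat k) (Smat n)"

definition A_alg :: "nat \<Rightarrow> nat \<Rightarrow> ((int \<times> int) list \<Rightarrow>\<^sub>0 Cq) set superalg" where
  "A_alg k n = presented pair_par (A_gens k n) (A_rels k n)"

definition A_class :: "nat \<Rightarrow> nat \<Rightarrow> ((int \<times> int) list \<Rightarrow>\<^sub>0 Cq) \<Rightarrow> ((int \<times> int) list \<Rightarrow>\<^sub>0 Cq) set" where
  "A_class k n = pres_class pair_par (A_gens k n) (A_rels k n)"

definition pi_par :: "int \<times> int \<Rightarrow> bit" where
  "pi_par = (\<lambda>(i, a). ipar a + 1)"

definition Api_gens :: "nat \<Rightarrow> nat \<Rightarrow> (int \<times> int) set" where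
  "Api_gens k n = {1..int k} \<times> idx n"

definition Api_rels :: "nat \<Rightarrow> nat \<Rightarrow> ((int \<times> int) list \<Rightarrow>\<^sub>0 Cq) set" where
  "Api_rels k n = matrix_rels pi_par {1..int k} n (Rplus k) (SJ n)"

definition Api_alg :: "nat \<Rightarrow> nat \<Rightarrow> ((int \<times> int) list \<Rightarrow>\<^sub>0 Cq) set superalg" where
  "Api_alg k n = presented pi_par (Api_gens k n) (Api_rels k n)"

definition Api_class :: "nat \<Rightarrow> nat \<Rightarrow> ((int \<times> int) list \<Rightarrow>\<^sub>0 Cq) \<Rightarrow> ((int \<times> int) list \<Rightarrow>\<^sub>0 Cq) set" where
  "Api_class k n = pres_class pi_par (Api_gens k n) (Api_rels k n)"

text \<open>
  $L^{[2]3}\cdot M^{1[2]} = M^{1[2]}S^{13}$, compared at each $E_{ic}\otimes{-}\otimes E_{ab}$, for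
  the matrix of generators with the given rows; \<open>cls\<close> maps the free superalgebra to \<open>B\<close>.
  This fixes the action of generators on generators, hence the whole supermodule superalgebra
  structure, so \<open>is_Phi\<close> and \<open>is_Phi_pi\<close> each hold for at most one action on carriers.
\<close>

definition L_acts_by_S ::
  "(int \<times> int \<Rightarrow> bit) \<Rightarrow> int set \<Rightarrow> nat \<Rightarrow> 'a superalg \<Rightarrow> (((int \<times> int) list \<Rightarrow>\<^sub>0 Cq) \<Rightarrow> 'a) \<Rightarrow>
   (((int \<times> int) list \<Rightarrow>\<^sub>0 Cq) set \<Rightarrow> 'a \<Rightarrow> 'a) \<Rightarrow> bool" where
  "L_acts_by_S par rows n B cls act \<longleftrightarrow>
     (\<forall>i\<in>rows. \<forall>c\<in>idx n. \<forall>a\<in>idx n. \<forall>b\<in>idx n.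
        ksign ((ipar a + ipar b) * par (i, c)) \<odot>\<^bsub>B\<^esub> act (Uq_class n (Lgen a b)) (cls (gen (i, c))) =
        cls (coeff2 (i, c) (a, b)
          (gmat12 rows n \<star>\<^bsub>mat_sa \<otimes>\<^sub>s free_sa par \<otimes>\<^sub>s mat_sa\<^esub> put13 (Smat n))))"

definition is_Phi ::
  "nat \<Rightarrow> nat \<Rightarrow> (((int \<times> int) list \<Rightarrow>\<^sub>0 Cq) set \<Rightarrow> ((int \<times> int) list \<Rightarrow>\<^sub>0 Cq) set \<Rightarrow>
   ((int \<times> int) list \<Rightarrow>\<^sub>0 Cq) set) \<Rightarrow> bool" where
  "is_Phi k n act \<longleftrightarrow> Uq_supermodule_superalgebra n (A_alg k n) act \<and>
     L_acts_by_S pair_par (idx k) n (A_alg k n) (A_class k n) act"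

definition is_Phi_pi ::
  "nat \<Rightarrow> nat \<Rightarrow> (((int \<times> int) list \<Rightarrow>\<^sub>0 Cq) set \<Rightarrow> ((int \<times> int) list \<Rightarrow>\<^sub>0 Cq) set \<Rightarrow>
   ((int \<times> int) list \<Rightarrow>\<^sub>0 Cq) set) \<Rightarrow> bool" where
  "is_Phi_pi k n act \<longleftrightarrow> Uq_supermodule_superalgebra n (Api_alg k n) act \<and>
     L_acts_by_S pi_par {1..int k} n (Api_alg k n) (Api_class k n) act"

definition T_plus :: "nat \<Rightarrow> nat \<Rightarrow> ((int \<times> int) \<times> (int \<times> int) list \<Rightarrow>\<^sub>0 Cq)" where
  "T_plus k n = gmat {1..int k} n"

definition Tcheck_plus :: "nat \<Rightarrow> nat \<Rightarrow> ((int \<times> int) \<times> (int \<times> int) list \<Rightarrow>\<^sub>0 Cq)" where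
  "Tcheck_plus k n = gmat {1..int k} n"

end

theory Submission
  imports Defs "HOL-Algebra.UnivPoly"
begin

text \<open>
  On generators $\tau(t^\pi_{ia}) = -t_{i,-a}$. The defining relations correspond because
  $S$ commutes with $J \otimes 1$: moving $J^1 J^2$ to the right of
  $R_+ T_+^1 T_+^2 = T_+^2 T_+^1 S$ turns $S$ into $S_J$.

  For the inverse one has to show that the relation
  $F := S T^1 T^2 - T^2 T^1 S = 0$ of $\mathsf{A}_{k,n}$ follows from its rows with positive indices
  together with $t_{ia} = t_{-i,-a}$. Since $J^1 F = F J^1$, the entries of $F$ in rows $(-i, j)$ are
  entries in rows $(i, j)$. If $P$ is the flip, then
  $J^2 P F P (J^2)^{-1} = -S^{-1} F S^{-1}$, where $S^{-1}$ is $S$ with $q$ replaced by $q^{-1}$;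
  read in rows $(-m, j)$ with $m, j > 0$ this expresses the remaining entries of $F$ through
  those already known to vanish.

  The actions of $\mathrm{U}_q(\mathfrak{q}_n)$ agree on generators, again by $S J^1 = J^1 S$, and then
  everywhere because $\Delta$ maps each $L_{ij}$ to a combination of tensors $L_{il} \otimes L_{lj}$.
\<close>

section \<open>Linear maps on finitely supported functions\<close>

text \<open>The formula for the flip rests on the Hecke relation P S P = S^{-1} + (q - q^{-1}) P.
  Since P T^2 T^1 = T^1 T^2 P, the term with P cancels from P F P = (P S P) T^2 T^1 - T^1 T^2 (P S
  P), which leaves P F P = -S^{-1} F S^{-1}; conjugation by J^2 changes nothing, because J^1 F = F
  J^1. Row (-m, j) with m, j > 0 is the useful one: there S^{-1} leads only to the rows (-m, j) and
  (-j, m), whose entries are already known, while P F P shows row (j, -m) of F.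

  The obstacle is that membership in an ideal of a noncommutative algebra has to be decided. This is
  done through linear functionals: a subspace contains z if every functional that vanishes on it
  vanishes at z. As F is quadratic, a functional f enters only through the scalars x i a j b =
  f(t_ia t_jb), and t_ia = t_{-i,-a} becomes a symmetry of x, so that the calculations take place in
  the commutative field C(q).\<close>

lemma lookup_scale [simp]: "Poly_Mapping.lookup (scale c x) w = c * Poly_Mapping.lookup x w"
  by (simp add: scale_def map.rep_eq when_def)

interpretation pm: vector_space scale
  by unfold_locales (auto intro!: poly_mapping_eqI simp: lookup_add algebra_simps)

lemma scale_single: "scale c (Poly_Mapping.single w d) = Poly_Mapping.single w (c * d)"
  by (rule poly_mapping_eqI) (simp add: lookup_single when_def)

lemma keys_scale: "Poly_Mapping.keys (scale c x) \<subseteq> Poly_Mapping.keys x"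
  by (auto simp: in_keys_iff)

lemma keys_uminus [simp]: "Poly_Mapping.keys (- x :: 'a \<Rightarrow>\<^sub>0 'b::ab_group_add) = Poly_Mapping.keys x"
  by (auto simp: in_keys_iff)

lemma keys_sum_subset: "(\<And>i. i \<in> I \<Longrightarrow> Poly_Mapping.keys (f i) \<subseteq> S) \<Longrightarrow> Poly_Mapping.keys (sum f I) \<subseteq> S"
proof (induction I rule: infinite_finite_induct)
  case (insert i I)
  have "Poly_Mapping.keys (f i + sum f I) \<subseteq> Poly_Mapping.keys (f i) \<union> Poly_Mapping.keys (sum f I)"
    by (rule Poly_Mapping.keys_add)
  then show ?case using insert by auto
qed auto

lemma poly_mapping_sum_single:
  "(\<Sum>w\<in>Poly_Mapping.keys x. scale (Poly_Mapping.lookup x w) (Poly_Mapping.single w 1)) = x"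
proof (rule poly_mapping_eqI)
  fix v
  have "Poly_Mapping.lookup (\<Sum>w\<in>Poly_Mapping.keys x. scale (Poly_Mapping.lookup x w) (Poly_Mapping.single w 1)) v
    = (\<Sum>w\<in>Poly_Mapping.keys x. if w = v then Poly_Mapping.lookup x w else 0)"
    unfolding lookup_sum by (intro sum.cong refl) (simp add: lookup_single when_def)
  then show "Poly_Mapping.lookup (\<Sum>w\<in>Poly_Mapping.keys x. scale (Poly_Mapping.lookup x w) (Poly_Mapping.single w 1)) v
    = Poly_Mapping.lookup x v"
    by (simp add: in_keys_iff)
qed

abbreviation linmap :: "(('a \<Rightarrow>\<^sub>0 Cq) \<Rightarrow> ('b \<Rightarrow>\<^sub>0 Cq)) \<Rightarrow> bool" where
  "linmap \<equiv> Vector_Spaces.linear scale scale"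

lemma linmapI:
  "(\<And>x y. h (x + y) = h x + h y) \<Longrightarrow> (\<And>c x. h (scale c x) = scale c (h x)) \<Longrightarrow> linmap h"
  by (simp add: Vector_Spaces.linear_iff pm.vector_space_axioms)

lemmas linmap_add = module_hom.add[OF module_hom_linearI]
  and linmap_scale = module_hom.scale[OF module_hom_linearI]
  and linmap_zero = module_hom.zero[OF module_hom_linearI]
  and linmap_sum = module_hom.sum[OF module_hom_linearI]
  and linmap_diff = module_hom.diff[OF module_hom_linearI]
  and linmap_neg = module_hom.neg[OF module_hom_linearI]

lemma linmap_compose: "linmap g \<Longrightarrow> linmap h \<Longrightarrow> linmap (\<lambda>x. g (h x))"
  by (simp add: Vector_Spaces.linear_iff)

lemma linmap_id: "linmap (\<lambda>x. x)"
  by (simp add: Vector_Spaces.linear_iff pm.vector_space_axioms)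

lemma linmap_const_scale: "linmap g \<Longrightarrow> linmap (\<lambda>x. scale c (g x))"
  by (simp add: Vector_Spaces.linear_iff pm.scale_right_distrib mult.commute)

lemma linmap_plus: "linmap g \<Longrightarrow> linmap h \<Longrightarrow> linmap (\<lambda>x. g x + h x)"
  by (simp add: Vector_Spaces.linear_iff pm.scale_right_distrib)

lemma linmap_minus: "linmap g \<Longrightarrow> linmap h \<Longrightarrow> linmap (\<lambda>x. g x - h x)"
  by (simp add: Vector_Spaces.linear_iff pm.scale_right_diff_distrib)

lemma linmap_sum_fun: "(\<And>i. i \<in> I \<Longrightarrow> linmap (g i)) \<Longrightarrow> linmap (\<lambda>x. \<Sum>i\<in>I. g i x)"
  by (simp add: Vector_Spaces.linear_iff pm.scale_sum_right sum.distrib pm.vector_space_axioms)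

lemma linmap_expand:
  assumes "linmap h"
  shows "h x = (\<Sum>w\<in>Poly_Mapping.keys x. scale (Poly_Mapping.lookup x w) (h (Poly_Mapping.single w 1)))"
proof -
  have "h x = h (\<Sum>w\<in>Poly_Mapping.keys x. scale (Poly_Mapping.lookup x w) (Poly_Mapping.single w 1))"
    by (simp add: poly_mapping_sum_single)
  then show ?thesis by (simp add: linmap_sum[OF assms] linmap_scale[OF assms])
qed

lemma linmap_eqI:
  assumes "linmap g" "linmap h"
    and "\<And>w. w \<in> Poly_Mapping.keys x \<Longrightarrow> g (Poly_Mapping.single w 1) = h (Poly_Mapping.single w 1)"
  shows "g x = h x"
  unfolding linmap_expand[OF assms(1), of x] linmap_expand[OF assms(2), of x]
  by (intro sum.cong refl) (simp add: assms(3))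

lemma linmap_ext:
  "linmap g \<Longrightarrow> linmap h \<Longrightarrow> (\<And>w. g (Poly_Mapping.single w 1) = h (Poly_Mapping.single w 1)) \<Longrightarrow> g = h"
  using linmap_eqI by blast

text \<open>Linear extension of a map given on basis vectors. Products, tensors and the placements
  \<open>put12\<close>, \<open>put13\<close> are rewritten as instances of it, which makes their
  linearity automatic and reduces identities between them to basis vectors.\<close>

definition lin :: "('a \<Rightarrow> ('b \<Rightarrow>\<^sub>0 Cq)) \<Rightarrow> ('a \<Rightarrow>\<^sub>0 Cq) \<Rightarrow> ('b \<Rightarrow>\<^sub>0 Cq)" where
  "lin f x = (\<Sum>w\<in>Poly_Mapping.keys x. scale (Poly_Mapping.lookup x w) (f w))"

lemma lin_superset:
  "finite S \<Longrightarrow> Poly_Mapping.keys x \<subseteq> S \<Longrightarrow> lin f x = (\<Sum>w\<in>S. scale (Poly_Mapping.lookup x w) (f w))"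
  unfolding lin_def by (rule sum.mono_neutral_left) (auto simp: in_keys_iff)

lemma linmap_lin [simp]: "linmap (lin f)"
proof (rule linmapI)
  fix x y :: "'a \<Rightarrow>\<^sub>0 Cq" and c
  \<comment> \<open>Cancellation may remove basis vectors from the support of \<open>x + y\<close>,
    so all three sums run over the union of the two supports.\<close>
  let ?S = "Poly_Mapping.keys x \<union> Poly_Mapping.keys y"
  have "Poly_Mapping.keys (x + y) \<subseteq> ?S" by (rule Poly_Mapping.keys_add)
  then show "lin f (x + y) = lin f x + lin f y"
    by (simp add: lin_superset[of ?S] lookup_add pm.scale_left_distrib sum.distrib)
  show "lin f (scale c x) = scale c (lin f x)"
    using keys_scale[of c x]
    by (simp add: lin_superset[of "Poly_Mapping.keys x"] pm.scale_sum_right)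
qed

lemma lin_single [simp]: "lin f (Poly_Mapping.single w c) = scale c (f w)"
  by (cases "c = 0") (simp_all add: lin_def)

lemma linmap_lin_param:
  "(\<And>b. linmap (h b)) \<Longrightarrow> linmap (\<lambda>y. lin (\<lambda>b. h b y) x)"
  unfolding lin_def by (intro linmap_sum_fun linmap_const_scale) auto

lemma sprod_lin: "sprod A x y = lin (\<lambda>b. lin (bmul A b) y) x"
  by (simp add: sprod_def lin_def pm.scale_sum_right)

lemma linmap_sprod_left [simp]: "linmap (\<lambda>x. sprod A x y)"
  by (simp add: sprod_lin)

lemma linmap_sprod_right [simp]: "linmap (sprod A x)"
  unfolding sprod_lin by (rule linmap_lin_param) simp

lemma sprod_single [simp]:
  "sprod A (Poly_Mapping.single b c) (Poly_Mapping.single b' c') = scale (c * c') (bmul A b b')"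
  by (simp add: sprod_lin)

lemma tens_lin: "tens x y = lin (\<lambda>b. lin (\<lambda>c. Poly_Mapping.single (b, c) 1) y) x"
  by (simp add: tens_def lin_def pm.scale_sum_right scale_single)

lemma linmap_tens_left [simp]: "linmap (\<lambda>x. tens x y)"
  by (simp add: tens_lin)

lemma linmap_tens_right [simp]: "linmap (tens x)"
  unfolding tens_lin by (rule linmap_lin_param) simp

lemma tens_single [simp]:
  "tens (Poly_Mapping.single b c) (Poly_Mapping.single b' c') = Poly_Mapping.single (b, b') (c * c')"
  by (simp add: tens_lin scale_single)

lemmas sprod_simps =
  linmap_add[OF linmap_sprod_left] linmap_add[OF linmap_sprod_right]
  linmap_diff[OF linmap_sprod_left] linmap_diff[OF linmap_sprod_right]
  linmap_neg[OF linmap_sprod_left] linmap_neg[OF linmap_sprod_right]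
  linmap_scale[OF linmap_sprod_left] linmap_scale[OF linmap_sprod_right]
  linmap_sum[OF linmap_sprod_left] linmap_sum[OF linmap_sprod_right]
  linmap_zero[OF linmap_sprod_left] linmap_zero[OF linmap_sprod_right]

lemmas tens_simps =
  linmap_add[OF linmap_tens_left] linmap_add[OF linmap_tens_right]
  linmap_scale[OF linmap_tens_left] linmap_scale[OF linmap_tens_right]
  linmap_sum[OF linmap_tens_left] linmap_sum[OF linmap_tens_right]
  linmap_zero[OF linmap_tens_left] linmap_zero[OF linmap_tens_right]

lemma linmap_sprod_left': "linmap g \<Longrightarrow> linmap (\<lambda>x. sprod A (g x) y)"
  and linmap_sprod_right': "linmap g \<Longrightarrow> linmap (\<lambda>x. sprod A y (g x))"
  and linmap_tens_left': "linmap g \<Longrightarrow> linmap (\<lambda>x. tens (g x) z)"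
  and linmap_tens_right': "linmap g \<Longrightarrow> linmap (\<lambda>x. tens z (g x))"
  and linmap_lin': "linmap g \<Longrightarrow> linmap (\<lambda>x. lin f (g x))"
  by (rule linmap_compose; simp)+

lemmas linmap_intros = linmap_id linmap_plus linmap_minus linmap_const_scale linmap_sum_fun
  linmap_sprod_left' linmap_sprod_right' linmap_tens_left' linmap_tens_right' linmap_lin'

section \<open>Tensor positions and coefficients of matrix units\<close>

lemma put12_lin: "put12 = lin (\<lambda>z. Poly_Mapping.single (fst z, snd z, []) 1)"
  by (rule ext) (simp add: put12_def lin_def scale_single)

lemma put13_lin: "put13 = lin (\<lambda>z. Poly_Mapping.single (fst z, [], snd z) 1)"
  by (rule ext) (simp add: put13_def lin_def scale_single)

lemma lookup_coeff3: "Poly_Mapping.lookup (coeff3 b c x) w = Poly_Mapping.lookup x (b, c, w)"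
  unfolding coeff3_def by (subst map_key.rep_eq) (auto simp: inj_on_def)

lemma lookup_coeff2: "Poly_Mapping.lookup (coeff2 b c x) w = Poly_Mapping.lookup x (b, w, c)"
  unfolding coeff2_def by (subst map_key.rep_eq) (auto simp: inj_on_def)

lemma lookup_entry: "Poly_Mapping.lookup (entry b x) w = Poly_Mapping.lookup x (b, w)"
  unfolding entry_def by (subst map_key.rep_eq) (auto simp: inj_on_def)

lemma linmap_coeff3 [simp]: "linmap (coeff3 b c)"
  by (rule linmapI) (auto intro!: poly_mapping_eqI simp: lookup_coeff3 lookup_add)

lemma linmap_coeff2 [simp]: "linmap (coeff2 b c)"
  by (rule linmapI) (auto intro!: poly_mapping_eqI simp: lookup_coeff2 lookup_add)

lemma linmap_entry [simp]: "linmap (entry b)"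
  by (rule linmapI) (auto intro!: poly_mapping_eqI simp: lookup_entry lookup_add)

lemma linmap_coeff3': "linmap g \<Longrightarrow> linmap (\<lambda>x. coeff3 b c (g x))"
  by (rule linmap_compose) simp_all

lemma coeff3_single: "coeff3 p r (Poly_Mapping.single (b, c, w) d) =
    (if b = p \<and> c = r then Poly_Mapping.single w d else 0)"
  by (rule poly_mapping_eqI) (auto simp: lookup_coeff3 lookup_single when_def)

lemma coeff2_single: "coeff2 p r (Poly_Mapping.single (b, w, c) d) =
    (if b = p \<and> c = r then Poly_Mapping.single w d else 0)"
  by (rule poly_mapping_eqI) (auto simp: lookup_coeff2 lookup_single when_def)

lemma entry_single: "entry p (Poly_Mapping.single (b, w) d) =
    (if b = p then Poly_Mapping.single w d else 0)"
  by (rule poly_mapping_eqI) (auto simp: lookup_entry lookup_single when_def)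

lemma ksign_simps [simp]: "ksign 0 = 1" "ksign 1 = -1"
  by (simp_all add: ksign_def)

lemma ksign_add: "ksign (p + r) = ksign p * ksign r"
  by (cases p; cases r) simp_all

text \<open>A basis of V together with z is independent, so some functional is 0 on the basis and 1
  at z. In the contrapositive form \<open>functional_separation\<close> this replaces a membership
  in an ideal by an identity between scalars.\<close>

lemma exists_separating_functional:
  fixes V :: "('a \<Rightarrow>\<^sub>0 Cq) set"
  assumes "pm.subspace V" "z \<notin> V"
  shows "\<exists>f. Vector_Spaces.linear scale (*) f \<and> (\<forall>v\<in>V. f v = 0) \<and> f z \<noteq> 0"
proof -
  interpret vs: vector_space "(*) :: Cq \<Rightarrow> Cq \<Rightarrow> Cq"
    by unfold_locales (simp_all add: algebra_simps)
  interpret vp: vector_space_pair scale "(*) :: Cq \<Rightarrow> Cq \<Rightarrow> Cq" ..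
  obtain B where B: "B \<subseteq> V" "pm.independent B" "V \<subseteq> pm.span B"
    using pm.maximal_independent_subset by blast
  have span: "pm.span B \<subseteq> V" using B(1) assms(1) by (rule pm.span_minimal)
  then have "z \<notin> pm.span B" using assms(2) by auto
  then have "pm.independent (insert z B)"
    using B(2) by (rule pm.independent_insertI)
  then obtain f where f: "Vector_Spaces.linear scale (*) f" "\<forall>x\<in>insert z B. f x = (if x = z then 1 else 0)"
    using vp.linear_independent_extend[of "insert z B" "\<lambda>x. if x = z then 1 else 0"] by blast
  have "f v = 0" if "v \<in> V" for v
  proof (rule module_hom.eq_0_on_span[OF module_hom_linearI[OF f(1)]])
    show "v \<in> pm.span B" using that B(3) by auto
    show "f x = 0" if "x \<in> B" for x using that f(2) B(1) assms(2) by auto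
  qed
  then show ?thesis using f by auto
qed

section \<open>The exchange relation in coordinates\<close>

lemma qvar_nonzero: "qvar \<noteq> 0"
  by (simp add: qvar_def Zero_fract_def eq_fract)

text \<open>The coefficient of $E_{ia} \otimes E_{jb}$ in $S T^1 T^2 - T^2 T^1 S$, where \<open>x i a j b\<close> stands
  for $t_{ia} t_{jb}$.\<close>

definition qcomm :: "(int \<Rightarrow> int \<Rightarrow> int \<Rightarrow> int \<Rightarrow> Cq) \<Rightarrow> int \<Rightarrow> int \<Rightarrow> int \<Rightarrow> int \<Rightarrow> Cq" where
  "qcomm x i a j b =
     qvar powi phi i j * ksign ((ipar i + ipar a) * (ipar j + ipar b)) * x i a j b
     + xi * (of_bool (j < i) * ksign (ipar j + (ipar j + ipar a) * (ipar j + ipar b)) * x j a i b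
           + of_bool (j < - i) * ksign (ipar j + (ipar j + 1 + ipar a) * (ipar j + ipar b))
               * x (- j) a (- i) b)
     - (qvar powi phi a b * x j b i a
        + xi * (of_bool (a < b) * ksign (ipar a + (ipar j + ipar a) * (ipar a + ipar b)) * x j a i b
           + of_bool (- a < b) * ksign (ipar a + 1 + (ipar j + ipar a + 1) * (ipar a + ipar b + 1))
               * x j (- a) i (- b)))"

lemma ipar_pos: "0 < i \<Longrightarrow> ipar i = 0" and ipar_neg: "i < 0 \<Longrightarrow> ipar i = 1"
  by (simp_all add: ipar_def)


lemma ipar_uminus: "i \<noteq> 0 \<Longrightarrow> ipar (- i) = ipar i + 1"
  by (auto simp: ipar_def)

lemma phi_uminus_left: "phi (- i) j = phi i j"
  by (auto simp: phi_def)

lemma phi_uminus_right: "j \<noteq> 0 \<Longrightarrow> phi i (- j) = - phi i j"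
  by (auto simp: phi_def ipar_uminus)

text \<open>This is J^1 F = F J^1 in coordinates. Negating the row and the column index of the first
  factor exchanges the two xi-terms of S and preserves its diagonal, as phi(-i, j) = phi(i, j). The
  assumptions on \<open>x\<close> express t_ia = t_{-i,-a} in each of the two factors; they turn a
  negated row into a negated column.\<close>

lemma qcomm_neg_row:
  assumes s1: "\<And>i a j b. x (- i) a j b = x i (- a) j b"
    and s2: "\<And>i a j b. x i a (- j) b = x i a j (- b)"
    and nz: "i \<noteq> 0" "a \<noteq> 0" "j \<noteq> 0" "b \<noteq> 0"
  shows "qcomm x (- i) a j b = qcomm x i (- a) j b"
  using nz
  by (cases "ipar i"; cases "ipar a"; cases "ipar j"; cases "ipar b")
    (simp_all add: qcomm_def s1 s2 phi_uminus_left ipar_uminus algebra_simps)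


text \<open>The coefficients of $F S^{-1}$.\<close>

definition colop :: "(int \<Rightarrow> int \<Rightarrow> int \<Rightarrow> int \<Rightarrow> Cq) \<Rightarrow> int \<Rightarrow> int \<Rightarrow> int \<Rightarrow> int \<Rightarrow> Cq" where
  "colop F i a j b = qvar powi (- phi a b) * F i a j b
     - xi * (of_bool (a < b) * ksign (ipar a + (ipar j + ipar a) * (ipar a + ipar b)) * F i b j a
        + of_bool (- a < b) * ksign (ipar a + 1 + (ipar j + ipar a + 1) * (ipar a + ipar b + 1))
            * F i (- b) j (- a))"


lemma phi_pos: "0 < i \<Longrightarrow> 0 < j \<Longrightarrow> phi i j = of_bool (i = j)"
  by (auto simp: phi_def ipar_pos)


lemma qvar_cancel: "qvar * inverse qvar = 1" "qvar * (inverse qvar * z) = z"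
  "inverse qvar * (qvar * z) = z"
  using qvar_nonzero by (simp_all add: field_simps)

text \<open>The entry in row $(-m, j)$ of $J^2 P F P (J^2)^{-1} = -S^{-1} F S^{-1}$.\<close>

lemma qcomm_mixed_row:
  assumes s1: "\<And>i a j b. x (- i) a j b = x i (- a) j b"
    and s2: "\<And>i a j b. x i a (- j) b = x i a j (- b)"
    and pos: "0 < m" "0 < j" and nz: "a \<noteq> 0" "b \<noteq> 0"
  shows "qcomm x j b (- m) a = - ksign ((1 + ipar a) * ipar b) *
    (qvar powi (- phi m j) * colop (qcomm x) (- m) a j b
      - xi * of_bool (j < m) * colop (qcomm x) (- j) a m b)"
proof -
  \<comment> \<open>\<open>A\<close> and \<open>B\<close> are the absolute values of the columns.
    Once the signs of a and b and the orders of m, j and of A, B are fixed, \<open>phi\<close> and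
    all order conditions are decided. What remains is linear in the values of \<open>x\<close> with
    coefficients in q and q^{-1}, and is settled by writing xi as q - q^{-1} and cancelling q
    q^{-1}.\<close>
  have main: "qcomm x j b (- m) a = - ksign ((1 + ipar a) * ipar b) *
    (qvar powi (- phi m j) * colop (qcomm x) (- m) a j b
      - xi * of_bool (j < m) * colop (qcomm x) (- j) a m b)"
    if A: "0 < A" "0 < B" and ab: "a = A \<or> a = - A" "b = B \<or> b = - B" for A B
  proof -
    show ?thesis
      using ab pos A
      apply (elim disjE; cases m j rule: linorder_cases; cases A B rule: linorder_cases)
                          apply (simp_all add: colop_def qcomm_def s1 s2 phi_uminus_left
          phi_uminus_right ipar_uminus phi_pos ipar_pos power_int_minus)
                      apply (simp_all only: ring_distribs xi_def)
                    apply (simp_all add: algebra_simps qvar_cancel)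
      done
  qed
  from main[of "\<bar>a\<bar>" "\<bar>b\<bar>"] nz show ?thesis by (auto simp: abs_if split: if_splits)
qed

section \<open>Presented superalgebras\<close>

lemma keys_lin: "Poly_Mapping.keys (lin f x) \<subseteq> (\<Union>w\<in>Poly_Mapping.keys x. Poly_Mapping.keys (f w))"
  unfolding lin_def by (intro keys_sum_subset subset_trans[OF keys_scale] UN_upper)

section \<open>The free superalgebra as a ring\<close>

lemma bmul_free_sa [simp]: "bmul (free_sa par) v w = Poly_Mapping.single (v @ w) 1"
  by (simp add: free_sa_def)

text \<open>Both sides are linear in each argument, so the arguments are replaced by words one at a
  time: z in the first step, then y, then x. On words the claim is associativity of
  concatenation.\<close>

lemma free_mult_assoc:
  "sprod (free_sa par) (sprod (free_sa par) x y) z = sprod (free_sa par) x (sprod (free_sa par) y z)"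
proof -
  let ?s = "\<lambda>v. Poly_Mapping.single v (1 :: Cq)"
  have 1: "(\<lambda>z. sprod (free_sa par) (sprod (free_sa par) (?s v) (?s w)) z)
      = (\<lambda>z. sprod (free_sa par) (?s v) (sprod (free_sa par) (?s w) z))" for v w
    by (rule linmap_ext; (intro linmap_intros)?) simp
  have 2: "(\<lambda>y. sprod (free_sa par) (sprod (free_sa par) (?s v) y) z)
      = (\<lambda>y. sprod (free_sa par) (?s v) (sprod (free_sa par) y z))" for v
    by (rule linmap_ext; (intro linmap_intros)?) (rule fun_cong[OF 1])
  have "(\<lambda>x. sprod (free_sa par) (sprod (free_sa par) x y) z)
      = (\<lambda>x. sprod (free_sa par) x (sprod (free_sa par) y z))"
    by (rule linmap_ext; (intro linmap_intros)?) (rule fun_cong[OF 2])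
  then show ?thesis by (rule fun_cong)
qed

lemma free_mult_one [simp]:
  "sprod (free_sa par) free_one x = x" "sprod (free_sa par) x free_one = x"
proof -
  have "(\<lambda>x. sprod (free_sa par) free_one x) = (\<lambda>x. x)" "(\<lambda>x. sprod (free_sa par) x free_one) = (\<lambda>x. x)"
    by (rule linmap_ext; (intro linmap_intros)?; simp add: free_one_def)+
  then show "sprod (free_sa par) free_one x = x" "sprod (free_sa par) x free_one = x"
    by (auto dest: fun_cong[of _ _ x])
qed

text \<open>\<open>presented\<close> defines scalar multiplication as multiplication by the class of
  a constant; this identifies it with \<open>scale\<close> on representatives.\<close>

lemma free_mult_const: "sprod (free_sa par) (Poly_Mapping.single [] c) x = scale c x"
proof -
  have "(\<lambda>x. sprod (free_sa par) (Poly_Mapping.single [] c) x) = (\<lambda>x. scale c x)"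
    by (rule linmap_ext; (intro linmap_intros)?) (simp add: scale_single)
  then show ?thesis by (rule fun_cong)
qed

lemma keys_free_mult:
  assumes "Poly_Mapping.keys x \<subseteq> lists G" "Poly_Mapping.keys y \<subseteq> lists G"
  shows "Poly_Mapping.keys (sprod (free_sa par) x y) \<subseteq> lists G"
proof -
  have "Poly_Mapping.keys (lin (bmul (free_sa par) b) y) \<subseteq> lists G" if "b \<in> Poly_Mapping.keys x" for b
    using keys_lin[of "bmul (free_sa par) b" y] that assms by (fastforce simp: free_sa_def)
  then show ?thesis
    unfolding sprod_lin using keys_lin[of "\<lambda>b. lin (bmul (free_sa par) b) y" x] by blast
qed

lemma keys_add_lists:
  "Poly_Mapping.keys x \<subseteq> L \<Longrightarrow> Poly_Mapping.keys y \<subseteq> L \<Longrightarrow> Poly_Mapping.keys (x + y :: 'a \<Rightarrow>\<^sub>0 Cq) \<subseteq> L"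
  using Poly_Mapping.keys_add[of x y] by blast

lemma keys_diff_lists:
  "Poly_Mapping.keys x \<subseteq> L \<Longrightarrow> Poly_Mapping.keys y \<subseteq> L \<Longrightarrow> Poly_Mapping.keys (x - y :: 'a \<Rightarrow>\<^sub>0 Cq) \<subseteq> L"
  using keys_add_lists[of x L "- y"] by simp

lemma keys_scale_lists: "Poly_Mapping.keys x \<subseteq> L \<Longrightarrow> Poly_Mapping.keys (scale c x) \<subseteq> L"
  using keys_scale by (rule subset_trans)

lemma free_ring_simps:
  "carrier (free_ring par G) = {x. Poly_Mapping.keys x \<subseteq> lists G}"
  "x \<otimes>\<^bsub>free_ring par G\<^esub> y = sprod (free_sa par) x y"
  "\<one>\<^bsub>free_ring par G\<^esub> = free_one"
  "\<zero>\<^bsub>free_ring par G\<^esub> = 0"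
  "x \<oplus>\<^bsub>free_ring par G\<^esub> y = x + y"
  by (simp_all add: free_ring_def)

lemma free_ring_closed:
  "x \<in> carrier (free_ring par G) \<Longrightarrow> y \<in> carrier (free_ring par G) \<Longrightarrow> x + y \<in> carrier (free_ring par G)"
  "x \<in> carrier (free_ring par G) \<Longrightarrow> y \<in> carrier (free_ring par G) \<Longrightarrow> x - y \<in> carrier (free_ring par G)"
  "x \<in> carrier (free_ring par G) \<Longrightarrow> y \<in> carrier (free_ring par G)
    \<Longrightarrow> sprod (free_sa par') x y \<in> carrier (free_ring par G)"
  "x \<in> carrier (free_ring par G) \<Longrightarrow> - x \<in> carrier (free_ring par G)"
  "x \<in> carrier (free_ring par G) \<Longrightarrow> scale c x \<in> carrier (free_ring par G)"
  "0 \<in> carrier (free_ring par G)"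
  "free_one \<in> carrier (free_ring par G)"
  unfolding free_ring_simps(1) mem_Collect_eq
        apply (erule (1) keys_add_lists)
       apply (erule (1) keys_diff_lists)
      apply (erule (1) keys_free_mult)
     apply (simp only: keys_uminus)
    apply (erule keys_scale_lists)
  by (simp_all add: free_one_def)

lemma ring_free_ring: "ring (free_ring par G)"
proof (rule ringI)
  show "abelian_group (free_ring par G)"
  proof (rule abelian_groupI)
    fix x assume "x \<in> carrier (free_ring par G)"
    then show "\<exists>y\<in>carrier (free_ring par G). y \<oplus>\<^bsub>free_ring par G\<^esub> x = \<zero>\<^bsub>free_ring par G\<^esub>"
      by (intro bexI[of _ "- x"]) (simp_all add: free_ring_simps(2-5) free_ring_closed)
  qed (simp_all add: free_ring_simps(2-5) free_ring_closed algebra_simps)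
  show "Group.monoid (free_ring par G)"
    by (rule monoidI) (simp_all add: free_ring_simps(2-5) free_ring_closed free_mult_assoc)
qed (simp_all add: free_ring_simps(2-5) sprod_simps)

lemma a_inv_free_ring:
  assumes "x \<in> carrier (free_ring par G)"
  shows "\<ominus>\<^bsub>free_ring par G\<^esub> x = - x"
proof -
  have "- x \<in> carrier (free_ring par G)" "- x \<oplus>\<^bsub>free_ring par G\<^esub> x = \<zero>\<^bsub>free_ring par G\<^esub>"
    using assms by (simp_all add: free_ring_simps)
  then show ?thesis
    using assms by (intro abelian_group.minus_equality[OF ring.is_abelian_group[OF ring_free_ring]])
qed

lemma a_minus_free_ring:
  assumes "x \<in> carrier (free_ring par G)" "y \<in> carrier (free_ring par G)"
  shows "x \<ominus>\<^bsub>free_ring par G\<^esub> y = x - y"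
  unfolding a_minus_def a_inv_free_ring[OF assms(2)] by (simp add: free_ring_simps)

section \<open>Parity components in the free superalgebra\<close>

definition hom_part :: "('g \<Rightarrow> bit) \<Rightarrow> bit \<Rightarrow> ('g list \<Rightarrow>\<^sub>0 Cq) \<Rightarrow> ('g list \<Rightarrow>\<^sub>0 Cq)" where
  "hom_part par p = lin (\<lambda>w. if word_par par w = p then Poly_Mapping.single w 1 else 0)"

definition homogeneous :: "('g \<Rightarrow> bit) \<Rightarrow> bit \<Rightarrow> ('g list \<Rightarrow>\<^sub>0 Cq) \<Rightarrow> bool" where
  "homogeneous par p x \<longleftrightarrow> (\<forall>w\<in>Poly_Mapping.keys x. word_par par w = p)"

lemma linmap_hom_part [simp]: "linmap (hom_part par p)"
  by (simp add: hom_part_def)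

lemma linmap_hom_part': "linmap g \<Longrightarrow> linmap (\<lambda>x. hom_part par p (g x))"
  by (rule linmap_compose) simp_all

lemma lookup_hom_part:
  "Poly_Mapping.lookup (hom_part par p x) w = (if word_par par w = p then Poly_Mapping.lookup x w else 0)"
proof -
  have "Poly_Mapping.lookup (hom_part par p x) w =
      (\<Sum>v\<in>Poly_Mapping.keys x. if v = w then if word_par par w = p then Poly_Mapping.lookup x w else 0 else 0)"
    unfolding hom_part_def lin_def lookup_sum
    by (intro sum.cong refl) (auto simp: lookup_single when_def)
  then show ?thesis by (simp add: in_keys_iff)
qed

lemma keys_hom_part: "Poly_Mapping.keys (hom_part par p x) \<subseteq> Poly_Mapping.keys x"
  by (auto simp: in_keys_iff lookup_hom_part split: if_splits)

lemma homogeneous_hom_part: "homogeneous par p (hom_part par p x)"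
  by (auto simp: homogeneous_def in_keys_iff lookup_hom_part split: if_splits)

lemma hom_part_sum: "hom_part par 0 x + hom_part par 1 x = x"
proof (rule poly_mapping_eqI)
  fix w show "Poly_Mapping.lookup (hom_part par 0 x + hom_part par 1 x) w = Poly_Mapping.lookup x w"
    by (cases "word_par par w") (auto simp: lookup_add lookup_hom_part)
qed

lemma hom_part_homogeneous:
  "homogeneous par r x \<Longrightarrow> hom_part par p x = (if p = r then x else 0)"
  by (rule poly_mapping_eqI) (auto simp: lookup_hom_part homogeneous_def in_keys_iff)

lemma word_par_append [simp]: "word_par par (v @ w) = word_par par v + word_par par w"
  by (simp add: word_par_def)

text \<open>The pairs of parities with sum p are (0, p) and (1, p + 1), because 1 + 1 = 0. By
  bilinearity it is enough to look at two words.\<close>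

lemma hom_part_free_mult:
  "hom_part par p (sprod (free_sa par) x y) =
    sprod (free_sa par) (hom_part par 0 x) (hom_part par p y)
    + sprod (free_sa par) (hom_part par 1 x) (hom_part par (p + 1) y)"
proof -
  let ?s = "\<lambda>v. Poly_Mapping.single v (1 :: Cq)"
  have 1: "(\<lambda>y. hom_part par p (sprod (free_sa par) (?s v) y)) = (\<lambda>y.
    sprod (free_sa par) (hom_part par 0 (?s v)) (hom_part par p y)
    + sprod (free_sa par) (hom_part par 1 (?s v)) (hom_part par (p + 1) y))" for v
  proof (rule linmap_ext; (intro linmap_intros linmap_hom_part')?)
    fix w
    show "hom_part par p (sprod (free_sa par) (?s v) (?s w)) =
      sprod (free_sa par) (hom_part par 0 (?s v)) (hom_part par p (?s w))
      + sprod (free_sa par) (hom_part par 1 (?s v)) (hom_part par (p + 1) (?s w))"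
      by (cases "word_par par v"; cases "word_par par w"; cases p)
        (simp_all add: hom_part_def sprod_simps)
  qed
  have "(\<lambda>x. hom_part par p (sprod (free_sa par) x y)) = (\<lambda>x.
    sprod (free_sa par) (hom_part par 0 x) (hom_part par p y)
    + sprod (free_sa par) (hom_part par 1 x) (hom_part par (p + 1) y))"
    by (rule linmap_ext; (intro linmap_intros linmap_hom_part')?) (rule fun_cong[OF 1])
  then show ?thesis by (rule fun_cong)
qed

lemma homogeneous_free_mult:
  assumes "homogeneous par p x" "homogeneous par r y"
  shows "homogeneous par (p + r) (sprod (free_sa par) x y)"
proof -
  have "Poly_Mapping.keys (lin (bmul (free_sa par) b) y) \<subseteq> {w. word_par par w = p + r}"
    if "b \<in> Poly_Mapping.keys x" for b
    using keys_lin[of "bmul (free_sa par) b" y] that assms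
    by (fastforce simp: free_sa_def homogeneous_def)
  then show ?thesis
    unfolding sprod_lin homogeneous_def using keys_lin[of "\<lambda>b. lin (bmul (free_sa par) b) y" x] by blast
qed

lemma homogeneous_keys: "homogeneous par p x \<longleftrightarrow> Poly_Mapping.keys x \<subseteq> {w. word_par par w = p}"
  by (auto simp: homogeneous_def)

lemma homogeneous_add: "homogeneous par p x \<Longrightarrow> homogeneous par p y \<Longrightarrow> homogeneous par p (x + y)"
  and homogeneous_diff: "homogeneous par p x \<Longrightarrow> homogeneous par p y \<Longrightarrow> homogeneous par p (x - y)"
  and homogeneous_scale: "homogeneous par p x \<Longrightarrow> homogeneous par p (scale c x)"
  unfolding homogeneous_keys by (simp_all add: keys_add_lists keys_diff_lists keys_scale_lists)

section \<open>The quotient by an ideal of relations\<close>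

locale presentation =
  fixes par :: "'g \<Rightarrow> bit" and G :: "'g set" and R :: "('g list \<Rightarrow>\<^sub>0 Cq) set"
  assumes rels_closed: "R \<subseteq> carrier (free_ring par G)"
begin

abbreviation "F \<equiv> free_ring par G"
abbreviation "I \<equiv> rel_ideal par G R"
abbreviation "cls \<equiv> pres_class par G R"
abbreviation "P \<equiv> presented par G R"

lemma ring_F: "ring F"
  by (rule ring_free_ring)

lemma ideal_I: "ideal I F"
  unfolding rel_ideal_def using ring.genideal_ideal[OF ring_F rels_closed] .

lemma rels_in_I: "R \<subseteq> I"
  unfolding rel_ideal_def using ring.genideal_self[OF ring_F rels_closed] .

lemma I_minimal: "ideal K F \<Longrightarrow> R \<subseteq> K \<Longrightarrow> I \<subseteq> K"
  unfolding rel_ideal_def by (rule ring.genideal_minimal[OF ring_F])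

lemma I_zero: "0 \<in> I"
  using additive_subgroup.zero_closed[OF ideal.axioms(1)[OF ideal_I]] by (simp add: free_ring_simps)

lemma I_add: "x \<in> I \<Longrightarrow> y \<in> I \<Longrightarrow> x + y \<in> I"
  using additive_subgroup.a_closed[OF ideal.axioms(1)[OF ideal_I], of x y] by (simp add: free_ring_simps)

lemma I_mult_left: "x \<in> carrier F \<Longrightarrow> y \<in> I \<Longrightarrow> sprod (free_sa par) x y \<in> I"
  using ideal.I_l_closed[OF ideal_I, of y x] by (simp add: free_ring_simps)

lemma I_mult_right: "x \<in> I \<Longrightarrow> y \<in> carrier F \<Longrightarrow> sprod (free_sa par) x y \<in> I"
  using ideal.I_r_closed[OF ideal_I, of x y] by (simp add: free_ring_simps)

lemma I_scale: "x \<in> I \<Longrightarrow> scale c x \<in> I"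
  using I_mult_left[of "Poly_Mapping.single [] c" x] by (simp add: free_ring_simps free_mult_const)

lemma subspace_I: "pm.subspace I"
  by (rule pm.subspaceI) (auto simp: I_zero I_add I_scale)

text \<open>Closure under negation follows from closure under multiplication, since -x is the
  product of the constant -1 with x.\<close>

lemma ideal_FI:
  assumes "K \<subseteq> carrier F" "0 \<in> K" "\<And>x y. x \<in> K \<Longrightarrow> y \<in> K \<Longrightarrow> x + y \<in> K"
    and "\<And>x y. x \<in> carrier F \<Longrightarrow> y \<in> K \<Longrightarrow> sprod (free_sa par) x y \<in> K"
    and "\<And>x y. x \<in> carrier F \<Longrightarrow> y \<in> K \<Longrightarrow> sprod (free_sa par) y x \<in> K"
  shows "ideal K F"
proof (rule idealI[OF ring_F])
  interpret ring F by (rule ring_F)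
  show "subgroup K (add_monoid F)"
  proof (rule add.subgroupI)
    fix x assume "x \<in> K"
    then have "sprod (free_sa par) (Poly_Mapping.single [] (- 1)) x \<in> K"
      by (intro assms(4)) (auto simp: free_ring_simps)
    then show "\<ominus>\<^bsub>F\<^esub> x \<in> K"
      using \<open>x \<in> K\<close> assms(1) by (auto simp: a_inv_free_ring free_mult_const pm.scale_minus_left)
  qed (use assms in \<open>auto simp: free_ring_simps\<close>)
qed (use assms in \<open>auto simp: free_ring_simps\<close>)

lemma presented_simps:
  "carrier P = carrier (F Quot I)" "monoid.mult P = monoid.mult (F Quot I)" "\<one>\<^bsub>P\<^esub> = \<one>\<^bsub>F Quot I\<^esub>"
  "\<zero>\<^bsub>P\<^esub> = \<zero>\<^bsub>F Quot I\<^esub>" "add P = add (F Quot I)"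
  by (simp_all add: presented_def Let_def)

lemma cls_eq_iff: "x \<in> carrier F \<Longrightarrow> y \<in> carrier F \<Longrightarrow> cls x = cls y \<longleftrightarrow> x - y \<in> I"
  using ring.quotient_eq_iff_same_a_r_cos[OF ring_F ideal_I, of x y]
  by (simp add: pres_class_def a_minus_free_ring)

lemma carrier_P: "carrier P = cls ` carrier F"
  by (auto simp: presented_simps FactRing_def A_RCOSETS_def' pres_class_def)

lemma cls_closed: "x \<in> carrier F \<Longrightarrow> cls x \<in> carrier P"
  by (simp add: carrier_P)

lemma cls_ring_hom: "cls \<in> ring_hom F P"
  using ideal.rcos_ring_hom[OF ideal_I]
  unfolding ring_hom_def presented_simps pres_class_def by simp

lemma cls_mult: "x \<in> carrier F \<Longrightarrow> y \<in> carrier F \<Longrightarrow> cls x \<otimes>\<^bsub>P\<^esub> cls y = cls (sprod (free_sa par) x y)"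
  using ring_hom_mult[OF cls_ring_hom, of x y] by (simp add: free_ring_simps)

lemma cls_add: "x \<in> carrier F \<Longrightarrow> y \<in> carrier F \<Longrightarrow> cls x \<oplus>\<^bsub>P\<^esub> cls y = cls (x + y)"
  using ring_hom_add[OF cls_ring_hom, of x y] by (simp add: free_ring_simps)

lemma cls_one: "\<one>\<^bsub>P\<^esub> = cls free_one"
  using ring_hom_one[OF cls_ring_hom] by (simp add: free_ring_simps)

lemma cls_smult: "x \<in> carrier F \<Longrightarrow> c \<odot>\<^bsub>P\<^esub> cls x = cls (scale c x)"
  using cls_mult[of "Poly_Mapping.single [] c" x]
  by (simp add: free_mult_const presented_def Let_def free_ring_simps)

lemma hpart_P: "hpart P p = cls ` {x \<in> carrier F. homogeneous par p x}"
  by (auto simp: presented_def Let_def homogeneous_def free_ring_simps)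

lemma ring_P: "ring P"
proof -
  interpret Q: ring "F Quot I" by (rule ideal.quotient_is_ring[OF ideal_I])
  show ?thesis
  proof (rule ringI)
    show "abelian_group P"
    proof (rule abelian_groupI)
      fix x assume "x \<in> carrier P"
      then show "\<exists>y\<in>carrier P. y \<oplus>\<^bsub>P\<^esub> x = \<zero>\<^bsub>P\<^esub>"
        by (intro bexI[of _ "\<ominus>\<^bsub>F Quot I\<^esub> x"]) (simp_all add: presented_simps Q.l_neg)
    qed (simp_all add: presented_simps Q.add.m_ac)
    show "Group.monoid P"
      by (rule monoidI) (simp_all add: presented_simps Q.m_assoc)
  qed (simp_all add: presented_simps Q.l_distr Q.r_distr)
qed

lemma cls_zero: "\<zero>\<^bsub>P\<^esub> = cls 0"
proof -
  interpret ring P by (rule ring_P)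
  have "cls 0 \<oplus>\<^bsub>P\<^esub> cls 0 = cls 0" by (simp add: cls_add free_ring_closed)
  then show ?thesis using cls_closed[OF free_ring_closed(6)] by (metis add.r_cancel_one')
qed

lemma module_P: "module Cq_ring P"
proof (rule moduleI)
  show "cring Cq_ring" by (rule cring_from_type_algebra)
  show "abelian_group P" using ring_P by (rule ring.is_abelian_group)
qed (auto simp: carrier_P cls_smult cls_add free_ring_closed ring_of_type_algebra_def pm.scale_left_distrib
      pm.scale_right_distrib)

end

locale homogeneous_presentation = presentation +
  assumes rels_homogeneous: "x \<in> R \<Longrightarrow> \<exists>p. homogeneous par p x"
begin

text \<open>The elements all of whose parity components lie in the ideal form an ideal themselves,
  by \<open>hom_part_free_mult\<close>. It contains the homogeneous relations, hence the ideal they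
  generate.\<close>

lemma I_graded:
  assumes "x \<in> I"
  shows "hom_part par p x \<in> I"
proof -
  define K where "K = {x \<in> carrier F. \<forall>p. hom_part par p x \<in> I}"
  have "ideal K F"
  proof (rule ideal_FI)
    fix x y assume xy: "x \<in> carrier F" "y \<in> K"
    have xp: "hom_part par p x \<in> carrier F" for p
      using xy(1) keys_hom_part[of par p x] by (auto simp: free_ring_simps)
    show "sprod (free_sa par) x y \<in> K"
      using xy xp by (auto simp: K_def hom_part_free_mult free_ring_closed intro!: I_add I_mult_left)
    show "sprod (free_sa par) y x \<in> K"
      using xy xp by (auto simp: K_def hom_part_free_mult free_ring_closed intro!: I_add I_mult_right)
  qed (auto simp: K_def linmap_zero[OF linmap_hom_part] linmap_add[OF linmap_hom_part] I_zero I_add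
      free_ring_closed)
  moreover have "R \<subseteq> K"
  proof
    fix r assume r: "r \<in> R"
    then obtain s where "homogeneous par s r" using rels_homogeneous by blast
    then show "r \<in> K"
      using r rels_closed rels_in_I by (auto simp: K_def hom_part_homogeneous I_zero)
  qed
  ultimately have "I \<subseteq> K" by (rule I_minimal)
  then show ?thesis using assms by (auto simp: K_def)
qed

lemma superalgebra_P: "superalgebra P"
proof -
  interpret ring P by (rule ring_P)
  interpret M: module Cq_ring P by (rule module_P)
  have sub: "submodule (hpart P p) Cq_ring P" for p
  proof (rule M.submoduleI)
    fix a assume "a \<in> hpart P p"
    then obtain x where x: "x \<in> carrier F" "homogeneous par p x" "a = cls x" by (auto simp: hpart_P)
    have "cls (scale (- 1) x) \<oplus>\<^bsub>P\<^esub> a = \<zero>\<^bsub>P\<^esub>"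
      using x by (simp add: cls_add free_ring_closed cls_zero pm.scale_minus_left)
    then have "\<ominus>\<^bsub>P\<^esub> a = cls (scale (- 1) x)"
      using x by (intro minus_equality) (auto simp: cls_closed free_ring_closed)
    then show "\<ominus>\<^bsub>P\<^esub> a \<in> hpart P p"
      using x homogeneous_scale[of par p x "- 1"] by (simp only: hpart_P) (simp add: free_ring_closed)
  qed (auto simp: hpart_P cls_zero cls_add cls_smult cls_closed free_ring_closed
      homogeneous_add homogeneous_scale intro!: imageI, auto simp: homogeneous_def)
  have direct: "\<exists>!y. y \<in> hpart P 0 \<times> hpart P 1 \<and> a = fst y \<oplus>\<^bsub>P\<^esub> snd y" if "a \<in> carrier P" for a
  proof -
    obtain x where x: "x \<in> carrier F" "a = cls x"
      using \<open>a \<in> carrier P\<close> by (auto simp: carrier_P)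
    have xp: "hom_part par p x \<in> carrier F" for p
      using x(1) keys_hom_part[of par p x] by (auto simp: free_ring_simps)
    \<comment> \<open>Uniqueness of the decomposition: two representatives of the same class differ
      by an element of the ideal, and by \<open>I_graded\<close> its even and odd parts lie there
      separately.\<close>
    have eq: "b = cls (hom_part par 0 x) \<and> c = cls (hom_part par 1 x)"
      if "b \<in> hpart P 0" "c \<in> hpart P 1" "a = b \<oplus>\<^bsub>P\<^esub> c" for b c
    proof -
      obtain y z where y: "y \<in> carrier F" "homogeneous par 0 y" "b = cls y"
        and z: "z \<in> carrier F" "homogeneous par 1 z" "c = cls z"
        using \<open>b \<in> hpart P 0\<close> \<open>c \<in> hpart P 1\<close> by (auto simp: hpart_P)
      have "(y + z) - x \<in> I"
        using that(3) x y z by (metis cls_add cls_eq_iff free_ring_closed)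
      then have "hom_part par p ((y + z) - x) \<in> I" for p by (rule I_graded)
      from this[of 0] this[of 1] have "y - hom_part par 0 x \<in> I" "z - hom_part par 1 x \<in> I"
        by (simp_all add: linmap_add[OF linmap_hom_part] linmap_diff[OF linmap_hom_part] hom_part_homogeneous[OF y(2)] hom_part_homogeneous[OF z(2)])
      then show ?thesis using y z xp by (simp add: cls_eq_iff)
    qed
    show ?thesis
    proof (rule ex1I[of _ "(cls (hom_part par 0 x), cls (hom_part par 1 x))"])
      show "(cls (hom_part par 0 x), cls (hom_part par 1 x)) \<in> hpart P 0 \<times> hpart P 1 \<and>
        a = fst (cls (hom_part par 0 x), cls (hom_part par 1 x)) \<oplus>\<^bsub>P\<^esub> snd (cls (hom_part par 0 x), cls (hom_part par 1 x))"
        using x xp by (auto simp: hpart_P homogeneous_hom_part cls_add hom_part_sum)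
    qed (use eq in force)
  qed
  have space: "superspace P"
    by (intro superspace.intro module_P superspace_axioms.intro sub direct)
  show ?thesis
  proof (intro superalgebra.intro space ring_P superalgebra_axioms.intro)
    fix c a b assume "a \<in> carrier P" "b \<in> carrier P"
    then show "(c \<odot>\<^bsub>P\<^esub> a) \<otimes>\<^bsub>P\<^esub> b = c \<odot>\<^bsub>P\<^esub> (a \<otimes>\<^bsub>P\<^esub> b)" "a \<otimes>\<^bsub>P\<^esub> (c \<odot>\<^bsub>P\<^esub> b) = c \<odot>\<^bsub>P\<^esub> (a \<otimes>\<^bsub>P\<^esub> b)"
      by (auto simp: carrier_P cls_smult cls_mult free_ring_closed sprod_simps)
  next
    show "\<one>\<^bsub>P\<^esub> \<in> hpart P 0"
      unfolding cls_one hpart_P by (rule imageI) (auto simp: free_ring_closed, auto simp: homogeneous_def free_one_def word_par_def)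
  next
    fix a b p r assume "a \<in> hpart P p" "b \<in> hpart P r"
    then obtain x y where "x \<in> carrier F" "homogeneous par p x" "a = cls x"
      "y \<in> carrier F" "homogeneous par r y" "b = cls y"
      by (auto simp: hpart_P)
    then show "a \<otimes>\<^bsub>P\<^esub> b \<in> hpart P (p + r)"
      using homogeneous_free_mult[of par p x r y]
      by (simp only: hpart_P) (simp add: cls_mult free_ring_closed)
  qed
qed

end

text \<open>The preimage of the target ideal under \<open>h\<close> is an ideal that contains the
  relations of the source, so minimality of the generated ideal applies.\<close>

lemma presented_hom_ideal:
  assumes pres: "homogeneous_presentation par G R" "homogeneous_presentation par' G' R'"
    and lin: "linmap h"
    and h_mult: "\<And>x y. h (sprod (free_sa par) x y) = sprod (free_sa par') (h x) (h y)"
    and h_closed: "\<And>x. x \<in> carrier (free_ring par G) \<Longrightarrow> h x \<in> carrier (free_ring par' G')"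
    and h_rels: "\<And>x. x \<in> R \<Longrightarrow> h x \<in> rel_ideal par' G' R'"
    and x: "x \<in> rel_ideal par G R"
  shows "h x \<in> rel_ideal par' G' R'"
proof -
  interpret A: homogeneous_presentation par G R by (rule pres(1))
  interpret B: homogeneous_presentation par' G' R' by (rule pres(2))
  have "ideal {x \<in> carrier A.F. h x \<in> B.I} A.F"
    by (rule A.ideal_FI)
      (auto simp: linmap_zero[OF lin] linmap_add[OF lin] h_mult free_ring_closed h_closed
        B.I_zero B.I_add B.I_mult_left B.I_mult_right)
  then have "A.I \<subseteq> {x \<in> carrier A.F. h x \<in> B.I}"
    using A.rels_closed h_rels by (intro A.I_minimal) auto
  then show ?thesis using x by auto
qed

text \<open>All conditions concern the homomorphism \<open>h\<close> between the free superalgebras.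
  Bijectivity downstairs is expressed by \<open>h_kernel\<close> (only elements of the source ideal
  reach the target ideal) and \<open>h_surj\<close> (every element is in the image up to the target
  ideal), so no inverse has to be supplied.\<close>

lemma presented_superalgebra_iso:
  assumes pres: "homogeneous_presentation par G R" "homogeneous_presentation par' G' R'"
    and lin: "linmap h"
    and h_mult: "\<And>x y. h (sprod (free_sa par) x y) = sprod (free_sa par') (h x) (h y)"
    and h_one: "h free_one = free_one"
    and h_closed: "\<And>x. x \<in> carrier (free_ring par G) \<Longrightarrow> h x \<in> carrier (free_ring par' G')"
    and h_homogeneous: "\<And>p x. x \<in> carrier (free_ring par G) \<Longrightarrow> homogeneous par p x \<Longrightarrow> homogeneous par' p (h x)"
    and h_rels: "\<And>x. x \<in> R \<Longrightarrow> h x \<in> rel_ideal par' G' R'"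
    and h_kernel: "\<And>x. x \<in> carrier (free_ring par G) \<Longrightarrow> h x \<in> rel_ideal par' G' R' \<Longrightarrow> x \<in> rel_ideal par G R"
    and h_surj: "\<And>y. y \<in> carrier (free_ring par' G') \<Longrightarrow>
      \<exists>x\<in>carrier (free_ring par G). y - h x \<in> rel_ideal par' G' R'"
  shows "\<exists>\<tau>. superalgebra_iso (presented par G R) (presented par' G' R') \<tau> \<and>
    (\<forall>x\<in>carrier (free_ring par G). \<tau> (pres_class par G R x) = pres_class par' G' R' (h x))"
proof -
  interpret A: homogeneous_presentation par G R by (rule pres(1))
  interpret B: homogeneous_presentation par' G' R' by (rule pres(2))
  note I = presented_hom_ideal[OF pres lin h_mult h_closed h_rels]
  \<comment> \<open>An arbitrary representative of the class is chosen; \<open>I\<close> shows that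
    the value does not depend on the choice.\<close>
  define \<tau> where "\<tau> = (\<lambda>Z. B.cls (h (inv_into (carrier A.F) A.cls Z)))"
  have \<tau>: "\<tau> (A.cls x) = B.cls (h x)" if x: "x \<in> carrier A.F" for x
  proof -
    define x' where "x' = inv_into (carrier A.F) A.cls (A.cls x)"
    have x': "x' \<in> carrier A.F" "A.cls x' = A.cls x"
      unfolding x'_def using x by (simp_all add: inv_into_into f_inv_into_f)
    then have "x' - x \<in> A.I" using x by (simp add: A.cls_eq_iff)
    then have "h x' - h x \<in> B.I" using I[of "x' - x"] by (simp add: linmap_diff[OF lin])
    then show ?thesis
      unfolding \<tau>_def x'_def[symmetric] using x x'(1) by (simp add: B.cls_eq_iff h_closed)
  qed
  have "\<tau> \<in> ring_hom A.P B.P"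
    by (rule ring_hom_memI)
      (auto simp: A.carrier_P \<tau> h_closed B.cls_closed A.cls_mult B.cls_mult A.cls_add B.cls_add
        A.cls_one B.cls_one free_ring_closed h_mult h_one linmap_add[OF lin])
  moreover have "bij_betw \<tau> (carrier A.P) (carrier B.P)"
  proof (rule bij_betw_imageI)
    show "inj_on \<tau> (carrier A.P)"
    proof (rule inj_onI)
      fix Z Y assume "Z \<in> carrier A.P" "Y \<in> carrier A.P" and eq: "\<tau> Z = \<tau> Y"
      then obtain x y where x: "x \<in> carrier A.F" "Z = A.cls x" and y: "y \<in> carrier A.F" "Y = A.cls y"
        by (auto simp: A.carrier_P)
      then have "h (x - y) \<in> B.I"
        using eq by (simp add: \<tau> B.cls_eq_iff h_closed linmap_diff[OF lin])
      then have "x - y \<in> A.I" using x y by (intro h_kernel) (simp add: free_ring_closed)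
      then show "Z = Y" using x y by (simp add: A.cls_eq_iff)
    qed
    show "\<tau> ` carrier A.P = carrier B.P"
    proof (intro equalityI subsetI)
      fix Y assume "Y \<in> carrier B.P"
      then obtain y where y: "y \<in> carrier B.F" "Y = B.cls y" by (auto simp: B.carrier_P)
      then obtain x where x: "x \<in> carrier A.F" "y - h x \<in> B.I" using h_surj by blast
      then have "Y = \<tau> (A.cls x)" using y by (simp add: \<tau> B.cls_eq_iff h_closed)
      then show "Y \<in> \<tau> ` carrier A.P" using x A.cls_closed by blast
    qed (auto simp: A.carrier_P \<tau> B.cls_closed h_closed)
  qed
  moreover have "\<forall>c. \<forall>Z\<in>carrier A.P. \<tau> (c \<odot>\<^bsub>A.P\<^esub> Z) = c \<odot>\<^bsub>B.P\<^esub> \<tau> Z"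
    by (auto simp: A.carrier_P A.cls_smult \<tau> B.cls_smult free_ring_closed h_closed linmap_scale[OF lin])
  moreover have "\<tau> ` hpart A.P p \<subseteq> hpart B.P p" for p
    by (auto simp: A.hpart_P B.hpart_P \<tau> h_closed h_homogeneous)
  ultimately have "superalgebra_iso A.P B.P \<tau>"
    by (simp add: superalgebra_iso_def ring_iso_def A.superalgebra_P B.superalgebra_P)
  then show ?thesis using \<tau> by blast
qed

section \<open>The entries of the matrix relations\<close>

abbreviation (input) mmf :: "('g \<Rightarrow> bit) \<Rightarrow> ((int \<times> int) \<times> (int \<times> int) \<times> 'g list) based_sa" where
  "mmf par \<equiv> mat_sa \<otimes>\<^sub>s mat_sa \<otimes>\<^sub>s free_sa par"

abbreviation mon :: "int \<Rightarrow> int \<Rightarrow> int \<Rightarrow> int \<Rightarrow> ((int \<times> int) list \<Rightarrow>\<^sub>0 Cq)" where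
  "mon i a j b \<equiv> Poly_Mapping.single [(i, a), (j, b)] 1"

section \<open>Koszul signs in triple tensor products\<close>

lemma word_par_simps [simp]: "word_par par [] = 0" "word_par par (g # w) = par g + word_par par w"
  by (simp_all add: word_par_def)

lemma bit_add_self [simp]: "p + p = 0" for p :: bit
  by (cases p) simp_all

text \<open>The sign for exchanging factors of parities p and r. A separate constant keeps products
  of parities folded until case distinctions have made them explicit.\<close>

definition koszul :: "bit \<Rightarrow> bit \<Rightarrow> Cq" where
  "koszul p r = ksign (p * r)"

lemma koszul_simps [simp]: "koszul p 0 = 1" "koszul 0 p = 1" "koszul 1 1 = - 1"
  by (simp_all add: koszul_def)

text \<open>The first sign arises from moving E_ca past E_jd and the word v, the second from moving
  E_db past v.\<close>

lemma bmul_mmf: "bmul (mmf par) ((i, c), (j, d), v) ((c', a), (d', b), w) =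
  (if c = c' \<and> d = d' then Poly_Mapping.single ((i, a), (j, b), v @ w)
     (koszul (ipar j + ipar d + word_par par v) (ipar c + ipar a)
       * koszul (word_par par v) (ipar d + ipar b))
   else 0)"
  by (cases "ipar a"; cases "ipar b"; cases "ipar c'"; cases "ipar d'"; cases "ipar j"; cases "word_par par v")
    (simp_all add: tens_sa_def mat_sa_def free_sa_def pair_par_def tens_simps
      linmap_neg[OF linmap_tens_right] single_uminus)

lemma finite_idx [simp]: "finite (idx N)"
  by (simp add: idx_def)

lemma sum_delta3:
  assumes "finite I" "finite Z"
  shows "(\<Sum>i\<in>I. \<Sum>a\<in>A. \<Sum>z\<in>Z. if c = i \<and> d = z then T i a z else 0) =
    (if c \<in> I \<and> d \<in> Z then \<Sum>a\<in>A. T c a d else (0 :: 'a :: comm_monoid_add))"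
proof -
  have "(\<Sum>a\<in>A. \<Sum>z\<in>Z. if c = i \<and> d = z then T i a z else 0) =
    (if c = i then if d \<in> Z then \<Sum>a\<in>A. T c a d else 0 else 0)" for i
    using assms by (cases "c = i") auto
  then show ?thesis using assms by simp
qed

lemma single_mult_gmat1:
  assumes "finite rows" "finite Z"
  shows "sprod (mmf par) (Poly_Mapping.single ((i, c), (j, d), v) e) (gmat1 rows n Z) =
    (if c \<in> rows \<and> d \<in> Z then \<Sum>a\<in>idx n. Poly_Mapping.single ((i, a), (j, d), v @ [(c, a)])
       (e * koszul (ipar j + ipar d + word_par par v) (ipar c + ipar a)) else 0)"
proof -
  have "sprod (mmf par) (Poly_Mapping.single ((i, c), (j, d), v) e) (gmat1 rows n Z) =
    (\<Sum>l\<in>rows. \<Sum>a\<in>idx n. \<Sum>z\<in>Z. if c = l \<and> d = z then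
      Poly_Mapping.single ((i, a), (j, z), v @ [(l, a)])
       (e * koszul (ipar j + ipar d + word_par par v) (ipar c + ipar a)) else 0)"
    unfolding gmat1_def E_def idm_def gen_def
    by (simp add: tens_simps sprod_simps bmul_mmf) (intro sum.cong refl; simp add: scale_single)
  then show ?thesis by (simp only: sum_delta3[OF assms])
qed

lemma single_mult_gmat2:
  assumes "finite rows" "finite Z"
  shows "sprod (mmf par) (Poly_Mapping.single ((i, c), (j, d), v) e) (gmat2 rows n Z) =
    (if d \<in> rows \<and> c \<in> Z then \<Sum>b\<in>idx n. Poly_Mapping.single ((i, c), (j, b), v @ [(d, b)])
       (e * koszul (word_par par v) (ipar d + ipar b)) else 0)"
proof -
  have "sprod (mmf par) (Poly_Mapping.single ((i, c), (j, d), v) e) (gmat2 rows n Z) =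
    (\<Sum>l\<in>rows. \<Sum>b\<in>idx n. \<Sum>z\<in>Z. if d = l \<and> c = z then
      Poly_Mapping.single ((i, z), (j, b), v @ [(l, b)])
       (e * koszul (word_par par v) (ipar d + ipar b)) else 0)"
    unfolding gmat2_def E_def idm_def gen_def
    by (simp add: tens_simps sprod_simps bmul_mmf) (intro sum.cong refl; simp add: scale_single)
  then show ?thesis by (simp only: sum_delta3[OF assms])
qed

lemma linmap_lookup_scale: "linmap (\<lambda>x. scale (Poly_Mapping.lookup x k * s) v)"
  by (rule linmapI) (simp_all add: lookup_add distrib_right pm.scale_left_distrib mult.assoc)

lemma linmap_if: "(P \<Longrightarrow> linmap f) \<Longrightarrow> linmap (\<lambda>x. if P then f x else 0)"
  by (rule linmapI) (auto simp: linmap_add linmap_scale pm.scale_zero_right)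

text \<open>Both sides are linear in A, so A may be taken to be one basis vector; the identity
  matrices and the matrix units then collapse the sums. The two signs come from moving E_ca past
  E_jd, and E_db past t_ca.\<close>

lemma coeff_left:
  assumes "finite rows"
  shows "coeff3 (i, a) (j, b)
      (put12 A \<star>\<^bsub>mmf par\<^esub> gmat1 rows n rows \<star>\<^bsub>mmf par\<^esub> gmat2 rows n (idx n)) =
    (if a \<in> idx n \<and> b \<in> idx n then \<Sum>c\<in>rows. \<Sum>d\<in>rows.
      scale (Poly_Mapping.lookup A ((i, c), (j, d)) *
        (koszul (ipar j + ipar d) (ipar c + ipar a) * koszul (par (c, a)) (ipar d + ipar b))) (mon c a d b)
     else 0)"
proof -
  have "(\<lambda>A. coeff3 (i, a) (j, b)
      (put12 A \<star>\<^bsub>mmf par\<^esub> gmat1 rows n rows \<star>\<^bsub>mmf par\<^esub> gmat2 rows n (idx n))) = (\<lambda>A.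
    (if a \<in> idx n \<and> b \<in> idx n then \<Sum>c\<in>rows. \<Sum>d\<in>rows.
      scale (Poly_Mapping.lookup A ((i, c), (j, d)) *
        (koszul (ipar j + ipar d) (ipar c + ipar a) * koszul (par (c, a)) (ipar d + ipar b))) (mon c a d b)
     else 0))" (is "?l = ?r")
  proof (rule linmap_ext)
    show "linmap ?l" unfolding put12_lin by (intro linmap_coeff3' linmap_intros)
    show "linmap ?r" by (intro linmap_if linmap_sum_fun linmap_lookup_scale)
    fix w :: "(int \<times> int) \<times> (int \<times> int)"
    obtain i' c' j' d' where w: "w = ((i', c'), (j', d'))" by (metis prod.exhaust)
    have "?l (Poly_Mapping.single w 1) = (if c' \<in> rows \<and> d' \<in> rows then \<Sum>a'\<in>idx n. \<Sum>b'\<in>idx n.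
       if a = a' \<and> b = b' \<and> i = i' \<and> j = j' then scale (koszul (ipar j' + ipar d') (ipar c' + ipar a') * koszul (par (c', a')) (ipar d' + ipar b'))
         (mon c' a' d' b') else 0 else 0)"
      unfolding w put12_lin using assms
      by (auto simp: single_mult_gmat1 single_mult_gmat2 sprod_simps linmap_sum[OF linmap_coeff3]
          linmap_zero[OF linmap_coeff3] coeff3_single ksign_add scale_single intro!: sum.cong)
    also have "\<dots> = ?r (Poly_Mapping.single w 1)"
    proof -
      have "(\<Sum>a'\<in>idx n. \<Sum>b'\<in>idx n. if a = a' \<and> b = b' \<and> P then T a' b' else 0) =
        (if a \<in> idx n \<and> b \<in> idx n \<and> P then T a b else 0)" for P and T :: "int \<Rightarrow> int \<Rightarrow> ((int \<times> int) list \<Rightarrow>\<^sub>0 Cq)"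
      proof -
        have "(\<Sum>b'\<in>idx n. if a = a' \<and> b = b' \<and> P then T a' b' else 0) =
          (if a = a' then if b \<in> idx n \<and> P then T a b else 0 else 0)" for a'
          by (cases "a = a'"; cases P) auto
        then show ?thesis by simp
      qed
      moreover have "(\<Sum>c\<in>rows. \<Sum>d\<in>rows. scale (Poly_Mapping.lookup (Poly_Mapping.single w 1) ((i, c), (j, d)) * s c d) (T c d))
        = (if c' \<in> rows \<and> d' \<in> rows \<and> i = i' \<and> j = j' then scale (s c' d') (T c' d') else 0)"
        for s and T :: "int \<Rightarrow> int \<Rightarrow> ((int \<times> int) list \<Rightarrow>\<^sub>0 Cq)"
      proof -
        have "(\<Sum>d\<in>rows. scale (Poly_Mapping.lookup (Poly_Mapping.single w 1) ((i, c), (j, d)) * s c d) (T c d)) =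
          (\<Sum>d\<in>rows. if d' = d then if c' = c \<and> i = i' \<and> j = j' then scale (s c d) (T c d) else 0 else 0)" for c
          unfolding w by (intro sum.cong refl) (auto simp: lookup_single when_def)
        also have "\<dots> c = (if c' = c then if d' \<in> rows \<and> i = i' \<and> j = j' then scale (s c' d') (T c' d') else 0 else 0)" for c
          using assms by auto
        finally show ?thesis using assms by simp
      qed
      ultimately show ?thesis by auto
    qed
    finally show "?l (Poly_Mapping.single w 1) = ?r (Poly_Mapping.single w 1)" .
  qed
  then show ?thesis by (rule fun_cong)
qed

lemma coeff_single_mult_put12:
  "coeff3 (i, a) (j, b) (Poly_Mapping.single ((z, c), (y, d), v) e \<star>\<^bsub>mmf par\<^esub> put12 B) =
    (if z = i \<and> y = j then scale (Poly_Mapping.lookup B ((c, a), (d, b)) *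
        (e * (koszul (ipar j + ipar d + word_par par v) (ipar c + ipar a) * koszul (word_par par v) (ipar d + ipar b))))
       (Poly_Mapping.single v 1) else 0)"
proof -
  have "(\<lambda>B. coeff3 (i, a) (j, b) (Poly_Mapping.single ((z, c), (y, d), v) e \<star>\<^bsub>mmf par\<^esub> put12 B)) = (\<lambda>B.
    (if z = i \<and> y = j then scale (Poly_Mapping.lookup B ((c, a), (d, b)) *
        (e * (koszul (ipar j + ipar d + word_par par v) (ipar c + ipar a) * koszul (word_par par v) (ipar d + ipar b))))
       (Poly_Mapping.single v 1) else 0))" (is "?l = ?r")
  proof (rule linmap_ext)
    show "linmap ?l" unfolding put12_lin by (intro linmap_coeff3' linmap_intros)
    show "linmap ?r" by (intro linmap_if linmap_lookup_scale)
    fix w :: "(int \<times> int) \<times> (int \<times> int)"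
    obtain c' a' d' b' where w: "w = ((c', a'), (d', b'))" by (metis prod.exhaust)
    show "?l (Poly_Mapping.single w 1) = ?r (Poly_Mapping.single w 1)"
      unfolding w put12_lin
      by (auto simp: bmul_mmf coeff3_single scale_single lookup_single when_def
          linmap_scale[OF linmap_coeff3] linmap_zero[OF linmap_coeff3])
  qed
  then show ?thesis by (rule fun_cong)
qed

text \<open>The three signs arise, in this order, from moving E_ic past E_jd and t_jd, then E_ca
  past E_jd and t_jd t_ic, and finally E_db past t_jd t_ic. The monomial is t_jd t_ic because T^2
  stands to the left of T^1.\<close>

lemma coeff_right:
  assumes "finite rows"
  shows "coeff3 (i, a) (j, b)
      (gmat2 rows n rows \<star>\<^bsub>mmf par\<^esub> gmat1 rows n (idx n) \<star>\<^bsub>mmf par\<^esub> put12 B) =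
    (if j \<in> rows \<and> i \<in> rows then \<Sum>d\<in>idx n. \<Sum>c\<in>idx n.
      scale (Poly_Mapping.lookup B ((c, a), (d, b)) *
        (koszul (ipar j + ipar d + par (j, d)) (ipar i + ipar c) *
         (koszul (ipar j + ipar d + (par (j, d) + par (i, c))) (ipar c + ipar a) *
          koszul (par (j, d) + par (i, c)) (ipar d + ipar b)))) (mon j d i c)
     else 0)"
proof -
  have "gmat2 rows n rows = (\<Sum>y\<in>rows. \<Sum>d\<in>idx n. \<Sum>z\<in>rows. Poly_Mapping.single ((z, z), (y, d), [(y, d)]) 1)"
    unfolding gmat2_def E_def idm_def gen_def by (simp add: tens_simps)
  then have "gmat2 rows n rows \<star>\<^bsub>mmf par\<^esub> gmat1 rows n (idx n) =
    (\<Sum>y\<in>rows. \<Sum>d\<in>idx n. \<Sum>z\<in>rows. \<Sum>c\<in>idx n. Poly_Mapping.single ((z, c), (y, d), [(y, d), (z, c)])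
       (koszul (ipar y + ipar d + par (y, d)) (ipar z + ipar c)))"
    by (auto intro!: sum.cong simp: sprod_simps single_mult_gmat1 assms)
  then have "coeff3 (i, a) (j, b)
      (gmat2 rows n rows \<star>\<^bsub>mmf par\<^esub> gmat1 rows n (idx n) \<star>\<^bsub>mmf par\<^esub> put12 B) =
    (\<Sum>y\<in>rows. \<Sum>d\<in>idx n. \<Sum>z\<in>rows. \<Sum>c\<in>idx n. if z = i \<and> y = j then
      scale (Poly_Mapping.lookup B ((c, a), (d, b)) *
        (koszul (ipar j + ipar d + par (j, d)) (ipar i + ipar c) *
         (koszul (ipar j + ipar d + (par (j, d) + par (i, c))) (ipar c + ipar a) *
          koszul (par (j, d) + par (i, c)) (ipar d + ipar b)))) (mon j d i c) else 0)"
    by (auto intro!: sum.cong simp: sprod_simps linmap_sum[OF linmap_coeff3] coeff_single_mult_put12 add.assoc)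
  also have "\<dots> = (\<Sum>y\<in>rows. \<Sum>d\<in>idx n. \<Sum>z\<in>rows. if j = y \<and> i = z then \<Sum>c\<in>idx n.
      scale (Poly_Mapping.lookup B ((c, a), (d, b)) *
        (koszul (ipar j + ipar d + par (j, d)) (ipar i + ipar c) *
         (koszul (ipar j + ipar d + (par (j, d) + par (i, c))) (ipar c + ipar a) *
          koszul (par (j, d) + par (i, c)) (ipar d + ipar b)))) (mon j d i c) else 0)"
    by (intro sum.cong refl) auto
  finally show ?thesis
    unfolding sum_delta3[OF assms assms] .
qed

section \<open>The coefficients of S, R_+ and S_J\<close>

lemma sum_delta2:
  assumes "finite I" "\<And>x. x \<in> I \<Longrightarrow> finite (Y x)"
  shows "(\<Sum>x\<in>I. \<Sum>y\<in>Y x. if x = u \<and> y = v then T x y else 0) =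
    (if u \<in> I \<and> v \<in> Y u then T u v else (0 :: 'a :: comm_monoid_add))"
proof -
  have "(\<Sum>y\<in>Y x. if x = u \<and> y = v then T x y else 0) =
      (if x = u then if v \<in> Y u then T u v else 0 else 0)" if "x \<in> I" for x
    using assms(2)[OF that] by (cases "x = u") auto
  then have "(\<Sum>x\<in>I. \<Sum>y\<in>Y x. if x = u \<and> y = v then T x y else 0) =
    (\<Sum>x\<in>I. if x = u then if v \<in> Y u then T u v else 0 else 0)"
    by (intro sum.cong refl)
  then show ?thesis using assms(1) by simp
qed

lemma uminus_in_idx [simp]: "- i \<in> idx N \<longleftrightarrow> i \<in> idx N"
  by (auto simp: idx_def)

text \<open>The second tensor factor E_xy of an off-diagonal term of S has to be E_jd, which forces
  x = j and y = d and leaves one summand of each double sum. Comparison of the first factors then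
  gives c = j, d = i or c = -j, d = -i.\<close>

lemma lookup_Smat:
  "Poly_Mapping.lookup (Smat N) ((i, c), (j, d)) =
    (if i = c \<and> j = d \<and> i \<in> idx N \<and> j \<in> idx N then qvar powi phi i j else 0)
    + xi * ((if c = j \<and> d = i \<and> j < i \<and> i \<in> idx N \<and> j \<in> idx N then ksign (ipar j) else 0)
          + (if c = - j \<and> d = - i \<and> j < - i \<and> i \<in> idx N \<and> j \<in> idx N then ksign (ipar j) else 0))"
proof -
  have "Poly_Mapping.lookup (\<Sum>x\<in>idx N. \<Sum>y\<in>idx N. scale (qvar powi phi x y) (E x x \<otimes>\<^sub>t E y y)) ((i, c), (j, d))
     = (\<Sum>x\<in>idx N. \<Sum>y\<in>idx N. if x = i \<and> y = j then if i = c \<and> j = d then qvar powi phi x y else 0 else 0)"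
    unfolding lookup_sum E_def by (intro sum.cong refl) (auto simp: lookup_single when_def)
  also have "\<dots> = (if i = c \<and> j = d \<and> i \<in> idx N \<and> j \<in> idx N then qvar powi phi i j else 0)"
    by (subst sum_delta2) auto
  finally have 1: "Poly_Mapping.lookup (\<Sum>x\<in>idx N. \<Sum>y\<in>idx N. scale (qvar powi phi x y) (E x x \<otimes>\<^sub>t E y y)) ((i, c), (j, d)) = \<dots>" .
  have "Poly_Mapping.lookup (\<Sum>x\<in>idx N. \<Sum>y\<in>{y\<in>idx N. x < y}. scale (ksign (ipar x)) (E y x \<otimes>\<^sub>t E x y)) ((i, c), (j, d))
     = (\<Sum>x\<in>idx N. \<Sum>y\<in>{y\<in>idx N. x < y}. if x = j \<and> y = d then
         if i = d \<and> c = j then ksign (ipar x) else 0 else 0)"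
    unfolding lookup_sum E_def by (intro sum.cong refl) (auto simp: lookup_single when_def)
  also have "\<dots> = (if c = j \<and> d = i \<and> j < i \<and> i \<in> idx N \<and> j \<in> idx N then ksign (ipar j) else 0)"
    by (subst sum_delta2) auto
  finally have 2: "Poly_Mapping.lookup (\<Sum>x\<in>idx N. \<Sum>y\<in>{y\<in>idx N. x < y}.
      scale (ksign (ipar x)) (E y x \<otimes>\<^sub>t E x y)) ((i, c), (j, d)) = \<dots>" .
  have "Poly_Mapping.lookup (\<Sum>x\<in>idx N. \<Sum>y\<in>{y\<in>idx N. x < y}. scale (ksign (ipar x)) (E (- y) (- x) \<otimes>\<^sub>t E x y)) ((i, c), (j, d))
     = (\<Sum>x\<in>idx N. \<Sum>y\<in>{y\<in>idx N. x < y}. if x = j \<and> y = d then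
         if i = - d \<and> c = - j then ksign (ipar x) else 0 else 0)"
    unfolding lookup_sum E_def by (intro sum.cong refl) (auto simp: lookup_single when_def)
  also have "\<dots> = (if c = - j \<and> d = - i \<and> j < - i \<and> i \<in> idx N \<and> j \<in> idx N then ksign (ipar j) else 0)"
    by (subst sum_delta2) auto
  finally have 3: "Poly_Mapping.lookup (\<Sum>x\<in>idx N. \<Sum>y\<in>{y\<in>idx N. x < y}.
      scale (ksign (ipar x)) (E (- y) (- x) \<otimes>\<^sub>t E x y)) ((i, c), (j, d)) = \<dots>" .
  show ?thesis
    unfolding Smat_def tens_simps pm.scale_right_distrib sum.distrib
    unfolding pm.scale_right_distrib[symmetric] lookup_add lookup_scale 1 2 3 ..
qed

lemma lookup_Rplus:
  "Poly_Mapping.lookup (Rplus k) ((i, c), (j, d)) =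
    (if i = c \<and> j = d \<and> i \<in> {1..int k} \<and> j \<in> {1..int k} then if i = j then qvar else 1 else 0)
    + xi * (if c = j \<and> d = i \<and> j < i \<and> i \<in> {1..int k} \<and> j \<in> {1..int k} then 1 else 0)"
proof -
  have "Poly_Mapping.lookup (\<Sum>x\<in>{1..int k}. \<Sum>y\<in>{1..int k}.
       scale (if x = y then qvar else 1) (E x x \<otimes>\<^sub>t E y y)) ((i, c), (j, d))
     = (\<Sum>x\<in>{1..int k}. \<Sum>y\<in>{1..int k}. if x = i \<and> y = j then
         if i = c \<and> j = d then if x = y then qvar else 1 else 0 else 0)"
    unfolding lookup_sum E_def by (intro sum.cong refl) (auto simp: lookup_single when_def)
  also have "\<dots> = (if i = c \<and> j = d \<and> i \<in> {1..int k} \<and> j \<in> {1..int k} then if i = j then qvar else 1 else 0)"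
    by (subst sum_delta2) auto
  finally have 1: "Poly_Mapping.lookup (\<Sum>x\<in>{1..int k}. \<Sum>y\<in>{1..int k}.
       scale (if x = y then qvar else 1) (E x x \<otimes>\<^sub>t E y y)) ((i, c), (j, d)) = \<dots>" .
  have "Poly_Mapping.lookup (\<Sum>x\<in>{1..int k}. \<Sum>y\<in>{x<..int k}. E y x \<otimes>\<^sub>t E x y) ((i, c), (j, d))
     = (\<Sum>x\<in>{1..int k}. \<Sum>y\<in>{x<..int k}. if x = j \<and> y = d then if i = d \<and> c = j then 1 else 0 else 0)"
    unfolding lookup_sum E_def by (intro sum.cong refl) (auto simp: lookup_single when_def)
  also have "\<dots> = (if c = j \<and> d = i \<and> j < i \<and> i \<in> {1..int k} \<and> j \<in> {1..int k} then 1 else 0)"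
    by (subst sum_delta2) auto
  finally have 2: "Poly_Mapping.lookup (\<Sum>x\<in>{1..int k}. \<Sum>y\<in>{x<..int k}. E y x \<otimes>\<^sub>t E x y) ((i, c), (j, d)) = \<dots>" .
  show ?thesis
    unfolding Rplus_def lookup_add lookup_scale 1 2 ..
qed

lemma ipar_uminus_idx: "i \<in> idx N \<Longrightarrow> ipar (- i) = ipar i + 1"
  by (rule ipar_uminus) (simp add: idx_def)

text \<open>The equation between parities says that S is even: in each of its terms both tensor
  factors have the same parity.\<close>

lemma keys_Smat:
  assumes "((c, a), (d, b)) \<in> Poly_Mapping.keys (Smat N)"
  shows "a \<in> idx N \<and> b \<in> idx N \<and> c \<in> idx N \<and> d \<in> idx N \<and> ipar c + ipar a = ipar d + ipar b"
proof -
  have nz: "Poly_Mapping.lookup (Smat N) ((c, a), (d, b)) \<noteq> 0"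
    using assms by (simp add: in_keys_iff)
  have "P \<or> Q \<or> R" if "(if P then u else 0) + z * ((if Q then v else 0) + (if R then w else 0)) \<noteq> 0"
    for P Q R and u v w z :: Cq
    using that by (cases P; cases Q; cases R) auto
  from this[OF nz[unfolded lookup_Smat]] show ?thesis
    by (elim disjE conjE; cases "ipar c"; cases "ipar d"; simp add: ipar_uminus_idx)
qed

lemma bmul_mat2: "bmul (mat_sa \<otimes>\<^sub>s mat_sa) ((i, c), (j, d)) ((c', a), (d', b)) =
  (if c = c' \<and> d = d' then Poly_Mapping.single ((i, a), (j, b)) (koszul (ipar j + ipar d) (ipar c + ipar a)) else 0)"
  by (cases "ipar a"; cases "ipar c'"; cases "ipar d"; cases "ipar d'"; cases "ipar j")
    (auto simp: tens_sa_def mat_sa_def pair_par_def tens_simps single_uminus)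

text \<open>A term E_ca \<otimes> E_db becomes E_ca \<otimes> E_{-d,-b}. The sign is (-1)^{|d|} from
  the left J, (-1)^{|c|+|a|} from moving this J past E_ca, and (-1)^{|b|+1} from the right J. As S
  is even, |c|+|a| = |d|+|b|, and the product is -1 for every term.\<close>

lemma SJ_lin: "SJ n = lin (\<lambda>((c, a), (d, b)). Poly_Mapping.single ((c, a), (- d, - b)) (- 1)) (Smat n)"
proof -
  let ?J = "idm (idx n) \<otimes>\<^sub>t Jmat n"
  have J: "?J = (\<Sum>z\<in>idx n. \<Sum>e\<in>idx n. Poly_Mapping.single ((z, z), (- e, e)) (ksign (ipar e)))"
    unfolding idm_def Jmat_def E_def by (simp add: tens_simps scale_single) (rule sum.swap)
  have "?J \<star>\<^bsub>mat_sa \<otimes>\<^sub>s mat_sa\<^esub> Smat n \<star>\<^bsub>mat_sa \<otimes>\<^sub>s mat_sa\<^esub> ?J =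
      lin (\<lambda>((c, a), (d, b)). Poly_Mapping.single ((c, a), (- d, - b)) (- 1)) (Smat n)"
  proof (rule linmap_eqI[where g = "\<lambda>x. ?J \<star>\<^bsub>mat_sa \<otimes>\<^sub>s mat_sa\<^esub> x \<star>\<^bsub>mat_sa \<otimes>\<^sub>s mat_sa\<^esub> ?J"])
    fix w assume "w \<in> Poly_Mapping.keys (Smat n)"
    moreover obtain c a d b where w: "w = ((c, a), (d, b))" by (metis prod.exhaust)
    ultimately have "((c, a), (d, b)) \<in> Poly_Mapping.keys (Smat n)" by simp
    from keys_Smat[OF this]
    have cabd: "a \<in> idx n" "b \<in> idx n" "c \<in> idx n" "d \<in> idx n" "ipar c + ipar a = ipar d + ipar b"
      by simp_all
    have "?J \<star>\<^bsub>mat_sa \<otimes>\<^sub>s mat_sa\<^esub> Poly_Mapping.single w 1 =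
      (\<Sum>z\<in>idx n. \<Sum>e\<in>idx n. if z = c \<and> e = d then
        Poly_Mapping.single ((c, a), (- d, b)) (ksign (ipar d) * koszul (ipar (- d) + ipar d) (ipar c + ipar a)) else 0)"
      unfolding J w sprod_simps by (intro sum.cong refl) (simp add: bmul_mat2 scale_single)
    also have "\<dots> = Poly_Mapping.single ((c, a), (- d, b)) (ksign (ipar d) * koszul 1 (ipar c + ipar a))"
      using cabd by (subst sum_delta2) (simp_all add: ipar_uminus_idx add.assoc add.left_commute[of _ 1])
    finally have 1: "?J \<star>\<^bsub>mat_sa \<otimes>\<^sub>s mat_sa\<^esub> Poly_Mapping.single w 1 = \<dots>" .
    have "Poly_Mapping.single ((c, a), (- d, b)) s \<star>\<^bsub>mat_sa \<otimes>\<^sub>s mat_sa\<^esub> ?J =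
      (\<Sum>z\<in>idx n. \<Sum>e\<in>idx n. if z = a \<and> e = - b then
        Poly_Mapping.single ((c, a), (- d, - b)) (s * ksign (ipar (- b))) else 0)" for s
      unfolding J sprod_simps by (intro sum.cong refl) (auto simp: bmul_mat2 scale_single)
    also have "\<dots> s = Poly_Mapping.single ((c, a), (- d, - b)) (s * ksign (ipar b + 1))" for s
      using cabd by (subst sum_delta2) (simp_all add: ipar_uminus_idx)
    finally have "?J \<star>\<^bsub>mat_sa \<otimes>\<^sub>s mat_sa\<^esub> Poly_Mapping.single w 1 \<star>\<^bsub>mat_sa \<otimes>\<^sub>s mat_sa\<^esub> ?J =
      Poly_Mapping.single ((c, a), (- d, - b)) (ksign (ipar d) * koszul 1 (ipar d + ipar b) * ksign (ipar b + 1))"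
      unfolding 1 cabd(5) .
    also have "ksign (ipar d) * koszul 1 (ipar d + ipar b) * ksign (ipar b + 1) = - 1"
      by (cases "ipar d"; cases "ipar b") simp_all
    finally show "?J \<star>\<^bsub>mat_sa \<otimes>\<^sub>s mat_sa\<^esub> Poly_Mapping.single w 1 \<star>\<^bsub>mat_sa \<otimes>\<^sub>s mat_sa\<^esub> ?J =
      lin (\<lambda>((c, a), (d, b)). Poly_Mapping.single ((c, a), (- d, - b)) (- 1)) (Poly_Mapping.single w 1)"
      by (simp add: w)
  qed (intro linmap_intros)+
  then show ?thesis by (simp add: SJ_def)
qed

lemma lookup_SJ:
  "Poly_Mapping.lookup (SJ n) ((c, a), (d, b)) = - Poly_Mapping.lookup (Smat n) ((c, a), (- d, - b))"
proof -
  have "Poly_Mapping.lookup (SJ n) ((c, a), (d, b)) =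
    (\<Sum>w\<in>Poly_Mapping.keys (Smat n). if w = ((c, a), (- d, - b)) then - Poly_Mapping.lookup (Smat n) w else 0)"
    unfolding SJ_lin lin_def lookup_sum
    by (intro sum.cong refl) (auto simp: lookup_single when_def split: prod.splits)
  then show ?thesis by (simp add: in_keys_iff)
qed

lemma if_sum_mult:
  "((if P then u else 0) + z * ((if Q then of_bool Q' * v else 0) + (if R then of_bool R' * w else 0))) * g =
    (if P then u * g else 0) + (if Q then z * (of_bool Q' * v * g) else 0)
    + (if R then z * (of_bool R' * w * g) else (0 :: 'a :: comm_ring_1))"
  by (cases P; cases Q; cases R) (simp_all add: algebra_simps)

lemma Smat_row_sum:
  assumes "i \<in> idx N" "j \<in> idx N"
  shows "(\<Sum>c\<in>idx N. \<Sum>d\<in>idx N. Poly_Mapping.lookup (Smat N) ((i, c), (j, d)) * g c d) =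
    qvar powi phi i j * g i j
    + xi * (of_bool (j < i) * ksign (ipar j) * g j i + of_bool (j < - i) * ksign (ipar j) * g (- j) (- i))"
proof -
  have 1: "(if i = c \<and> j = d \<and> i \<in> idx N \<and> j \<in> idx N then qvar powi phi i j else 0) =
      (if c = i \<and> d = j then qvar powi phi i j else 0)" for c d
    using assms by auto
  have 2: "(if c = j \<and> d = i \<and> j < i \<and> i \<in> idx N \<and> j \<in> idx N then ksign (ipar j) else 0) =
      (if c = j \<and> d = i then of_bool (j < i) * ksign (ipar j) else 0)" for c d
    using assms by auto
  have 3: "(if c = - j \<and> d = - i \<and> j < - i \<and> i \<in> idx N \<and> j \<in> idx N then ksign (ipar j) else 0) =
      (if c = - j \<and> d = - i then of_bool (j < - i) * ksign (ipar j) else 0)" for c d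
    using assms by auto
  show ?thesis
    unfolding lookup_Smat 1 2 3 if_sum_mult sum.distrib
    using assms by (simp add: sum_delta2 distrib_left)
qed

lemma Smat_col_sum:
  assumes "a \<in> idx N" "b \<in> idx N"
  shows "(\<Sum>d\<in>idx N. \<Sum>c\<in>idx N. Poly_Mapping.lookup (Smat N) ((c, a), (d, b)) * g c d) =
    qvar powi phi a b * g a b
    + xi * (of_bool (a < b) * ksign (ipar a) * g b a + of_bool (- a < b) * ksign (ipar a + 1) * g (- b) (- a))"
proof -
  have 1: "(if c = a \<and> d = b \<and> c \<in> idx N \<and> d \<in> idx N then qvar powi phi c d else 0) =
      (if d = b \<and> c = a then qvar powi phi a b else 0)" for c d
    using assms by auto
  have 2: "(if a = d \<and> b = c \<and> d < c \<and> c \<in> idx N \<and> d \<in> idx N then ksign (ipar d) else 0) =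
      (if d = a \<and> c = b then of_bool (a < b) * ksign (ipar a) else 0)" for c d
    using assms by auto
  have 3: "(if a = - d \<and> b = - c \<and> d < - c \<and> c \<in> idx N \<and> d \<in> idx N then ksign (ipar d) else 0) =
      (if d = - a \<and> c = - b then of_bool (- a < b) * ksign (ipar a + 1) else 0)" for c d
    using assms by (auto simp: ipar_uminus_idx)
  show ?thesis
    unfolding lookup_Smat 1 2 3 if_sum_mult sum.distrib
    using assms by (simp add: sum_delta2 distrib_left)
qed

lemma SJ_col_sum:
  assumes "a \<in> idx N" "b \<in> idx N"
  shows "(\<Sum>d\<in>idx N. \<Sum>c\<in>idx N. Poly_Mapping.lookup (SJ N) ((c, a), (d, b)) * g c d) =
    - (qvar powi phi a (- b) * g a b
    + xi * (of_bool (a < - b) * ksign (ipar a) * g (- b) (- a) + of_bool (- a < - b) * ksign (ipar a + 1) * g b a))"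
proof -
  have "(\<Sum>d\<in>idx N. \<Sum>c\<in>idx N. Poly_Mapping.lookup (SJ N) ((c, a), (d, b)) * g c d) =
    - (\<Sum>d\<in>idx N. \<Sum>c\<in>idx N. Poly_Mapping.lookup (Smat N) ((c, a), (- d, - b)) * g c d)"
    by (simp add: lookup_SJ sum_negf)
  also have "(\<Sum>d\<in>idx N. \<Sum>c\<in>idx N. Poly_Mapping.lookup (Smat N) ((c, a), (- d, - b)) * g c d)
      = (\<Sum>d\<in>idx N. \<Sum>c\<in>idx N. Poly_Mapping.lookup (Smat N) ((c, a), (d, - b)) * g c (- d))"
    by (rule sum.reindex_bij_witness[of _ uminus uminus]) auto
  finally show ?thesis using assms by (simp add: Smat_col_sum)
qed

lemma Rplus_row_sum:
  assumes "i \<in> {1..int k}" "j \<in> {1..int k}"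
  shows "(\<Sum>c\<in>{1..int k}. \<Sum>d\<in>{1..int k}. Poly_Mapping.lookup (Rplus k) ((i, c), (j, d)) * g c d) =
    (if i = j then qvar else 1) * g i j + xi * (of_bool (j < i) * g j i)"
proof -
  have 1: "(if i = c \<and> j = d \<and> i \<in> {1..int k} \<and> j \<in> {1..int k} then if i = j then qvar else 1 else 0) =
      (if c = i \<and> d = j then if i = j then qvar else 1 else 0)" for c d
    using assms by auto
  have 2: "(if c = j \<and> d = i \<and> j < i \<and> i \<in> {1..int k} \<and> j \<in> {1..int k} then 1 else 0) =
      (if c = j \<and> d = i then of_bool (j < i) else (0 :: Cq))" for c d
    using assms by auto
  have 3: "((if P then u else 0) + z * (if Q then v else 0)) * h =
      (if P then u * h else 0) + (if Q then z * (v * h) else 0)" for P Q and u v z h :: Cq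
    by (cases P; cases Q) (simp_all add: algebra_simps)
  show ?thesis
    unfolding lookup_Rplus 1 2 3 sum.distrib
    using assms by (subst (1 2) sum_delta2) simp_all
qed

section \<open>Entries of the relations under linear functionals\<close>

abbreviation functional :: "(('a \<Rightarrow>\<^sub>0 Cq) \<Rightarrow> Cq) \<Rightarrow> bool" where
  "functional \<equiv> Vector_Spaces.linear scale (*)"

lemmas functional_scale = module_hom.scale[OF module_hom_linearI, of scale "(*)"]
  and functional_sum = module_hom.sum[OF module_hom_linearI, of scale "(*)"]
  and functional_diff = module_hom.diff[OF module_hom_linearI, of scale "(*)"]
  and functional_zero = module_hom.zero[OF module_hom_linearI, of scale "(*)"]

lemma functional_comp: "functional f \<Longrightarrow> linmap h \<Longrightarrow> functional (\<lambda>x. f (h x))"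
  by (simp add: Vector_Spaces.linear_iff)

definition rel_entry where
  "rel_entry par rows n A B i a j b =
     coeff3 (i, a) (j, b) (put12 A \<star>\<^bsub>mmf par\<^esub> gmat1 rows n rows \<star>\<^bsub>mmf par\<^esub> gmat2 rows n (idx n))
     - coeff3 (i, a) (j, b) (gmat2 rows n rows \<star>\<^bsub>mmf par\<^esub> gmat1 rows n (idx n) \<star>\<^bsub>mmf par\<^esub> put12 B)"

lemma matrix_rels_iff: "r \<in> matrix_rels par rows n A B \<longleftrightarrow> (\<exists>i a j b. r = rel_entry par rows n A B i a j b)"
  by (simp add: matrix_rels_def rel_entry_def Let_def split_paired_Ex)

text \<open>The relations are indexed by all pairs of integer index pairs. At positions outside the
  matrices the entry is 0, so the coordinate formulas only have to cover the proper index
  sets.\<close>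

lemma rel_entry_outside:
  assumes "finite rows"
    and A: "\<And>i c j d. Poly_Mapping.lookup A ((i, c), (j, d)) \<noteq> 0 \<Longrightarrow> i \<in> rows \<and> j \<in> rows"
    and B: "\<And>c a d b. Poly_Mapping.lookup B ((c, a), (d, b)) \<noteq> 0 \<Longrightarrow> a \<in> idx n \<and> b \<in> idx n"
    and out: "\<not> (i \<in> rows \<and> j \<in> rows \<and> a \<in> idx n \<and> b \<in> idx n)"
  shows "rel_entry par rows n A B i a j b = 0"
proof (cases "i \<in> rows \<and> j \<in> rows")
  case True
  then have "Poly_Mapping.lookup B ((c, a), (d, b)) = 0" for c d using B out by blast
  then show ?thesis using True out unfolding rel_entry_def coeff_left[OF assms(1)] coeff_right[OF assms(1)] by auto
next
  case False
  then have "Poly_Mapping.lookup A ((i, c), (j, d)) = 0" for c d using A by blast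
  then show ?thesis using False unfolding rel_entry_def coeff_left[OF assms(1)] coeff_right[OF assms(1)] by auto
qed

lemma rel_entry_closed:
  assumes "finite rows"
  shows "rel_entry par rows n A B i a j b \<in> carrier (free_ring par' (rows \<times> idx n))"
  unfolding rel_entry_def coeff_left[OF assms] coeff_right[OF assms] free_ring_simps mem_Collect_eq
  by (intro keys_diff_lists) (auto intro!: keys_sum_subset keys_scale_lists)

lemma homogeneous_sum: "(\<And>i. i \<in> I \<Longrightarrow> homogeneous par p (f i)) \<Longrightarrow> homogeneous par p (sum f I)"
  unfolding homogeneous_keys by (rule keys_sum_subset)

lemma homogeneous_zero: "homogeneous par p 0"
  by (simp add: homogeneous_def)

lemma homogeneous_scale_mon:
  "(c \<noteq> 0 \<Longrightarrow> par (i, a) + par (j, b) = p) \<Longrightarrow> homogeneous par p (scale (c * s) (mon i a j b))"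
  by (cases "c = 0") (auto simp: homogeneous_def scale_single)

text \<open>\<open>rp\<close> is the parity that a row contributes to a generator: |i| for A, and
  the constant 1 for the parity-shifted generators. It allows one argument for both presentations,
  based on evenness of the two coefficient matrices.\<close>

lemma rel_entry_homogeneous:
  assumes "finite rows" and par: "\<And>i a. i \<in> rows \<Longrightarrow> par (i, a) = rp i + ipar a"
    and A: "\<And>i c j d. Poly_Mapping.lookup A ((i, c), (j, d)) \<noteq> 0 \<Longrightarrow> rp c + rp d = rp i + rp j"
    and B: "\<And>c a d b. Poly_Mapping.lookup B ((c, a), (d, b)) \<noteq> 0 \<Longrightarrow> ipar c + ipar a = ipar d + ipar b"
  shows "homogeneous par (rp i + rp j + (ipar a + ipar b)) (rel_entry par rows n A B i a j b)"
proof -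
  have "par (c, a) + par (d, b) = rp i + rp j + (ipar a + ipar b)"
    if "Poly_Mapping.lookup A ((i, c), (j, d)) \<noteq> 0" "c \<in> rows" "d \<in> rows" for c d
  proof -
    have "par (c, a) + par (d, b) = (rp c + rp d) + (ipar a + ipar b)"
      unfolding par[OF that(2)] par[OF that(3)] by (simp only: ac_simps)
    then show ?thesis by (simp only: A[OF that(1)])
  qed
  moreover have "par (j, d) + par (i, c) = rp i + rp j + (ipar a + ipar b)"
    if "Poly_Mapping.lookup B ((c, a), (d, b)) \<noteq> 0" "i \<in> rows" "j \<in> rows" for c d
  proof -
    have "r + p = q + s" if "p + q = r + s" for p q r s :: bit
      using that by (cases p; cases q; cases r; cases s) simp_all
    from this[OF B[OF that(1)]] have *: "ipar d + ipar c = ipar a + ipar b" .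
    have "par (j, d) + par (i, c) = (rp i + rp j) + (ipar d + ipar c)"
      unfolding par[OF that(2)] par[OF that(3)] by (simp only: ac_simps)
    then show ?thesis by (simp only: *)
  qed
  ultimately show ?thesis
    unfolding rel_entry_def coeff_left[OF assms(1)] coeff_right[OF assms(1)]
    by (intro homogeneous_diff)
      (auto intro!: homogeneous_sum homogeneous_scale_mon simp only: if_True if_False homogeneous_zero split: if_split)
qed

lemma functional_rel_entry:
  assumes f: "functional f" and "finite rows" and "i \<in> rows" "j \<in> rows" "a \<in> idx n" "b \<in> idx n"
  shows "f (rel_entry par rows n A B i a j b) =
    (\<Sum>c\<in>rows. \<Sum>d\<in>rows. Poly_Mapping.lookup A ((i, c), (j, d)) *
        (koszul (ipar j + ipar d) (ipar c + ipar a) * koszul (par (c, a)) (ipar d + ipar b) * f (mon c a d b)))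
    - (\<Sum>d\<in>idx n. \<Sum>c\<in>idx n. Poly_Mapping.lookup B ((c, a), (d, b)) *
        (koszul (ipar j + ipar d + par (j, d)) (ipar i + ipar c) *
         (koszul (ipar j + ipar d + (par (j, d) + par (i, c))) (ipar c + ipar a) *
          koszul (par (j, d) + par (i, c)) (ipar d + ipar b)) * f (mon j d i c)))"
  using assms unfolding rel_entry_def coeff_left[OF assms(2)] coeff_right[OF assms(2)]
  by (simp add: functional_diff[OF f] functional_sum[OF f] functional_scale[OF f] mult.assoc)

text \<open>The row and column sums of S leave three terms on either side; for fixed parities of i,
  j, a, b their accumulated Koszul signs are the ones written in \<open>qcomm\<close>.\<close>

lemma functional_A_entry:
  assumes f: "functional f" and ij: "i \<in> idx k" "j \<in> idx k" and ab: "a \<in> idx n" "b \<in> idx n"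
  shows "f (rel_entry pair_par (idx k) n (Smat k) (Smat n) i a j b) = qcomm (\<lambda>i a j b. f (mon i a j b)) i a j b"
  unfolding functional_rel_entry[OF f finite_idx ij ab] Smat_row_sum[OF ij] Smat_col_sum[OF ab]
  by (cases "ipar a"; cases "ipar b"; cases "ipar i"; cases "ipar j")
    (simp_all add: qcomm_def pair_par_def ipar_uminus_idx[OF ij(1)] ipar_uminus_idx[OF ij(2)]
      ipar_uminus_idx[OF ab(1)] ipar_uminus_idx[OF ab(2)])

text \<open>In positive rows the term with j < -i is absent and phi(i, j) is the Kronecker delta, so
  R_+ acts as S does; for the same reason \<open>x\<close> matters in positive rows only. On the
  columns S_J at (a, b) becomes S at (-a, -b). The common sign (-1)^{|a|+1} is the coefficient of
  J^1 J^2 at E_{-a,a} \<otimes> E_{-b,b} together with the Koszul signs for moving these units past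
  an entry of F.\<close>

lemma functional_Api_entry:
  assumes f: "functional f" and ij: "i \<in> {1..int k}" "j \<in> {1..int k}" and ab: "a \<in> idx n" "b \<in> idx n"
    and x: "\<And>i a j b. 0 < i \<Longrightarrow> 0 < j \<Longrightarrow> x i a j b = f (mon i (- a) j (- b))"
  shows "f (rel_entry pi_par {1..int k} n (Rplus k) (SJ n) i a j b) = ksign (ipar a + 1) * qcomm x i (- a) j (- b)"
proof -
  have pos: "0 < i" "0 < j" and par: "ipar i = 0" "ipar j = 0" using ij by (simp_all add: ipar_def)
  have phi: "phi (- a) (- b) = phi a (- b)" and phi': "phi i j = of_bool (i = j)"
    using pos by (simp_all add: phi_uminus_left phi_pos)
  have nlt: "\<not> j < - i" using pos by simp
  show ?thesis
    unfolding functional_rel_entry[OF f finite_atLeastAtMost_int ij ab] Rplus_row_sum[OF ij] SJ_col_sum[OF ab]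
    using pos par nlt
    by (cases "ipar a"; cases "ipar b")
      (simp_all add: qcomm_def pi_par_def x phi phi' ipar_uminus_idx[OF ab(1)] ipar_uminus_idx[OF ab(2)] algebra_simps)
qed

text \<open>With rows described by their signs, (-,+) follows from (+,+) by
  \<open>qcomm_neg_row\<close>, (+,-) from (-,+) by \<open>qcomm_mixed_row\<close>, and the rows
  with negative first index follow from those with positive first index by
  \<open>qcomm_neg_row\<close> again.\<close>

lemma qcomm_zero:
  assumes s1: "\<And>i a j b. x (- i) a j b = x i (- a) j b"
    and s2: "\<And>i a j b. x i a (- j) b = x i a j (- b)"
    and pos: "\<And>i a j b. i \<in> {1..int k} \<Longrightarrow> j \<in> {1..int k} \<Longrightarrow> a \<in> idx n \<Longrightarrow> b \<in> idx n \<Longrightarrow> qcomm x i a j b = 0"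
    and ij: "i \<in> idx k" "j \<in> idx k" and ab: "a \<in> idx n" "b \<in> idx n"
  shows "qcomm x i a j b = 0"
proof -
  have nz: "c \<noteq> 0" if "c \<in> idx N" for c N using that by (simp add: idx_def)
  have neg: "qcomm x (- i) a j b = 0" if "i \<in> {1..int k}" "j \<in> {1..int k}" "a \<in> idx n" "b \<in> idx n" for i j a b
    using that nz by (subst qcomm_neg_row[where x = x, OF s1 s2]) (auto intro: pos)
  have mixed: "qcomm x i a j b = 0" if "i \<in> {1..int k}" "j \<in> idx k" "a \<in> idx n" "b \<in> idx n" for i j a b
  proof (cases "0 < j")
    case True
    then show ?thesis using that by (intro pos) (auto simp: idx_def)
  next
    case False
    define m where "m = - j"
    have m: "m \<in> {1..int k}" "j = - m" using False that(2) by (auto simp: m_def idx_def)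
    \<comment> \<open>\<open>colop\<close> changes columns only, so both expressions involve just
      entries in rows (-m, i) and (-i, m), which \<open>neg\<close> covers.\<close>
    have "colop (qcomm x) (- m) b i a = 0" "colop (qcomm x) (- i) b m a = 0"
      using that m by (simp_all add: colop_def neg)
    then show ?thesis
      using that m nz by (simp add: qcomm_mixed_row[where x = x, OF s1 s2])
  qed
  show ?thesis
  proof (cases "0 < i")
    case True
    then show ?thesis using ij ab by (intro mixed) (auto simp: idx_def)
  next
    case False
    define m where "m = - i"
    have m: "m \<in> {1..int k}" "i = - m" using False ij(1) by (auto simp: m_def idx_def)
    show ?thesis using m ij ab nz by (simp add: qcomm_neg_row[where x = x, OF s1 s2] mixed)
  qed
qed

section \<open>The isomorphism of superalgebras\<close>

lemma functional_separation:
  assumes "pm.subspace V" "\<And>f. functional f \<Longrightarrow> \<forall>v\<in>V. f v = 0 \<Longrightarrow> f z = 0"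
  shows "z \<in> V"
  using exists_separating_functional[OF assms(1)] assms(2) by metis

lemma homogeneous_presentation_A: "homogeneous_presentation pair_par (A_gens k n) (A_rels k n)"
proof
  have entry: "\<exists>p. homogeneous pair_par p (rel_entry pair_par (idx k) n (Smat k) (Smat n) i a j b)" for i a j b
  proof (rule exI, rule rel_entry_homogeneous[where rp = ipar])
    show "ipar c + ipar d = ipar i + ipar j" if "Poly_Mapping.lookup (Smat k) ((i, c), (j, d)) \<noteq> 0" for i c j d
    proof -
      have "r + s = p + q" if "p + r = q + s" for p q r s :: bit
        using that by (cases p; cases q; cases r; cases s) simp_all
      moreover have "ipar i + ipar c = ipar j + ipar d"
        using keys_Smat[unfolded in_keys_iff, OF that] by (elim conjE)
      ultimately show ?thesis by blast
    qed
    show "ipar c + ipar a = ipar d + ipar b" if "Poly_Mapping.lookup (Smat n) ((c, a), (d, b)) \<noteq> 0" for c a d b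
      using keys_Smat[unfolded in_keys_iff, OF that] by (elim conjE)
  qed (simp_all add: pair_par_def)
  have gens: "homogeneous pair_par (ipar i + ipar a) (gen (i, a) - gen (- i, - a))"
    if "i \<in> idx k" "a \<in> idx n" for i a
  proof (rule homogeneous_diff)
    have "(ipar i + 1) + (ipar a + 1) = ipar i + ipar a" by (cases "ipar i"; cases "ipar a") simp_all
    then show "homogeneous pair_par (ipar i + ipar a) (gen (- i, - a))"
      using that by (simp add: homogeneous_def gen_def pair_par_def ipar_uminus_idx)
  qed (simp add: homogeneous_def gen_def pair_par_def)
  show "\<exists>p. homogeneous pair_par p x" if "x \<in> A_rels k n" for x
  proof -
    consider i a where "x = gen (i, a) - gen (- i, - a)" "i \<in> idx k" "a \<in> idx n"
      | i a j b where "x = rel_entry pair_par (idx k) n (Smat k) (Smat n) i a j b"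
      using \<open>x \<in> A_rels k n\<close> by (auto simp: A_rels_def matrix_rels_iff)
    then show ?thesis using gens entry by cases (auto simp del: bit_not_zero_iff)
  qed
  have "gen (i, a) - gen (- i, - a) \<in> carrier (free_ring pair_par (A_gens k n))"
    if "i \<in> idx k" "a \<in> idx n" for i a
    using that by (intro free_ring_closed) (simp_all add: free_ring_simps gen_def A_gens_def)
  then show "A_rels k n \<subseteq> carrier (free_ring pair_par (A_gens k n))"
    by (auto simp: A_rels_def matrix_rels_iff A_gens_def rel_entry_closed)
qed

lemma homogeneous_presentation_Api: "homogeneous_presentation pi_par (Api_gens k n) (Api_rels k n)"
proof
  have "homogeneous pi_par (1 + 1 + (ipar a + ipar b)) (rel_entry pi_par {1..int k} n (Rplus k) (SJ n) i a j b)" for i a j b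
  proof (rule rel_entry_homogeneous[where rp = "\<lambda>_. 1"])
    fix c a d b assume "Poly_Mapping.lookup (SJ n) ((c, a), (d, b)) \<noteq> 0"
    then have "((c, a), (- d, - b)) \<in> Poly_Mapping.keys (Smat n)"
      by (simp add: lookup_SJ in_keys_iff)
    from keys_Smat[OF this] have *: "d \<in> idx n" "b \<in> idx n" "ipar c + ipar a = ipar (- d) + ipar (- b)"
      by simp_all
    have "(ipar d + 1) + (ipar b + 1) = ipar d + ipar b"
      by (cases "ipar d"; cases "ipar b") simp_all
    then show "ipar c + ipar a = ipar d + ipar b"
      using * by (simp add: ipar_uminus_idx)
  qed (simp_all add: pi_par_def add.commute)
  then show "\<exists>p. homogeneous pi_par p x" if "x \<in> Api_rels k n" for x
    using that unfolding Api_rels_def matrix_rels_iff by (elim exE) (simp, rule exI)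
  show "Api_rels k n \<subseteq> carrier (free_ring pi_par (Api_gens k n))"
    by (auto simp: Api_rels_def matrix_rels_iff Api_gens_def rel_entry_closed)
qed

interpretation A: homogeneous_presentation pair_par "A_gens k n" "A_rels k n" for k n
  by (rule homogeneous_presentation_A)

interpretation Api: homogeneous_presentation pi_par "Api_gens k n" "Api_rels k n" for k n
  by (rule homogeneous_presentation_Api)

text \<open>Every generator \<open>g\<close> is sent to $-$\<open>\<sigma> g\<close>.\<close>

definition gen_subst :: "('g \<Rightarrow> 'h) \<Rightarrow> ('g list \<Rightarrow>\<^sub>0 Cq) \<Rightarrow> ('h list \<Rightarrow>\<^sub>0 Cq)" where
  "gen_subst \<sigma> = lin (\<lambda>w. Poly_Mapping.single (map \<sigma> w) ((- 1) ^ length w))"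

lemma linmap_gen_subst [simp]: "linmap (gen_subst \<sigma>)"
  by (simp add: gen_subst_def)

lemma gen_subst_single: "gen_subst \<sigma> (Poly_Mapping.single w c) = Poly_Mapping.single (map \<sigma> w) ((- 1) ^ length w * c)"
  by (simp add: gen_subst_def scale_single mult.commute)

text \<open>Concatenation of words involves no sign, so the parities on the two sides may be
  unrelated; they are compared separately in \<open>gen_subst_homogeneous\<close>.\<close>

lemma gen_subst_mult:
  "gen_subst \<sigma> (sprod (free_sa par) x y) = sprod (free_sa par') (gen_subst \<sigma> x) (gen_subst \<sigma> y)"
proof -
  let ?s = "\<lambda>v. Poly_Mapping.single v (1 :: Cq)"
  have 1: "(\<lambda>y. gen_subst \<sigma> (sprod (free_sa par) (?s v) y))
      = (\<lambda>y. sprod (free_sa par') (gen_subst \<sigma> (?s v)) (gen_subst \<sigma> y))" for v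
    by (rule linmap_ext) (auto intro!: linmap_compose[OF linmap_gen_subst] linmap_sprod_right' linmap_id
        simp: gen_subst_single power_add scale_single)
  have "(\<lambda>x. gen_subst \<sigma> (sprod (free_sa par) x y))
      = (\<lambda>x. sprod (free_sa par') (gen_subst \<sigma> x) (gen_subst \<sigma> y))"
    by (rule linmap_ext) (auto intro!: linmap_compose[OF linmap_gen_subst] linmap_sprod_left' linmap_id
        simp: fun_cong[OF 1])
  then show ?thesis by (rule fun_cong)
qed

lemma gen_subst_one: "gen_subst \<sigma> free_one = free_one"
  by (simp add: free_one_def gen_subst_single)

lemma keys_gen_subst: "Poly_Mapping.keys (gen_subst \<sigma> x) \<subseteq> map \<sigma> ` Poly_Mapping.keys x"
  unfolding gen_subst_def using keys_lin[of "\<lambda>w. Poly_Mapping.single (map \<sigma> w) ((- 1) ^ length w)" x] by auto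

lemma gen_subst_closed:
  assumes "\<And>g. g \<in> G \<Longrightarrow> \<sigma> g \<in> G'" "x \<in> carrier (free_ring par G)"
  shows "gen_subst \<sigma> x \<in> carrier (free_ring par' G')"
proof -
  have "map \<sigma> w \<in> lists G'" if "w \<in> lists G" for w
    using that assms(1) by auto
  then have "map \<sigma> ` Poly_Mapping.keys x \<subseteq> lists G'"
    using assms(2) unfolding free_ring_simps by blast
  with keys_gen_subst show ?thesis unfolding free_ring_simps mem_Collect_eq by (rule subset_trans)
qed

lemma gen_subst_homogeneous:
  assumes "\<And>g. g \<in> G \<Longrightarrow> par' (\<sigma> g) = par g" "x \<in> carrier (free_ring par G)" "homogeneous par p x"
  shows "homogeneous par' p (gen_subst \<sigma> x)"
proof -
  have "word_par par' (map \<sigma> w) = word_par par w" if "w \<in> lists G" for w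
    using that by induction (simp_all add: assms(1))
  then show ?thesis
    using keys_gen_subst[of \<sigma> x] assms(2,3) unfolding free_ring_simps homogeneous_def by fastforce
qed

text \<open>Both substitutions contribute (-1)^{length w}, so their composite is an unsigned
  relabelling of letters.\<close>

lemma gen_subst_gen_subst: "gen_subst \<sigma> (gen_subst \<rho> x) = lin (\<lambda>w. Poly_Mapping.single (map (\<sigma> \<circ> \<rho>) w) 1) x"
proof -
  have "(\<lambda>x. gen_subst \<sigma> (gen_subst \<rho> x)) = lin (\<lambda>w. Poly_Mapping.single (map (\<sigma> \<circ> \<rho>) w) 1)"
    by (rule linmap_ext)
      (auto intro!: linmap_compose[OF linmap_gen_subst] linmap_id simp: gen_subst_single power_mult_distrib[symmetric])
  then show ?thesis by (rule fun_cong)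
qed

section \<open>The index maps of tau and of its inverse\<close>

definition tau_ix :: "int \<times> int \<Rightarrow> int \<times> int" where
  "tau_ix = (\<lambda>(i, a). (i, - a))"

text \<open>At \<open>i = 0\<close> the value is \<open>(0, 0)\<close>, so \<open>tau_inv_ix (- i, a) = tau_inv_ix (i, - a)\<close> holds for all integers.\<close>

definition tau_inv_ix :: "int \<times> int \<Rightarrow> int \<times> int" where
  "tau_inv_ix = (\<lambda>(i, a). (\<bar>i\<bar>, - sgn i * a))"

lemma range_in_idx: "i \<in> {1..int k} \<Longrightarrow> i \<in> idx k"
  by (auto simp: idx_def)

lemma tau_ix_closed: "g \<in> Api_gens k n \<Longrightarrow> tau_ix g \<in> A_gens k n"
  by (auto simp: tau_ix_def Api_gens_def A_gens_def idx_def)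

lemma tau_inv_ix_closed: "g \<in> A_gens k n \<Longrightarrow> tau_inv_ix g \<in> Api_gens k n"
  by (auto simp: tau_inv_ix_def Api_gens_def A_gens_def idx_def sgn_if split: if_splits)

text \<open>For i > 0 the parity of t_{i,-a} is |-a| = |a| + 1: the index change made by J accounts
  for the parity shift of the generators.\<close>

lemma tau_ix_par: "g \<in> Api_gens k n \<Longrightarrow> pair_par (tau_ix g) = pi_par g"
  by (auto simp: tau_ix_def Api_gens_def pair_par_def pi_par_def ipar_uminus_idx ipar_pos)

lemma A_entry_in_I: "rel_entry pair_par (idx k) n (Smat k) (Smat n) i a j b \<in> A.I k n"
proof -
  have "rel_entry pair_par (idx k) n (Smat k) (Smat n) i a j b \<in> A_rels k n"
    unfolding A_rels_def Un_iff matrix_rels_iff by (intro disjI2 exI) (rule refl)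
  with A.rels_in_I show ?thesis by (rule subsetD)
qed

lemma Api_entry_in_I: "rel_entry pi_par {1..int k} n (Rplus k) (SJ n) i a j b \<in> Api.I k n"
proof -
  have "rel_entry pi_par {1..int k} n (Rplus k) (SJ n) i a j b \<in> Api_rels k n"
    unfolding Api_rels_def matrix_rels_iff by (intro exI) (rule refl)
  with Api.rels_in_I show ?thesis by (rule subsetD)
qed

lemma Api_entry_outside:
  assumes "\<not> (i \<in> {1..int k} \<and> j \<in> {1..int k} \<and> a \<in> idx n \<and> b \<in> idx n)"
  shows "rel_entry pi_par {1..int k} n (Rplus k) (SJ n) i a j b = 0"
proof (rule rel_entry_outside[OF _ _ _ assms])
  show "i \<in> {1..int k} \<and> j \<in> {1..int k}" if "Poly_Mapping.lookup (Rplus k) ((i, c), (j, d)) \<noteq> 0" for i c j d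
    using that by (cases "i \<in> {1..int k}"; cases "j \<in> {1..int k}") (simp_all add: lookup_Rplus del: atLeastAtMost_iff)
  show "a \<in> idx n \<and> b \<in> idx n" if "Poly_Mapping.lookup (SJ n) ((c, a), (d, b)) \<noteq> 0" for c a d b
  proof -
    have "Poly_Mapping.lookup (Smat n) ((c, a), (- d, - b)) \<noteq> 0" using that by (simp add: lookup_SJ)
    from keys_Smat[unfolded in_keys_iff, OF this] show ?thesis by simp
  qed
qed simp

lemma A_entry_outside:
  assumes "\<not> (i \<in> idx k \<and> j \<in> idx k \<and> a \<in> idx n \<and> b \<in> idx n)"
  shows "rel_entry pair_par (idx k) n (Smat k) (Smat n) i a j b = 0"
proof (rule rel_entry_outside[OF _ _ _ assms])
  show "i \<in> idx k \<and> j \<in> idx k" if "Poly_Mapping.lookup (Smat k) ((i, c), (j, d)) \<noteq> 0" for i c j d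
    using keys_Smat[unfolded in_keys_iff, OF that] by simp
  show "a \<in> idx n \<and> b \<in> idx n" if "Poly_Mapping.lookup (Smat n) ((c, a), (d, b)) \<noteq> 0" for c a d b
    using keys_Smat[unfolded in_keys_iff, OF that] by simp
qed simp

text \<open>For a functional vanishing on the ideal of A, the image of the entry in columns a, b is,
  up to sign, the value of F in columns -a, -b and the same rows, which is itself a relation of A.
  The signs of the two letters of a quadratic monomial cancel.\<close>

lemma tau_rels:
  assumes "x \<in> Api_rels k n"
  shows "gen_subst tau_ix x \<in> A.I k n"
proof (rule functional_separation[OF A.subspace_I])
  fix f assume f: "functional f" and f0: "\<forall>v\<in>A.I k n. f v = 0"
  obtain i a j b where x: "x = rel_entry pi_par {1..int k} n (Rplus k) (SJ n) i a j b"
    using assms unfolding Api_rels_def matrix_rels_iff by (elim exE)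
  show "f (gen_subst tau_ix x) = 0"
  proof (cases "i \<in> {1..int k} \<and> j \<in> {1..int k} \<and> a \<in> idx n \<and> b \<in> idx n")
    case True
    then have ij: "i \<in> {1..int k}" "j \<in> {1..int k}" and ab: "a \<in> idx n" "b \<in> idx n" by blast+
    have ab': "- a \<in> idx n" "- b \<in> idx n" using ab by simp_all
    define x' where "x' i a j b = f (mon i a j b)" for i a j b
    have g: "functional (\<lambda>x. f (gen_subst tau_ix x))"
      using f linmap_gen_subst by (rule functional_comp)
    have "f (gen_subst tau_ix x) = ksign (ipar a + 1) * qcomm x' i (- a) j (- b)"
      unfolding x by (rule functional_Api_entry[OF g ij ab]) (simp add: x'_def gen_subst_single tau_ix_def)
    moreover have "f (rel_entry pair_par (idx k) n (Smat k) (Smat n) i (- a) j (- b)) = qcomm x' i (- a) j (- b)"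
      unfolding x'_def by (rule functional_A_entry[OF f range_in_idx[OF ij(1)] range_in_idx[OF ij(2)] ab'])
    moreover have "f (rel_entry pair_par (idx k) n (Smat k) (Smat n) i (- a) j (- b)) = 0"
      using f0 A_entry_in_I by (rule bspec)
    ultimately show ?thesis by simp
  next
    case False
    show ?thesis
      by (simp only: x Api_entry_outside[OF False] linmap_zero[OF linmap_gen_subst] functional_zero[OF f])
  qed
qed

text \<open>This is where \<open>qcomm_zero\<close> enters: F has entries in all rows of I_{k|k},
  whereas the target only has relations for positive rows. There F in columns a, b corresponds, up
  to sign, to the relation of the target in columns -a, -b.\<close>

lemma tau_inv_rels:
  assumes "x \<in> A_rels k n"
  shows "gen_subst tau_inv_ix x \<in> Api.I k n"
proof -
  consider i a where "x = gen (i, a) - gen (- i, - a)"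
    | i a j b where "x = rel_entry pair_par (idx k) n (Smat k) (Smat n) i a j b"
    using assms by (auto simp: A_rels_def matrix_rels_iff)
  then show ?thesis
  proof cases
    case 1
    \<comment> \<open>The linear relations vanish already in the free superalgebra, since
      \<open>tau_inv_ix\<close> has the same value at (i, a) and (-i, -a).\<close>
    then have "gen_subst tau_inv_ix x = 0"
      by (simp add: linmap_diff[OF linmap_gen_subst] gen_def gen_subst_single tau_inv_ix_def)
    then show ?thesis by (simp add: Api.I_zero)
  next
    case 2
    show ?thesis
    proof (cases "i \<in> idx k \<and> j \<in> idx k \<and> a \<in> idx n \<and> b \<in> idx n")
      case True
      then have ij: "i \<in> idx k" "j \<in> idx k" and ab: "a \<in> idx n" "b \<in> idx n" by blast+
      show ?thesis
      proof (rule functional_separation[OF Api.subspace_I])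
        fix f assume f: "functional f" and f0: "\<forall>v\<in>Api.I k n. f v = 0"
        define x' where "x' i a j b = f (gen_subst tau_inv_ix (mon i a j b))" for i a j b
        have g: "functional (\<lambda>x. f (gen_subst tau_inv_ix x))"
          using f linmap_gen_subst by (rule functional_comp)
        have "f (gen_subst tau_inv_ix x) = qcomm x' i a j b"
          unfolding 2 x'_def by (rule functional_A_entry[OF g ij ab])
        also have "qcomm x' i a j b = 0"
        proof (rule qcomm_zero[where x = x', OF _ _ _ ij ab])
          show "x' (- i) a j b = x' i (- a) j b" for i a j b
            by (simp add: x'_def gen_subst_single tau_inv_ix_def)
          show "x' i a (- j) b = x' i a j (- b)" for i a j b
            by (simp add: x'_def gen_subst_single tau_inv_ix_def)
          fix i a j b
          assume ij: "i \<in> {1..int k}" "j \<in> {1..int k}" and ab: "a \<in> idx n" "b \<in> idx n"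
          then have ab': "- a \<in> idx n" "- b \<in> idx n" by simp_all
          have "f (rel_entry pi_par {1..int k} n (Rplus k) (SJ n) i (- a) j (- b)) =
              ksign (ipar (- a) + 1) * qcomm x' i (- (- a)) j (- (- b))"
            by (rule functional_Api_entry[OF f ij ab']) (simp add: x'_def gen_subst_single tau_inv_ix_def)
          moreover have "f (rel_entry pi_par {1..int k} n (Rplus k) (SJ n) i (- a) j (- b)) = 0"
            using f0 Api_entry_in_I by (rule bspec)
          ultimately show "qcomm x' i a j b = 0"
            by (cases "ipar (- a)") simp_all
        qed
        finally show "f (gen_subst tau_inv_ix x) = 0" .
      qed
    next
      case False
      show ?thesis
        by (simp only: 2 A_entry_outside[OF False] linmap_zero[OF linmap_gen_subst] Api.I_zero)
    qed
  qed
qed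

lemma tau_inv_tau:
  assumes "x \<in> carrier (free_ring pi_par (Api_gens k n))"
  shows "gen_subst tau_inv_ix (gen_subst tau_ix x) = x"
proof -
  have "tau_inv_ix (tau_ix g) = g" if "g \<in> Api_gens k n" for g
    using that by (auto simp: tau_inv_ix_def tau_ix_def Api_gens_def)
  then have "map (tau_inv_ix \<circ> tau_ix) w = w" if "w \<in> Poly_Mapping.keys x" for w
    using that assms by (intro map_idI) (auto simp: free_ring_simps)
  then have "gen_subst tau_inv_ix (gen_subst tau_ix x) =
      (\<Sum>w\<in>Poly_Mapping.keys x. scale (Poly_Mapping.lookup x w) (Poly_Mapping.single w 1))"
    unfolding gen_subst_gen_subst lin_def by (intro sum.cong refl) simp
  then show ?thesis by (simp add: poly_mapping_sum_single)
qed

text \<open>The composite fixes the letter (i, a) if i > 0 and replaces it by (-i, -a) if i < 0. The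
  difference of the two generators is a relation of A, so every word is congruent to its
  image.\<close>

lemma tau_tau_inv:
  assumes "x \<in> carrier (free_ring pair_par (A_gens k n))"
  shows "x - gen_subst tau_ix (gen_subst tau_inv_ix x) \<in> A.I k n"
proof -
  define r where "r = tau_ix \<circ> tau_inv_ix"
  have r_closed: "r g \<in> A_gens k n" if "g \<in> A_gens k n" for g
    using that by (simp add: r_def tau_ix_closed tau_inv_ix_closed)
  have r: "gen g - gen (r g) \<in> A.I k n" if "g \<in> A_gens k n" for g
  proof -
    obtain i a where g: "g = (i, a)" "i \<in> idx k" "a \<in> idx n"
      using \<open>g \<in> A_gens k n\<close> by (auto simp: A_gens_def)
    show ?thesis
    proof (cases "0 < i")
      case True
      then show ?thesis using g by (simp add: r_def tau_ix_def tau_inv_ix_def A.I_zero)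
    next
      case False
      then have "r g = (- i, - a)" using g by (auto simp: r_def tau_ix_def tau_inv_ix_def idx_def sgn_if)
      then have "gen g - gen (r g) \<in> A_rels k n" using g by (auto simp: A_rels_def)
      then show ?thesis using A.rels_in_I by blast
    qed
  qed
  have word: "Poly_Mapping.single w 1 - Poly_Mapping.single (map r w) 1 \<in> A.I k n" if "w \<in> lists (A_gens k n)" for w
    using that
  proof induction
    case (Cons g w)
    \<comment> \<open>The telescoping identity g w - g' w' = g (w - w') + (g - g') w', with primes
      for images under \<open>r\<close>.\<close>
    have "Poly_Mapping.single (g # w) 1 - Poly_Mapping.single (map r (g # w)) 1 =
      sprod (free_sa pair_par) (gen g) (Poly_Mapping.single w 1 - Poly_Mapping.single (map r w) 1)
      + sprod (free_sa pair_par) (gen g - gen (r g)) (Poly_Mapping.single (map r w) 1)"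
      by (simp add: sprod_simps gen_def)
    also have "\<dots> \<in> A.I k n"
      using Cons r_closed r
      by (intro A.I_add A.I_mult_left A.I_mult_right) (auto simp: free_ring_simps gen_def)
    finally show ?case .
  qed (simp add: A.I_zero)
  have "x - gen_subst tau_ix (gen_subst tau_inv_ix x) =
    (\<Sum>w\<in>Poly_Mapping.keys x. scale (Poly_Mapping.lookup x w) (Poly_Mapping.single w 1))
    - (\<Sum>w\<in>Poly_Mapping.keys x. scale (Poly_Mapping.lookup x w) (Poly_Mapping.single (map r w) 1))"
    unfolding poly_mapping_sum_single gen_subst_gen_subst lin_def r_def ..
  also have "\<dots> = (\<Sum>w\<in>Poly_Mapping.keys x. scale (Poly_Mapping.lookup x w)
      (Poly_Mapping.single w 1 - Poly_Mapping.single (map r w) 1))"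
    by (simp add: sum_subtractf pm.scale_right_diff_distrib)
  also have "\<dots> \<in> A.I k n"
    using assms by (intro pm.subspace_sum[OF A.subspace_I] A.I_scale word) (auto simp: free_ring_simps)
  finally show ?thesis .
qed

text \<open>The map for the opposite direction, \<open>gen_subst tau_inv_ix\<close>, is a left
  inverse on the nose and a right inverse modulo the ideal of A; the former yields the kernel
  condition, the latter surjectivity.\<close>

lemma tau_exists:
  "\<exists>\<tau>. superalgebra_iso (Api_alg k n) (A_alg k n) \<tau> \<and>
    (\<forall>x\<in>carrier (free_ring pi_par (Api_gens k n)). \<tau> (Api_class k n x) = A_class k n (gen_subst tau_ix x))"
  unfolding Api_alg_def A_alg_def Api_class_def A_class_def
proof (rule presented_superalgebra_iso[OF homogeneous_presentation_Api homogeneous_presentation_A,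
      where h = "gen_subst tau_ix"])
  show "linmap (gen_subst tau_ix)" by simp
  show "gen_subst tau_ix (sprod (free_sa pi_par) x y)
      = sprod (free_sa pair_par) (gen_subst tau_ix x) (gen_subst tau_ix y)" for x y
    by (rule gen_subst_mult)
  show "gen_subst tau_ix free_one = free_one" by (rule gen_subst_one)
next
  fix x assume x: "x \<in> carrier (free_ring pi_par (Api_gens k n))"
  show "gen_subst tau_ix x \<in> carrier (free_ring pair_par (A_gens k n))"
    using tau_ix_closed x by (rule gen_subst_closed)
  show "homogeneous pair_par p (gen_subst tau_ix x)" if "homogeneous pi_par p x" for p
    using tau_ix_par x that by (rule gen_subst_homogeneous)
  assume "gen_subst tau_ix x \<in> A.I k n"
  \<comment> \<open>The opposite substitution maps the ideal of A into that of the source, and it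
    maps the image of \<open>x\<close> back to \<open>x\<close>.\<close>
  with homogeneous_presentation_A homogeneous_presentation_Api linmap_gen_subst
    gen_subst_mult gen_subst_closed[OF tau_inv_ix_closed] tau_inv_rels
  have "gen_subst tau_inv_ix (gen_subst tau_ix x) \<in> Api.I k n"
    by (rule presented_hom_ideal)
  then show "x \<in> Api.I k n" by (simp only: tau_inv_tau[OF x])
next
  fix y assume y: "y \<in> carrier (free_ring pair_par (A_gens k n))"
  have "gen_subst tau_inv_ix y \<in> carrier (free_ring pi_par (Api_gens k n))"
    using tau_inv_ix_closed y by (rule gen_subst_closed)
  with tau_tau_inv[OF y] show "\<exists>x\<in>carrier (free_ring pi_par (Api_gens k n)). y - gen_subst tau_ix x \<in> A.I k n"
    by (rule bexI)
qed (rule tau_rels)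

section \<open>Compatibility with the actions\<close>

lemma bpar_free_sa [simp]: "bpar (free_sa par) = word_par par"
  by (simp add: free_sa_def)

section \<open>The generator matrix under tau\<close>

lemma bmul_mf: "bmul (mat_sa \<otimes>\<^sub>s free_sa par) ((i, c), v) ((c', a), w) =
  (if c = c' then Poly_Mapping.single ((i, a), v @ w) (koszul (word_par par v) (ipar c + ipar a)) else 0)"
  by (cases "ipar a"; cases "ipar c'"; cases "word_par par v")
    (auto simp: tens_sa_def mat_sa_def pair_par_def tens_simps single_uminus)

lemma sum_delta_uminus:
  assumes "c \<in> idx N"
  shows "(\<Sum>e\<in>idx N. if c = - e then T e else 0) = (T (- c) :: 'a :: comm_monoid_add)"
proof -
  have "(\<Sum>e\<in>idx N. if c = - e then T e else 0) = (\<Sum>e\<in>idx N. if e = - c then T e else 0)"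
    by (intro sum.cong refl) auto
  then show ?thesis using assms by simp
qed

text \<open>This is the origin of the minus sign in tau. Moving the odd J past t_ia with i > 0 gives
  (-1)^{|a|}, and J has the coefficient (-1)^{|a|+1} at E_{a,-a}; the product is -1 for every
  a.\<close>

lemma T_plus_J:
  "T_plus k n \<star>\<^bsub>mat_sa \<otimes>\<^sub>s free_sa pair_par\<^esub> (Jmat n \<otimes>\<^sub>t free_one) =
    (\<Sum>i\<in>{1..int k}. \<Sum>a\<in>idx n. Poly_Mapping.single ((i, - a), [(i, a)]) (- 1))"
proof -
  have J: "Jmat n \<otimes>\<^sub>t free_one = (\<Sum>e\<in>idx n. Poly_Mapping.single ((- e, e), []) (ksign (ipar e)))"
    by (simp add: Jmat_def E_def free_one_def tens_simps scale_single)
  have "Poly_Mapping.single ((i, a), [(i, a)]) 1 \<star>\<^bsub>mat_sa \<otimes>\<^sub>s free_sa pair_par\<^esub> (Jmat n \<otimes>\<^sub>t free_one) =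
      Poly_Mapping.single ((i, - a), [(i, a)]) (- 1)" if "i \<in> {1..int k}" "a \<in> idx n" for i a
  proof -
    have "Poly_Mapping.single ((i, a), [(i, a)]) 1 \<star>\<^bsub>mat_sa \<otimes>\<^sub>s free_sa pair_par\<^esub> (Jmat n \<otimes>\<^sub>t free_one) =
      (\<Sum>e\<in>idx n. if a = - e then Poly_Mapping.single ((i, e), [(i, a)])
        (ksign (ipar e) * koszul (pair_par (i, a)) (ipar a + ipar e)) else 0)"
      unfolding J sprod_simps by (intro sum.cong refl) (simp add: bmul_mf scale_single)
    also have "\<dots> = Poly_Mapping.single ((i, - a), [(i, a)])
        (ksign (ipar (- a)) * koszul (pair_par (i, a)) (ipar a + ipar (- a)))"
      using that(2) by (rule sum_delta_uminus)
    also have "ksign (ipar (- a)) * koszul (pair_par (i, a)) (ipar a + ipar (- a)) = - 1"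
      using that by (cases "ipar a") (simp_all add: pair_par_def ipar_pos ipar_uminus_idx)
    finally show ?thesis .
  qed
  then show ?thesis
    by (simp add: T_plus_def gmat_def E_def gen_def sprod_simps)
qed

lemma entry_sum:
  "entry p (\<Sum>i\<in>I. \<Sum>a\<in>Y. f i a) = (\<Sum>i\<in>I. \<Sum>a\<in>Y. entry p (f i a))"
  by (simp add: linmap_sum[OF linmap_entry])

lemma entry_T_plus_J:
  "entry p (T_plus k n \<star>\<^bsub>mat_sa \<otimes>\<^sub>s free_sa pair_par\<^esub> (Jmat n \<otimes>\<^sub>t free_one)) =
    gen_subst tau_ix (entry p (Tcheck_plus k n))"
proof -
  have "entry p (T_plus k n \<star>\<^bsub>mat_sa \<otimes>\<^sub>s free_sa pair_par\<^esub> (Jmat n \<otimes>\<^sub>t free_one)) =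
    (\<Sum>i\<in>{1..int k}. \<Sum>a\<in>idx n. if (i, - a) = p then Poly_Mapping.single [(i, a)] (- 1) else 0)"
    unfolding T_plus_J entry_sum entry_single ..
  also have "\<dots> = (\<Sum>i\<in>{1..int k}. \<Sum>a\<in>idx n. if (i, a) = p then Poly_Mapping.single [(i, - a)] (- 1) else 0)"
    by (intro sum.cong refl sum.reindex_bij_witness[of _ uminus uminus]) auto
  also have "\<dots> = gen_subst tau_ix (entry p (Tcheck_plus k n))"
    unfolding Tcheck_plus_def gmat_def E_def gen_def tens_single entry_sum entry_single
      linmap_sum[OF linmap_gen_subst]
    by (intro sum.cong refl) (auto simp: gen_subst_single tau_ix_def linmap_zero[OF linmap_gen_subst])
  finally show ?thesis .
qed

lemma entry_Tcheck_closed: "entry p (Tcheck_plus k n) \<in> carrier (free_ring par (Api_gens k n))"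
proof -
  have "entry p (Tcheck_plus k n) = (\<Sum>i\<in>{1..int k}. \<Sum>a\<in>idx n. if (i, a) = p then gen (i, a) else 0)"
    unfolding Tcheck_plus_def gmat_def E_def gen_def tens_single entry_sum entry_single
    by (simp only: mult_1_left)
  then show ?thesis
    unfolding free_ring_simps mem_Collect_eq
    by (simp only:) (intro keys_sum_subset, auto simp: gen_def Api_gens_def)
qed

text \<open>The coordinate form of the fact that S commutes with J \<otimes> 1: the substitution
  exchanges the two off-diagonal terms of S.\<close>

lemma lookup_Smat_uminus:
  "Poly_Mapping.lookup (Smat N) ((- i, - c), (j, d)) = Poly_Mapping.lookup (Smat N) ((i, c), (j, d))"
proof -
  have 1: "(if - i = - c \<and> j = d \<and> - i \<in> idx N \<and> j \<in> idx N then qvar powi phi (- i) j else 0) =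
      (if i = c \<and> j = d \<and> i \<in> idx N \<and> j \<in> idx N then qvar powi phi i j else 0)"
    by (auto simp: phi_uminus_left)
  have 2: "(if - c = j \<and> d = - i \<and> j < - i \<and> - i \<in> idx N \<and> j \<in> idx N then ksign (ipar j) else 0) =
      (if c = - j \<and> d = - i \<and> j < - i \<and> i \<in> idx N \<and> j \<in> idx N then ksign (ipar j) else 0)"
    by (auto)
  have 3: "(if - c = - j \<and> d = - (- i) \<and> j < - (- i) \<and> - i \<in> idx N \<and> j \<in> idx N then ksign (ipar j) else 0) =
      (if c = j \<and> d = i \<and> j < i \<and> i \<in> idx N \<and> j \<in> idx N then ksign (ipar j) else 0)"
    by simp
  show ?thesis unfolding lookup_Smat 1 2 3 by (simp only: add.commute)
qed

lemma bmul_mfm: "bmul (mat_sa \<otimes>\<^sub>s free_sa par \<otimes>\<^sub>s mat_sa) ((i, c), v, (p, q)) ((c', d), w, (a, b)) =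
  (if c = c' \<and> q = a then Poly_Mapping.single ((i, d), v @ w, (p, b))
     (koszul (word_par par v + (ipar p + ipar q)) (ipar c + ipar d) * koszul (ipar p + ipar q) (word_par par w))
   else 0)"
  by (cases "ipar c'"; cases "ipar d"; cases "ipar p"; cases "ipar q"; cases "word_par par v"; cases "word_par par w")
    (auto simp: tens_sa_def mat_sa_def pair_par_def tens_simps
      linmap_neg[OF linmap_tens_right] single_uminus)

text \<open>As in \<open>coeff_left\<close>, linearity reduces S to one basis vector. The only sign
  left comes from moving E_ec past t_ie, because the third tensor factor of the left matrix is an
  even unit E_zz.\<close>

lemma gmat12_S_coeff:
  assumes "finite rows" "i \<in> rows" "a \<in> idx n" "b \<in> idx n"
  shows "coeff2 (i, c) (a, b) (gmat12 rows n \<star>\<^bsub>mat_sa \<otimes>\<^sub>s free_sa par \<otimes>\<^sub>s mat_sa\<^esub> put13 (Smat n)) =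
    (\<Sum>e\<in>idx n. scale (Poly_Mapping.lookup (Smat n) ((e, c), (a, b)) * koszul (par (i, e)) (ipar e + ipar c))
       (gen (i, e)))"
proof -
  have gm: "gmat12 rows n = (\<Sum>l\<in>rows. \<Sum>e\<in>idx n. \<Sum>z\<in>idx n. Poly_Mapping.single ((l, e), [(l, e)], (z, z)) 1)"
    unfolding gmat12_def E_def gen_def idm_def by (simp add: tens_simps)
  have one: "coeff2 (i, c) (a, b) (Poly_Mapping.single ((l, e), [(l, e)], (z, z)) 1
        \<star>\<^bsub>mat_sa \<otimes>\<^sub>s free_sa par \<otimes>\<^sub>s mat_sa\<^esub> put13 B) =
      (if i = l \<and> a = z then scale (Poly_Mapping.lookup B ((e, c), (a, b)) * koszul (par (l, e)) (ipar e + ipar c))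
       (gen (l, e)) else 0)" for l e z B
  proof -
    have "(\<lambda>B. coeff2 (i, c) (a, b) (Poly_Mapping.single ((l, e), [(l, e)], (z, z)) 1
        \<star>\<^bsub>mat_sa \<otimes>\<^sub>s free_sa par \<otimes>\<^sub>s mat_sa\<^esub> put13 B)) = (\<lambda>B.
      (if i = l \<and> a = z then scale (Poly_Mapping.lookup B ((e, c), (a, b)) * koszul (par (l, e)) (ipar e + ipar c))
       (gen (l, e)) else 0))" (is "?l = ?r")
    proof (rule linmap_ext)
      show "linmap ?l" unfolding put13_lin by (rule linmap_compose[OF linmap_coeff2]) (intro linmap_intros)
      show "linmap ?r" by (intro linmap_if linmap_lookup_scale)
      fix w :: "(int \<times> int) \<times> (int \<times> int)"
      obtain e' c' a' b' where w: "w = ((e', c'), (a', b'))" by (metis prod.exhaust)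
      show "?l (Poly_Mapping.single w 1) = ?r (Poly_Mapping.single w 1)"
        unfolding w put13_lin
        by (auto simp: bmul_mfm coeff2_single scale_single lookup_single when_def gen_def
          linmap_scale[OF linmap_coeff2] linmap_zero[OF linmap_coeff2])
    qed
    then show ?thesis by (rule fun_cong)
  qed
  have "coeff2 (i, c) (a, b) (gmat12 rows n \<star>\<^bsub>mat_sa \<otimes>\<^sub>s free_sa par \<otimes>\<^sub>s mat_sa\<^esub> put13 (Smat n)) =
    (\<Sum>l\<in>rows. \<Sum>e\<in>idx n. \<Sum>z\<in>idx n. if i = l \<and> a = z then
      scale (Poly_Mapping.lookup (Smat n) ((e, c), (a, b)) * koszul (par (l, e)) (ipar e + ipar c))
       (gen (l, e)) else 0)"
    unfolding gm sprod_simps linmap_sum[OF linmap_coeff2] one ..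
  then show ?thesis
    using assms by (simp only: sum_delta3[OF assms(1) finite_idx]) simp
qed

text \<open>Both sides describe the action of a generator on \<open>t_{i,-c}\<close>; they agree because
  $S$ commutes with $J \otimes 1$.\<close>

lemma tau_gmat12_S_coeff:
  assumes "i \<in> {1..int k}" "c \<in> idx n" "a \<in> idx n" "b \<in> idx n"
  shows "gen_subst tau_ix (coeff2 (i, c) (a, b)
      (gmat12 {1..int k} n \<star>\<^bsub>mat_sa \<otimes>\<^sub>s free_sa pi_par \<otimes>\<^sub>s mat_sa\<^esub> put13 (Smat n))) =
    - coeff2 (i, - c) (a, b) (gmat12 (idx k) n \<star>\<^bsub>mat_sa \<otimes>\<^sub>s free_sa pair_par \<otimes>\<^sub>s mat_sa\<^esub> put13 (Smat n))"
proof -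
  have i: "i \<in> idx k" "ipar i = 0" using assms(1) by (simp_all add: range_in_idx ipar_pos)
  have kos: "koszul (pi_par (i, e)) (ipar e + ipar c) = koszul (pair_par (i, - e)) (ipar (- e) + ipar (- c))"
    if "e \<in> idx n" for e
    using that assms(2) i
    by (cases "ipar e"; cases "ipar c") (simp_all add: pi_par_def pair_par_def ipar_uminus_idx)
  have "gen_subst tau_ix (coeff2 (i, c) (a, b)
      (gmat12 {1..int k} n \<star>\<^bsub>mat_sa \<otimes>\<^sub>s free_sa pi_par \<otimes>\<^sub>s mat_sa\<^esub> put13 (Smat n))) =
    - (\<Sum>e\<in>idx n. scale (Poly_Mapping.lookup (Smat n) ((e, c), (a, b)) * koszul (pi_par (i, e)) (ipar e + ipar c))
       (gen (i, - e)))"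
    unfolding gmat12_S_coeff[OF finite_atLeastAtMost_int assms(1,3,4)]
    by (simp add: linmap_sum[OF linmap_gen_subst] linmap_scale[OF linmap_gen_subst] gen_def gen_subst_single
        tau_ix_def scale_single single_uminus sum_negf)
  also have "(\<Sum>e\<in>idx n. scale (Poly_Mapping.lookup (Smat n) ((e, c), (a, b)) * koszul (pi_par (i, e)) (ipar e + ipar c))
       (gen (i, - e))) =
    (\<Sum>e\<in>idx n. scale (Poly_Mapping.lookup (Smat n) ((e, - c), (a, b)) * koszul (pair_par (i, e)) (ipar e + ipar (- c)))
       (gen (i, e)))"
  proof (rule sum.reindex_bij_witness[of _ uminus uminus])
    fix e assume e: "e \<in> idx n"
    show "scale (Poly_Mapping.lookup (Smat n) ((- e, - c), (a, b)) * koszul (pair_par (i, - e)) (ipar (- e) + ipar (- c)))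
       (gen (i, - e)) =
      scale (Poly_Mapping.lookup (Smat n) ((e, c), (a, b)) * koszul (pi_par (i, e)) (ipar e + ipar c)) (gen (i, - e))"
      by (simp only: kos[OF e] lookup_Smat_uminus)
  qed auto
  finally show ?thesis
    unfolding gmat12_S_coeff[OF finite_idx i(1) assms(3,4)] .
qed

lemma (in presentation) smult_closed: "x \<in> carrier P \<Longrightarrow> c \<odot>\<^bsub>P\<^esub> x \<in> carrier P"
  by (auto simp: carrier_P cls_smult free_ring_closed)

lemma (in presentation) smult_smult: "x \<in> carrier P \<Longrightarrow> c \<odot>\<^bsub>P\<^esub> (d \<odot>\<^bsub>P\<^esub> x) = (c * d) \<odot>\<^bsub>P\<^esub> x"
  by (auto simp: carrier_P cls_smult free_ring_closed)

lemma (in presentation) smult_ksign_cancel: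
  assumes "x \<in> carrier P" "y \<in> carrier P" "ksign s \<odot>\<^bsub>P\<^esub> x = ksign s \<odot>\<^bsub>P\<^esub> y"
  shows "x = y"
proof -
  have one: "1 \<odot>\<^bsub>P\<^esub> z = z" if "z \<in> carrier P" for z
    using that by (auto simp: carrier_P cls_smult)
  have sq: "ksign s * ksign s = 1" by (cases s) simp_all
  have "ksign s \<odot>\<^bsub>P\<^esub> (ksign s \<odot>\<^bsub>P\<^esub> x) = ksign s \<odot>\<^bsub>P\<^esub> (ksign s \<odot>\<^bsub>P\<^esub> y)"
    by (simp only: assms(3))
  then show ?thesis by (simp only: smult_smult[OF assms(1)] smult_smult[OF assms(2)] sq one assms(1,2))
qed

lemma keys_tens: "Poly_Mapping.keys (tens x y) \<subseteq> Poly_Mapping.keys x \<times> Poly_Mapping.keys y"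
proof -
  have "Poly_Mapping.keys (lin (\<lambda>c. Poly_Mapping.single (b, c) (1 :: Cq)) y) \<subseteq> {b} \<times> Poly_Mapping.keys y" for b
    using keys_lin[of "\<lambda>c. Poly_Mapping.single (b, c) 1" y] by auto
  then show ?thesis
    unfolding tens_lin using keys_lin[of "\<lambda>b. lin (\<lambda>c. Poly_Mapping.single (b, c) 1) y" x] by fastforce
qed

lemma keys_free_tens_mult:
  assumes "Poly_Mapping.keys x \<subseteq> lists G \<times> UNIV" "Poly_Mapping.keys y \<subseteq> lists G \<times> UNIV"
  shows "Poly_Mapping.keys (sprod (free_sa par \<otimes>\<^sub>s C) x y) \<subseteq> lists G \<times> UNIV"
proof -
  have b: "Poly_Mapping.keys (bmul (free_sa par \<otimes>\<^sub>s C) (v, p) (w, r)) \<subseteq> lists G \<times> UNIV"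
    if "v \<in> lists G" "w \<in> lists G" for v p w r
  proof -
    have eq: "bmul (free_sa par \<otimes>\<^sub>s C) (v, p) (w, r) =
        scale (ksign (bpar C p * word_par par w)) (Poly_Mapping.single (v @ w) 1 \<otimes>\<^sub>t bmul C p r)"
      by (simp add: tens_sa_def)
    show ?thesis
      unfolding eq by (intro keys_scale_lists subset_trans[OF keys_tens]) (use that in auto)
  qed
  show ?thesis
    unfolding sprod_lin
  proof (intro subset_trans[OF keys_lin] UN_least)
    fix k l assume "k \<in> Poly_Mapping.keys x" "l \<in> Poly_Mapping.keys y"
    then have "fst k \<in> lists G" "fst l \<in> lists G" using assms by auto
    from b[OF this, of "snd k" "snd l"]
    show "Poly_Mapping.keys (bmul (free_sa par \<otimes>\<^sub>s C) k l) \<subseteq> lists G \<times> UNIV" by simp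
  qed
qed

section \<open>Generators and coproduct of the quantum superalgebra\<close>

lemma keys_Lgen: "i \<in> idx n \<Longrightarrow> j \<in> idx n \<Longrightarrow> Poly_Mapping.keys (Lgen i j) \<subseteq> lists (Uq_gens n)"
  by (simp add: Lgen_def gen_def Uq_gens_def)

lemma presentation_Uq: "presentation pair_par (Uq_gens n) (Uq_rels n)"
proof
  let ?C = "{x. Poly_Mapping.keys x \<subseteq> lists (Uq_gens n) \<times> (UNIV :: ((int \<times> int) \<times> (int \<times> int)) set)}"
  have "Poly_Mapping.keys (Lgen i j \<otimes>\<^sub>t y) \<subseteq> lists (Uq_gens n) \<times> UNIV"
    if "i \<in> idx n" "j \<in> idx n" for i j and y :: "(int \<times> int) \<times> (int \<times> int) \<Rightarrow>\<^sub>0 Cq"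
    by (rule subset_trans[OF keys_tens Sigma_mono[OF keys_Lgen[OF that]]]) simp
  then have L: "L12 n \<in> ?C" "L13 n \<in> ?C"
    unfolding L12_def L13_def mem_Collect_eq by (intro keys_sum_subset; assumption)+
  have S: "put23 (Smat n) \<in> ?C"
    unfolding put23_def mem_Collect_eq by (rule keys_sum_subset) simp
  have coeff: "coeff1 p r x \<in> carrier (free_ring pair_par (Uq_gens n))" if "x \<in> ?C" for p r x
  proof -
    have "Poly_Mapping.lookup (coeff1 p r x) w = Poly_Mapping.lookup x (w, p, r)" for w
      unfolding coeff1_def by (subst map_key.rep_eq) (auto simp: inj_on_def)
    then show ?thesis using that by (auto simp: free_ring_simps in_keys_iff)
  qed
  have mult: "sprod (free_sa pair_par \<otimes>\<^sub>s mat_sa \<otimes>\<^sub>s mat_sa) x y \<in> ?C" if "x \<in> ?C" "y \<in> ?C" for x y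
    using that unfolding mem_Collect_eq by (rule keys_free_tens_mult)
  have "Lgen i i \<star>\<^bsub>free_sa pair_par\<^esub> Lgen (- i) (- i) - free_one \<in> carrier (free_ring pair_par (Uq_gens n))"
    if "i \<in> idx n" for i
    using that keys_Lgen[of _ n] by (intro free_ring_closed) (simp_all add: free_ring_simps)
  moreover have "coeff1 p r (L12 n \<star>\<^bsub>Uq_free \<otimes>\<^sub>s mat_sa \<otimes>\<^sub>s mat_sa\<^esub> L13 n \<star>\<^bsub>Uq_free \<otimes>\<^sub>s mat_sa \<otimes>\<^sub>s mat_sa\<^esub> put23 (Smat n))
      - coeff1 p r (put23 (Smat n) \<star>\<^bsub>Uq_free \<otimes>\<^sub>s mat_sa \<otimes>\<^sub>s mat_sa\<^esub> L13 n \<star>\<^bsub>Uq_free \<otimes>\<^sub>s mat_sa \<otimes>\<^sub>s mat_sa\<^esub> L12 n)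
      \<in> carrier (free_ring pair_par (Uq_gens n))" for p r
    by (intro free_ring_closed coeff mult L S)
  ultimately show "Uq_rels n \<subseteq> carrier (free_ring pair_par (Uq_gens n))"
    unfolding Uq_rels_def Let_def by (intro Un_least subsetI) (elim CollectE exE conjE; simp only:)+
qed

interpretation Uq: presentation pair_par "Uq_gens n" "Uq_rels n" for n
  by (rule presentation_Uq)

text \<open>The coproduct of L_ij is a combination of tensors L_il \<otimes> L_lj, in which the
  summands with i > l or l > j vanish. So both Sweedler components of a generator are generators
  again, and an induction over words can stay with single generators.\<close>

lemma keys_comul_gen:
  assumes "g \<in> Uq_gens n" "z \<in> Poly_Mapping.keys (comul n (gen g))"
  obtains g1 g2 where "g1 \<in> Uq_gens n" "g2 \<in> Uq_gens n" "z = ([g1], [g2])"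
proof -
  have "(\<lambda>x. sprod (free_sa pair_par \<otimes>\<^sub>s free_sa pair_par) x (free_one \<otimes>\<^sub>t free_one)) = (\<lambda>x. x)"
    by (rule linmap_ext; (intro linmap_intros)?)
      (auto simp: free_one_def tens_sa_def)
  then have one: "sprod (free_sa pair_par \<otimes>\<^sub>s free_sa pair_par) x (free_one \<otimes>\<^sub>t free_one) = x" for x
    by (rule fun_cong)
  have "comul n (gen g) = comul_gen n g"
    by (simp add: comul_def gen_def one)
  moreover have "Poly_Mapping.keys (comul_gen n g) \<subseteq> (\<lambda>(g1, g2). ([g1], [g2])) ` (Uq_gens n \<times> Uq_gens n)"
  proof -
    obtain i j where g: "g = (i, j)" "i \<in> idx n" "j \<in> idx n" using assms(1) by (auto simp: Uq_gens_def)
    have "Poly_Mapping.keys (Lgen i k \<otimes>\<^sub>t Lgen k j) \<subseteq> (\<lambda>(g1, g2). ([g1], [g2])) ` (Uq_gens n \<times> Uq_gens n)"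
      if "k \<in> idx n" for k
      using that g by (auto simp: Lgen_def gen_def Uq_gens_def linmap_zero[OF linmap_tens_left]
          linmap_zero[OF linmap_tens_right])
    then show ?thesis
      unfolding comul_gen_def g(1) split_conv by (intro keys_sum_subset keys_scale_lists)
  qed
  ultimately show ?thesis using assms(2) that by auto
qed

text \<open>Every class is a linear combination of classes of words, so a property stable under sums
  and scalars can be checked on words.\<close>

lemma (in presentation) cls_induct:
  assumes "x \<in> carrier P"
    and word: "\<And>w. w \<in> lists G \<Longrightarrow> Q (cls (Poly_Mapping.single w 1))"
    and add: "\<And>x y. x \<in> carrier P \<Longrightarrow> y \<in> carrier P \<Longrightarrow> Q x \<Longrightarrow> Q y \<Longrightarrow> Q (x \<oplus>\<^bsub>P\<^esub> y)"
    and smult: "\<And>c x. x \<in> carrier P \<Longrightarrow> Q x \<Longrightarrow> Q (c \<odot>\<^bsub>P\<^esub> x)"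
  shows "Q x"
proof -
  have w: "Poly_Mapping.single w 1 \<in> carrier F" if "w \<in> lists G" for w
    using that by (simp add: free_ring_simps)
  have sum: "(\<Sum>w\<in>S. scale (c w) (Poly_Mapping.single w 1)) \<in> carrier F \<and>
      Q (cls (\<Sum>w\<in>S. scale (c w) (Poly_Mapping.single w 1)))" if "finite S" "S \<subseteq> lists G" for S c
    using that
  proof (induction S rule: finite_induct)
    case empty
    \<comment> \<open>The zero class, which the empty sum requires, is obtained as 0 times the class
      of the empty word.\<close>
    have "Q (0 \<odot>\<^bsub>P\<^esub> cls (Poly_Mapping.single [] 1))"
      by (intro smult word cls_closed w) simp_all
    then show ?case by (simp add: cls_smult[OF w] free_ring_closed)
  next
    case (insert v S)
    let ?y = "\<Sum>w\<in>S. scale (c w) (Poly_Mapping.single w 1)"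
    have v: "Poly_Mapping.single v 1 \<in> carrier F" "v \<in> lists G" using insert.prems by (auto intro: w)
    have y: "?y \<in> carrier F" "Q (cls ?y)" using insert by auto
    have "Q ((c v \<odot>\<^bsub>P\<^esub> cls (Poly_Mapping.single v 1)) \<oplus>\<^bsub>P\<^esub> cls ?y)"
      by (intro add smult word smult_closed cls_closed v y)
    then have "Q (cls (scale (c v) (Poly_Mapping.single v 1) + ?y))"
      by (simp only: cls_smult[OF v(1)] cls_add[OF free_ring_closed(5)[OF v(1)] y(1)])
    moreover have "scale (c v) (Poly_Mapping.single v 1) + ?y \<in> carrier F"
      by (intro free_ring_closed v y)
    ultimately show ?case by (simp only: sum.insert[OF insert.hyps])
  qed
  obtain y where y: "y \<in> carrier F" "x = cls y" using assms(1) by (auto simp: carrier_P)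
  have "Q (cls (\<Sum>w\<in>Poly_Mapping.keys y. scale (Poly_Mapping.lookup y w) (Poly_Mapping.single w 1)))"
    using sum[of "Poly_Mapping.keys y"] y(1) by (simp add: free_ring_simps)
  then show ?thesis by (simp only: poly_mapping_sum_single y(2))
qed

section \<open>Equivariance of tau\<close>

context
  fixes k n :: nat and act act_pi \<tau>
  assumes Phi: "is_Phi k n act" and Phi_pi: "is_Phi_pi k n act_pi"
    and iso: "superalgebra_iso (Api_alg k n) (A_alg k n) \<tau>"
    and tau_class: "\<And>x. x \<in> carrier (free_ring pi_par (Api_gens k n)) \<Longrightarrow>
      \<tau> (Api_class k n x) = A_class k n (gen_subst tau_ix x)"
begin

interpretation M: Uq_supermodule_superalgebra n "A_alg k n" act
  using Phi by (simp add: is_Phi_def)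

interpretation N: Uq_supermodule_superalgebra n "Api_alg k n" act_pi
  using Phi_pi by (simp add: is_Phi_pi_def)

lemma tau_ring_hom: "ring_hom_ring (Api_alg k n) (A_alg k n) \<tau>"
  using iso by (intro ring_hom_ringI2 N.ring_axioms M.ring_axioms) (simp add: superalgebra_iso_def ring_iso_def)

interpretation \<tau>: ring_hom_ring "Api_alg k n" "A_alg k n" \<tau>
  by (rule tau_ring_hom)

lemma tau_smult:
  assumes "x \<in> carrier (Api_alg k n)"
  shows "\<tau> (c \<odot>\<^bsub>Api_alg k n\<^esub> x) = c \<odot>\<^bsub>A_alg k n\<^esub> \<tau> x"
proof -
  have "\<forall>c. \<forall>x\<in>carrier (Api_alg k n). \<tau> (c \<odot>\<^bsub>Api_alg k n\<^esub> x) = c \<odot>\<^bsub>A_alg k n\<^esub> \<tau> x"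
    using iso unfolding superalgebra_iso_def by (elim conjE)
  then show ?thesis using assms by simp
qed

lemma tau_hpart:
  assumes "x \<in> hpart (Api_alg k n) p"
  shows "\<tau> x \<in> hpart (A_alg k n) p"
proof -
  have "\<forall>p. \<tau> ` hpart (Api_alg k n) p \<subseteq> hpart (A_alg k n) p"
    using iso unfolding superalgebra_iso_def by (elim conjE)
  then show ?thesis using assms by (auto dest: spec[of _ p])
qed

text \<open>Each action is prescribed on generators by the entries of T^1 S^13.
  \<open>tau_gmat12_S_coeff\<close> matches the two prescriptions, and its minus sign is the one in
  tau(t^pi_ic) = -t_{i,-c}.\<close>

lemma act_gen_gen:
  assumes g: "g \<in> Uq_gens n" and h: "h \<in> Api_gens k n"
  shows "\<tau> (act_pi (Uq_class n (gen g)) (Api_class k n (gen h))) = act (Uq_class n (gen g)) (\<tau> (Api_class k n (gen h)))"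
proof -
  obtain a b where ab: "g = (a, b)" "a \<in> idx n" "b \<in> idx n" "a \<le> b" using g by (auto simp: Uq_gens_def)
  obtain i c where ic: "h = (i, c)" "i \<in> {1..int k}" "c \<in> idx n" using h unfolding Api_gens_def by blast
  have i: "i \<in> idx k" "ipar i = 0" using ic(2) by (simp_all add: range_in_idx ipar_pos)
  have c: "- c \<in> idx n" using ic(3) by simp
  have L: "Lgen a b = gen g" using ab by (simp add: Lgen_def)
  \<comment> \<open>For i > 0 the generators t^pi_ic and t_{i,-c} have the same parity, so both
    prescriptions carry the same sign, which can be cancelled at the end.\<close>
  define s where "s = (ipar a + ipar b) * pi_par (i, c)"
  have s: "(ipar a + ipar b) * pair_par (i, - c) = s"
    by (simp add: s_def pi_par_def pair_par_def i(2) ipar_uminus_idx[OF ic(3)])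
  define X1 where "X1 = act_pi (Uq_class n (gen g)) (Api_class k n (gen h))"
  define X2 where "X2 = act (Uq_class n (gen g)) (A_class k n (gen (i, - c)))"
  define E1 where "E1 = coeff2 (i, c) (a, b) (gmat12 {1..int k} n \<star>\<^bsub>mat_sa \<otimes>\<^sub>s free_sa pi_par \<otimes>\<^sub>s mat_sa\<^esub> put13 (Smat n))"
  define E2 where "E2 = coeff2 (i, - c) (a, b) (gmat12 (idx k) n \<star>\<^bsub>mat_sa \<otimes>\<^sub>s free_sa pair_par \<otimes>\<^sub>s mat_sa\<^esub> put13 (Smat n))"
  have u: "Uq_class n (gen g) \<in> carrier (Uq n)"
    unfolding Uq_class_def Uq_def using g by (intro Uq.cls_closed) (simp add: free_ring_simps gen_def)
  have genh: "gen h \<in> carrier (free_ring pi_par (Api_gens k n))"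
    using h by (simp add: free_ring_simps gen_def)
  have genc: "gen (i, - c) \<in> carrier (free_ring pair_par (A_gens k n))"
    using i ic by (simp add: free_ring_simps gen_def A_gens_def)
  have E1: "E1 \<in> carrier (free_ring pi_par (Api_gens k n))"
    unfolding E1_def gmat12_S_coeff[OF finite_atLeastAtMost_int ic(2) ab(2,3)] free_ring_simps mem_Collect_eq
    by (intro keys_sum_subset keys_scale_lists) (use ic in \<open>simp add: gen_def Api_gens_def\<close>)
  have E2: "E2 \<in> carrier (free_ring pair_par (A_gens k n))"
    unfolding E2_def gmat12_S_coeff[OF finite_idx i(1) ab(2,3)] free_ring_simps mem_Collect_eq
    by (intro keys_sum_subset keys_scale_lists) (use i in \<open>simp add: gen_def A_gens_def\<close>)
  have X1_closed: "X1 \<in> carrier (Api_alg k n)"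
    unfolding X1_def using u Api.cls_closed[OF genh]
    by (intro N.act_closed) (simp_all add: Api_class_def Api_alg_def)
  have c2: "A_class k n (gen (i, - c)) \<in> carrier (A_alg k n)"
    using A.cls_closed[OF genc] by (simp add: A_class_def A_alg_def)
  have X2_closed: "X2 \<in> carrier (A_alg k n)"
    unfolding X2_def by (intro M.act_closed u c2)
  have "L_acts_by_S pi_par {1..int k} n (Api_alg k n) (Api_class k n) act_pi"
    using Phi_pi unfolding is_Phi_pi_def by (rule conjunct2)
  from this[unfolded L_acts_by_S_def, THEN bspec, OF ic(2), THEN bspec, OF ic(3), THEN bspec, OF ab(2),
      THEN bspec, OF ab(3)]
  have L1: "ksign s \<odot>\<^bsub>Api_alg k n\<^esub> X1 = Api_class k n E1"
    unfolding L s_def[symmetric] E1_def[symmetric] unfolding ic(1)[symmetric] X1_def[symmetric] .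
  have "L_acts_by_S pair_par (idx k) n (A_alg k n) (A_class k n) act"
    using Phi unfolding is_Phi_def by (rule conjunct2)
  from this[unfolded L_acts_by_S_def, THEN bspec, OF i(1), THEN bspec, OF c, THEN bspec, OF ab(2),
      THEN bspec, OF ab(3)]
  have L2: "ksign s \<odot>\<^bsub>A_alg k n\<^esub> X2 = A_class k n E2"
    unfolding L s E2_def[symmetric] X2_def[symmetric] .
  have "ksign s \<odot>\<^bsub>A_alg k n\<^esub> \<tau> X1 = A_class k n (gen_subst tau_ix E1)"
    by (simp only: tau_smult[OF X1_closed, symmetric] L1 tau_class[OF E1])
  also have "gen_subst tau_ix E1 = scale (- 1) E2"
    unfolding E1_def E2_def tau_gmat12_S_coeff[OF ic(2,3) ab(2,3)] by (simp add: pm.scale_minus_left)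
  also have "A_class k n (scale (- 1) E2) = (- 1) \<odot>\<^bsub>A_alg k n\<^esub> (ksign s \<odot>\<^bsub>A_alg k n\<^esub> X2)"
    unfolding L2 using A.cls_smult[OF E2, of "- 1"] by (simp add: A_class_def A_alg_def)
  also have "\<dots> = ksign s \<odot>\<^bsub>A_alg k n\<^esub> ((- 1) \<odot>\<^bsub>A_alg k n\<^esub> X2)"
    using X2_closed unfolding A_alg_def by (simp add: A.smult_smult)
  finally have eq: "ksign s \<odot>\<^bsub>A_alg k n\<^esub> \<tau> X1
      = ksign s \<odot>\<^bsub>A_alg k n\<^esub> ((- 1) \<odot>\<^bsub>A_alg k n\<^esub> X2)" .
  have "(- 1) \<odot>\<^bsub>A_alg k n\<^esub> X2 \<in> carrier (A_alg k n)"
    using X2_closed unfolding A_alg_def by (rule A.smult_closed)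
  with \<tau>.hom_closed[OF X1_closed] have "\<tau> X1 = (- 1) \<odot>\<^bsub>A_alg k n\<^esub> X2"
    using eq unfolding A_alg_def by (rule A.smult_ksign_cancel)
  also have "\<dots> = act (Uq_class n (gen g)) ((- 1) \<odot>\<^bsub>A_alg k n\<^esub> A_class k n (gen (i, - c)))"
    unfolding X2_def by (rule M.act_smult_right[OF u c2, symmetric])
  also have "(- 1) \<odot>\<^bsub>A_alg k n\<^esub> A_class k n (gen (i, - c)) = \<tau> (Api_class k n (gen h))"
    unfolding tau_class[OF genh] A_class_def A_alg_def A.cls_smult[OF genc]
    by (simp add: ic(1) gen_def gen_subst_single tau_ix_def scale_single)
  finally show ?thesis unfolding X1_def .
qed

text \<open>Induction over the word with \<open>g\<close> kept general: the coproduct of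
  \<open>g\<close> splits the action on a product h w into generators acting on h, covered by
  \<open>act_gen_gen\<close>, and possibly different generators acting on w, covered by the
  induction hypothesis. The empty word is handled by the counit.\<close>

lemma act_gen:
  assumes "w \<in> lists (Api_gens k n)" and "g \<in> Uq_gens n"
  shows "\<tau> (act_pi (Uq_class n (gen g)) (Api_class k n (Poly_Mapping.single w 1)))
    = act (Uq_class n (gen g)) (\<tau> (Api_class k n (Poly_Mapping.single w 1)))"
  using assms
proof (induction w arbitrary: g)
  case Nil
  have one: "Api_class k n (Poly_Mapping.single [] 1) = \<one>\<^bsub>Api_alg k n\<^esub>"
    unfolding Api_class_def Api_alg_def Api.cls_one free_one_def ..
  have keys: "Poly_Mapping.keys (gen g) \<subseteq> lists (Uq_gens n)" using Nil by (simp add: gen_def)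
  show ?case
    unfolding one \<tau>.hom_one N.act_unit[OF keys] M.act_unit[OF keys] tau_smult[OF N.one_closed] ..
next
  case (Cons h w)
  define x where "x = Api_class k n (gen h)"
  define y where "y = Api_class k n (Poly_Mapping.single w 1)"
  have w: "w \<in> lists (Api_gens k n)" and h: "h \<in> Api_gens k n" using Cons.hyps by auto
  have genh: "gen h \<in> carrier (free_ring pi_par (Api_gens k n))"
    using h by (simp add: free_ring_simps gen_def)
  have wc: "Poly_Mapping.single w 1 \<in> carrier (free_ring pi_par (Api_gens k n))"
    using w by (simp add: free_ring_simps)
  have xy: "Api_class k n (Poly_Mapping.single (h # w) 1) = x \<otimes>\<^bsub>Api_alg k n\<^esub> y"
    unfolding x_def y_def Api_class_def Api_alg_def Api.cls_mult[OF genh wc] by (simp add: gen_def)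
  \<comment> \<open>The sign in \<open>act_prod\<close> depends on the parity of the left factor. As
    tau preserves parity, the expansions on both sides have identical coefficients.\<close>
  have x: "x \<in> hpart (Api_alg k n) (pi_par h)"
    unfolding x_def Api_class_def Api_alg_def Api.hpart_P using genh by (simp add: homogeneous_def gen_def)
  have xc: "x \<in> carrier (Api_alg k n)" and yc: "y \<in> carrier (Api_alg k n)"
    unfolding x_def y_def Api_class_def Api_alg_def by (rule Api.cls_closed genh wc)+
  have keys: "Poly_Mapping.keys (gen g) \<subseteq> lists (Uq_gens n)" using Cons.prems by (simp add: gen_def)
  let ?K = "Poly_Mapping.keys (comul n (gen g))"
  let ?c = "\<lambda>z. Poly_Mapping.lookup (comul n (gen g)) z * ksign (word_par pair_par (snd z) * pi_par h)"
  let ?u = "\<lambda>v. Uq_class n (Poly_Mapping.single v 1)"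
  have acts: "act_pi (?u (fst z)) x \<in> carrier (Api_alg k n)" "act_pi (?u (snd z)) y \<in> carrier (Api_alg k n)"
    "\<tau> (act_pi (?u (fst z)) x) = act (?u (fst z)) (\<tau> x)" "\<tau> (act_pi (?u (snd z)) y) = act (?u (snd z)) (\<tau> y)"
    if "z \<in> ?K" for z
  proof -
    obtain g1 g2 where g12: "g1 \<in> Uq_gens n" "g2 \<in> Uq_gens n" "z = ([g1], [g2])"
      using keys_comul_gen[OF Cons.prems \<open>z \<in> ?K\<close>] .
    then have u: "?u (fst z) = Uq_class n (gen g1)" "?u (snd z) = Uq_class n (gen g2)"
      by (simp_all add: gen_def)
    have uc: "Uq_class n (gen g1) \<in> carrier (Uq n)" "Uq_class n (gen g2) \<in> carrier (Uq n)"
      unfolding Uq_class_def Uq_def using g12 by (auto intro!: Uq.cls_closed simp: free_ring_simps gen_def)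
    show "act_pi (?u (fst z)) x \<in> carrier (Api_alg k n)" "act_pi (?u (snd z)) y \<in> carrier (Api_alg k n)"
      unfolding u by (intro N.act_closed uc xc yc)+
    show "\<tau> (act_pi (?u (fst z)) x) = act (?u (fst z)) (\<tau> x)"
      unfolding u x_def by (rule act_gen_gen[OF g12(1) h])
    show "\<tau> (act_pi (?u (snd z)) y) = act (?u (snd z)) (\<tau> y)"
      unfolding u y_def by (rule Cons.IH[OF g12(2)])
  qed
  let ?f = "\<lambda>z. ?c z \<odot>\<^bsub>Api_alg k n\<^esub> (act_pi (?u (fst z)) x \<otimes>\<^bsub>Api_alg k n\<^esub> act_pi (?u (snd z)) y)"
  let ?f' = "\<lambda>z. ?c z \<odot>\<^bsub>A_alg k n\<^esub> (act (?u (fst z)) (\<tau> x) \<otimes>\<^bsub>A_alg k n\<^esub> act (?u (snd z)) (\<tau> y))"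
  have fc: "?f z \<in> carrier (Api_alg k n)" if "z \<in> ?K" for z
    using N.m_closed[OF acts(1,2)[OF that]] unfolding Api_alg_def by (rule Api.smult_closed)
  have ff': "\<tau> (?f z) = ?f' z" if "z \<in> ?K" for z
    by (simp only: tau_smult[OF N.m_closed[OF acts(1,2)[OF that]]] \<tau>.hom_mult[OF acts(1,2)[OF that]] acts(3,4)[OF that])
  have "\<tau> (act_pi (Uq_class n (gen g)) (x \<otimes>\<^bsub>Api_alg k n\<^esub> y)) = \<tau> (finsum (Api_alg k n) ?f ?K)"
    by (simp only: N.act_prod[OF keys x yc])
  also have "\<dots> = finsum (A_alg k n) (\<tau> \<circ> ?f) ?K"
    using fc by (intro \<tau>.hom_finsum) auto
  also have "\<dots> = finsum (A_alg k n) ?f' ?K"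
  proof (rule abelian_monoid.finsum_cong'[OF
        abelian_group.axioms(1)[OF ring.is_abelian_group[OF M.ring_axioms]] refl])
    show "?f' \<in> ?K \<rightarrow> carrier (A_alg k n)"
    proof (rule Pi_I)
      fix z assume z: "z \<in> ?K"
      show "?f' z \<in> carrier (A_alg k n)"
        using \<tau>.hom_closed[OF fc[OF z]] by (simp only: ff'[OF z])
    qed
    show "(\<tau> \<circ> ?f) z = ?f' z" if "z \<in> ?K" for z
      by (simp only: o_def ff'[OF that])
  qed
  also have "\<dots> = act (Uq_class n (gen g)) (\<tau> x \<otimes>\<^bsub>A_alg k n\<^esub> \<tau> y)"
    by (rule M.act_prod[OF keys tau_hpart[OF x] \<tau>.hom_closed[OF yc], symmetric])
  finally show ?case unfolding xy \<tau>.hom_mult[OF xc yc] .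
qed

lemma act_gen_all:
  assumes g: "g \<in> Uq_gens n" and "x \<in> carrier (Api_alg k n)"
  shows "\<tau> (act_pi (Uq_class n (gen g)) x) = act (Uq_class n (gen g)) (\<tau> x)"
proof -
  have u: "Uq_class n (gen g) \<in> carrier (Uq n)"
    unfolding Uq_class_def Uq_def using g by (intro Uq.cls_closed) (simp add: free_ring_simps gen_def)
  show ?thesis
    using assms(2) unfolding Api_alg_def
  proof (rule Api.cls_induct[where Q = "\<lambda>x. \<tau> (act_pi (Uq_class n (gen g)) x) = act (Uq_class n (gen g)) (\<tau> x)"];
      fold Api_alg_def Api_class_def)
    show "\<tau> (act_pi (Uq_class n (gen g)) (Api_class k n (Poly_Mapping.single w 1))) =
      act (Uq_class n (gen g)) (\<tau> (Api_class k n (Poly_Mapping.single w 1)))" if "w \<in> lists (Api_gens k n)" for w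
      using that g by (rule act_gen)
  next
    fix x y assume x: "x \<in> carrier (Api_alg k n)" and y: "y \<in> carrier (Api_alg k n)"
      and IH: "\<tau> (act_pi (Uq_class n (gen g)) x) = act (Uq_class n (gen g)) (\<tau> x)"
        "\<tau> (act_pi (Uq_class n (gen g)) y) = act (Uq_class n (gen g)) (\<tau> y)"
    show "\<tau> (act_pi (Uq_class n (gen g)) (x \<oplus>\<^bsub>Api_alg k n\<^esub> y)) =
      act (Uq_class n (gen g)) (\<tau> (x \<oplus>\<^bsub>Api_alg k n\<^esub> y))"
      by (simp only: N.act_add_right[OF u x y] \<tau>.hom_add[OF N.act_closed[OF u x] N.act_closed[OF u y]] IH
        \<tau>.hom_add[OF x y] M.act_add_right[OF u \<tau>.hom_closed[OF x] \<tau>.hom_closed[OF y]])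
  next
    fix c x assume x: "x \<in> carrier (Api_alg k n)"
      and IH: "\<tau> (act_pi (Uq_class n (gen g)) x) = act (Uq_class n (gen g)) (\<tau> x)"
    show "\<tau> (act_pi (Uq_class n (gen g)) (c \<odot>\<^bsub>Api_alg k n\<^esub> x)) =
      act (Uq_class n (gen g)) (\<tau> (c \<odot>\<^bsub>Api_alg k n\<^esub> x))"
      by (simp only: N.act_smult_right[OF u x] tau_smult[OF N.act_closed[OF u x]] IH
        tau_smult[OF x] M.act_smult_right[OF u \<tau>.hom_closed[OF x]])
  qed
qed

text \<open>A word acts as the composite of the actions of its letters, so
  \<open>act_gen_all\<close> is applied once for each letter; it has to hold on the whole algebra,
  because the remaining letters act before the first one.\<close>

lemma act_word:
  assumes "w \<in> lists (Uq_gens n)"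
  shows "Uq_class n (Poly_Mapping.single w 1) \<in> carrier (Uq n) \<and> (\<forall>x\<in>carrier (Api_alg k n).
    \<tau> (act_pi (Uq_class n (Poly_Mapping.single w 1)) x) = act (Uq_class n (Poly_Mapping.single w 1)) (\<tau> x))"
  using assms
proof induction
  case Nil
  have one: "Uq_class n (Poly_Mapping.single [] 1) = \<one>\<^bsub>Uq n\<^esub>"
    unfolding Uq_class_def Uq_def Uq.cls_one free_one_def ..
  show ?case unfolding one using N.act_one M.act_one \<tau>.hom_closed by simp
next
  case (Cons g w)
  have gc: "gen g \<in> carrier (free_ring pair_par (Uq_gens n))"
    and wc: "Poly_Mapping.single w 1 \<in> carrier (free_ring pair_par (Uq_gens n))"
    using Cons.hyps by (simp_all add: free_ring_simps gen_def)
  have u: "Uq_class n (gen g) \<in> carrier (Uq n)" and v: "Uq_class n (Poly_Mapping.single w 1) \<in> carrier (Uq n)"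
    unfolding Uq_class_def Uq_def by (rule Uq.cls_closed gc wc)+
  have uv: "Uq_class n (Poly_Mapping.single (g # w) 1) =
      Uq_class n (gen g) \<otimes>\<^bsub>Uq n\<^esub> Uq_class n (Poly_Mapping.single w 1)"
    unfolding Uq_class_def Uq_def Uq.cls_mult[OF gc wc] by (simp add: gen_def)
  have "\<tau> (act_pi (Uq_class n (gen g) \<otimes>\<^bsub>Uq n\<^esub> Uq_class n (Poly_Mapping.single w 1)) x) =
      act (Uq_class n (gen g) \<otimes>\<^bsub>Uq n\<^esub> Uq_class n (Poly_Mapping.single w 1)) (\<tau> x)"
    if x: "x \<in> carrier (Api_alg k n)" for x
  proof -
    have "\<tau> (act_pi (Uq_class n (Poly_Mapping.single w 1)) x) = act (Uq_class n (Poly_Mapping.single w 1)) (\<tau> x)"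
      using Cons.IH x by blast
    then show ?thesis
      by (simp only: N.act_mult[OF u v x] M.act_mult[OF u v \<tau>.hom_closed[OF x]]
        act_gen_all[OF Cons.hyps(1) N.act_closed[OF v x]])
  qed
  moreover have "Uq_class n (Poly_Mapping.single (g # w) 1) \<in> carrier (Uq n)"
    unfolding Uq_class_def Uq_def using Cons.hyps by (intro Uq.cls_closed) (simp add: free_ring_simps)
  ultimately show ?case unfolding uv by blast
qed

lemma tau_equivariant:
  assumes "u \<in> carrier (Uq n)" and x: "x \<in> carrier (Api_alg k n)"
  shows "\<tau> (act_pi u x) = act u (\<tau> x)"
  using assms(1) unfolding Uq_def
proof (rule Uq.cls_induct[where Q = "\<lambda>u. \<tau> (act_pi u x) = act u (\<tau> x)"]; fold Uq_def Uq_class_def)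
  show "\<tau> (act_pi (Uq_class n (Poly_Mapping.single w 1)) x) = act (Uq_class n (Poly_Mapping.single w 1)) (\<tau> x)"
    if "w \<in> lists (Uq_gens n)" for w
    using act_word[OF that] x by blast
next
  fix u v assume u: "u \<in> carrier (Uq n)" and v: "v \<in> carrier (Uq n)"
    and IH: "\<tau> (act_pi u x) = act u (\<tau> x)" "\<tau> (act_pi v x) = act v (\<tau> x)"
  show "\<tau> (act_pi (u \<oplus>\<^bsub>Uq n\<^esub> v) x) = act (u \<oplus>\<^bsub>Uq n\<^esub> v) (\<tau> x)"
    by (simp only: N.act_add_left[OF u v x] \<tau>.hom_add[OF N.act_closed[OF u x] N.act_closed[OF v x]] IH
      M.act_add_left[OF u v \<tau>.hom_closed[OF x]])
next
  fix c u assume u: "u \<in> carrier (Uq n)" and IH: "\<tau> (act_pi u x) = act u (\<tau> x)"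
  show "\<tau> (act_pi (c \<odot>\<^bsub>Uq n\<^esub> u) x) = act (c \<odot>\<^bsub>Uq n\<^esub> u) (\<tau> x)"
    by (simp only: N.act_smult_left[OF u x] tau_smult[OF N.act_closed[OF u x]] IH
      M.act_smult_left[OF u \<tau>.hom_closed[OF x]])
qed

end

text \<open>Applying tau to the second tensor factor is expressed by comparing classes of entries at
  each matrix unit \<open>p\<close>. The map tau is chosen before the two actions, so that one
  isomorphism serves every pair of actions with the prescribed values on generators.\<close>

theorem proposition3p11:
  fixes k n :: nat
  assumes "k \<ge> 1" and "n \<ge> 1"
  shows "\<exists>\<tau>. superalgebra_iso (Api_alg k n) (A_alg k n) \<tau> \<and>
    (\<forall>p. \<tau> (Api_class k n (entry p (Tcheck_plus k n))) =
         A_class k n (entry p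
           (T_plus k n \<star>\<^bsub>mat_sa \<otimes>\<^sub>s free_sa pair_par\<^esub> (Jmat n \<otimes>\<^sub>t free_one)))) \<and>
    (\<forall>\<Phi> \<Phi>\<^sub>\<pi>. is_Phi k n \<Phi> \<longrightarrow> is_Phi_pi k n \<Phi>\<^sub>\<pi> \<longrightarrow>
       Uq_supermodule_superalgebra_iso n (Api_alg k n) \<Phi>\<^sub>\<pi> (A_alg k n) \<Phi> \<tau>)"
proof -
  obtain \<tau> where iso: "superalgebra_iso (Api_alg k n) (A_alg k n) \<tau>"
    and cls: "\<And>x. x \<in> carrier (free_ring pi_par (Api_gens k n)) \<Longrightarrow>
      \<tau> (Api_class k n x) = A_class k n (gen_subst tau_ix x)"
    using tau_exists by metis
  have "Uq_supermodule_superalgebra_iso n (Api_alg k n) act_pi (A_alg k n) act \<tau>"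
    if "is_Phi k n act" "is_Phi_pi k n act_pi" for act act_pi
    unfolding Uq_supermodule_superalgebra_iso_def
    using that iso tau_equivariant[OF that iso cls] by (simp add: is_Phi_def is_Phi_pi_def)
  moreover have "\<tau> (Api_class k n (entry p (Tcheck_plus k n))) = A_class k n (entry p
      (T_plus k n \<star>\<^bsub>mat_sa \<otimes>\<^sub>s free_sa pair_par\<^esub> (Jmat n \<otimes>\<^sub>t free_one)))" for p
    unfolding entry_T_plus_J by (rule cls[OF entry_Tcheck_closed])
  ultimately show ?thesis using iso by blast
qed

end
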